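(* Let $E$ be an elliptic curve over $\mathbb{C}$ with complex multiplication such that $j(E)\in\mathbb{R}$. Let $\mathcal{J}(\mathbb{R},E)\subset\mathbb{R}$ be the set of all $j(E')$, where $E'$ ranges over the elliptic curves over $\mathbb{C}$ such that (1) $E'$ is isogenous to $E$, (2) $j(E')\in\mathbb{R}$, and (3) $E'$ has the same parity as $E$ (i.e., $E'$ is odd if and only if $E$ is odd). Then the closure of $\mathcal{J}(\mathbb{R},E)$ in $\mathbb{R}$ is the closed half-line $(-\infty,1728]$ if $E$ is odd, and is all of $\mathbb{R}$ if $E$ is even.
   Context: For an order $O$ in a quadratic field $K$, its discriminant $\mathrm{discr}(O)\in\mathbb{Z}$ is the discriminant of the trace form $(a,b)\mapsto \mathrm{tr}_{K/\mathbb{Q}}(ab)$ on $O$. The order $O$ is called odd (resp. even) if $\mathrm{discr}(O)$ is an odd (resp. even) integer. If $E$ is an elliptic curve over $\mathbb{C}$ with complex multiplication, then $\mathrm{End}(E)$ is an order in the imaginary quadratic field $\mathrm{End}(E)\otimes\mathbb{Q}$; $E$ is called odd (resp. even) if the order $\mathrm{End}(E)$ is odd (resp. even). $j(E)$ denotes the $j$-invariant. *)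

theory Defs
  imports
    "HOL-Analysis.Analysis"
    "HOL-Algebra.Ring"
    "HOL-Computational_Algebra.Polynomial"
begin

section \<open>Elliptic curves over the complex numbers\<close>

text \<open>
  Since the characteristic is 0, an elliptic curve is given by a short Weierstrass
  equation \<open>y\<^sup>2 = x\<^sup>3 + a x + b\<close>, together with its point at infinity.
\<close>

datatype weierstrass = Weierstrass (coeff_a: complex) (coeff_b: complex)

definition elliptic_curve :: "weierstrass \<Rightarrow> bool" where
  "elliptic_curve E \<longleftrightarrow> 4 * coeff_a E ^ 3 + 27 * coeff_b E ^ 2 \<noteq> 0"

definition j_inv :: "weierstrass \<Rightarrow> complex" where
  "j_inv E = 1728 * (4 * coeff_a E ^ 3) / (4 * coeff_a E ^ 3 + 27 * coeff_b E ^ 2)"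

datatype ec_point = Infinity | Affine complex complex

definition ec_points :: "weierstrass \<Rightarrow> ec_point set" where
  "ec_points E =
     insert Infinity {Affine x y | x y. y ^ 2 = x ^ 3 + coeff_a E * x + coeff_b E}"

text \<open>The chord-and-tangent law; \<open>l\<close> is the slope of the chord or tangent.\<close>

fun ec_add :: "weierstrass \<Rightarrow> ec_point \<Rightarrow> ec_point \<Rightarrow> ec_point" where
  "ec_add E Infinity Q = Q"
| "ec_add E P Infinity = P"
| "ec_add E (Affine x1 y1) (Affine x2 y2) =
     (if x1 = x2 \<and> y1 = - y2 then Infinity
      else let l = (if x1 = x2 then (3 * x1 ^ 2 + coeff_a E) / (2 * y1)
                    else (y2 - y1) / (x2 - x1));
               x3 = l ^ 2 - x1 - x2
           in Affine x3 (l * (x1 - x3) - y1))"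

definition ec_group :: "weierstrass \<Rightarrow> ec_point monoid" where
  "ec_group E = \<lparr>carrier = ec_points E, mult = ec_add E, one = Infinity\<rparr>"


section \<open>Homomorphisms, isogenies and the endomorphism ring\<close>

text \<open>An element of \<open>\<complex>[x][y]\<close> (the outer variable is \<open>y\<close>), evaluated at a point.\<close>

definition poly_xy :: "complex poly poly \<Rightarrow> complex \<Rightarrow> complex \<Rightarrow> complex" where
  "poly_xy p x y = poly (poly p [:y:]) x"

text \<open>
  A map given by rational functions \<open>p1 / q\<close>, \<open>p2 / q\<close> (over a common denominator that
  does not vanish identically on the curve) at the affine points where \<open>q\<close> is nonzero.
  The finitely many remaining values are not constrained by this condition; they are
  determined once the map is required to be a group homomorphism, as in \<open>ec_hom\<close>.
\<close>

definition given_by_rational_functions ::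
  "weierstrass \<Rightarrow> (ec_point \<Rightarrow> ec_point) \<Rightarrow> bool" where
  "given_by_rational_functions E f \<longleftrightarrow>
     (\<exists>p1 p2 q.
        (\<exists>x y. Affine x y \<in> ec_points E \<and> poly_xy q x y \<noteq> 0) \<and>
        (\<forall>x y. Affine x y \<in> ec_points E \<longrightarrow> poly_xy q x y \<noteq> 0 \<longrightarrow>
           f (Affine x y) =
             Affine (poly_xy p1 x y / poly_xy q x y) (poly_xy p2 x y / poly_xy q x y)))"

definition ec_zero_hom :: "weierstrass \<Rightarrow> ec_point \<Rightarrow> ec_point" where
  "ec_zero_hom E = (\<lambda>P\<in>ec_points E. Infinity)"

text \<open>
  \<open>Hom(E, E')\<close>: the homomorphisms of algebraic groups, as functions on complex points.
  The zero map has no description by affine rational functions and is added separately.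
\<close>

definition ec_hom :: "weierstrass \<Rightarrow> weierstrass \<Rightarrow> (ec_point \<Rightarrow> ec_point) set" where
  "ec_hom E E' =
     {f \<in> hom (ec_group E) (ec_group E') \<inter> extensional (ec_points E).
        f = ec_zero_hom E \<or> given_by_rational_functions E f}"

definition isogeny :: "weierstrass \<Rightarrow> weierstrass \<Rightarrow> (ec_point \<Rightarrow> ec_point) \<Rightarrow> bool" where
  "isogeny E E' f \<longleftrightarrow> f \<in> ec_hom E E' \<and> f \<noteq> ec_zero_hom E"

definition isogenous :: "weierstrass \<Rightarrow> weierstrass \<Rightarrow> bool" where
  "isogenous E E' \<longleftrightarrow> (\<exists>f. isogeny E E' f)"

definition End_ring :: "weierstrass \<Rightarrow> (ec_point \<Rightarrow> ec_point) ring" where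
  "End_ring E =
     \<lparr>carrier = ec_hom E E,
      mult = compose (ec_points E),
      one = (\<lambda>P\<in>ec_points E. P),
      zero = ec_zero_hom E,
      add = (\<lambda>f g. \<lambda>P\<in>ec_points E. ec_add E (f P) (g P))\<rparr>"

text \<open>Complex multiplication: \<open>\<int> \<rightarrow> End(E)\<close> is not surjective.\<close>

definition has_CM :: "weierstrass \<Rightarrow> bool" where
  "has_CM E \<longleftrightarrow>
     (\<exists>f\<in>carrier (End_ring E). \<forall>n::int. f \<noteq> [n] \<cdot>\<^bsub>End_ring E\<^esub> \<one>\<^bsub>End_ring E\<^esub>)"


section \<open>Discriminant of a quadratic order\<close>

text \<open>
  For an order \<open>R\<close> in a quadratic field \<open>K\<close>, a \<open>\<int>\<close>-basis of \<open>R\<close> is a \<open>\<rat>\<close>-basis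
  of \<open>K = R \<otimes> \<rat>\<close>, so for \<open>x \<in> R\<close> the trace of \<open>x\<close> from \<open>K\<close> to \<open>\<rat>\<close> is the trace
  of the integer matrix of multiplication by \<open>x\<close> in such a basis.
\<close>

definition Z_basis :: "('a, 'b) ring_scheme \<Rightarrow> 'a \<Rightarrow> 'a \<Rightarrow> bool" where
  "Z_basis R u v \<longleftrightarrow> u \<in> carrier R \<and> v \<in> carrier R \<and>
     (\<forall>x\<in>carrier R. \<exists>!c::int \<times> int. x = [fst c] \<cdot>\<^bsub>R\<^esub> u \<oplus>\<^bsub>R\<^esub> [snd c] \<cdot>\<^bsub>R\<^esub> v)"

definition Z_coords :: "('a, 'b) ring_scheme \<Rightarrow> 'a \<Rightarrow> 'a \<Rightarrow> 'a \<Rightarrow> int \<times> int" where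
  "Z_coords R u v x = (THE c. x = [fst c] \<cdot>\<^bsub>R\<^esub> u \<oplus>\<^bsub>R\<^esub> [snd c] \<cdot>\<^bsub>R\<^esub> v)"

definition order_trace :: "('a, 'b) ring_scheme \<Rightarrow> 'a \<Rightarrow> 'a \<Rightarrow> 'a \<Rightarrow> int" where
  "order_trace R u v x =
     fst (Z_coords R u v (x \<otimes>\<^bsub>R\<^esub> u)) + snd (Z_coords R u v (x \<otimes>\<^bsub>R\<^esub> v))"

text \<open>
  The determinant of the Gram matrix of the trace form; it does not depend on the basis,
  so the description below is proper whenever \<open>R\<close> is an order in a quadratic field.
\<close>

definition order_discr :: "('a, 'b) ring_scheme \<Rightarrow> int" where
  "order_discr R = (THE d. \<exists>u v. Z_basis R u v \<and>
     d = order_trace R u v (u \<otimes>\<^bsub>R\<^esub> u) * order_trace R u v (v \<otimes>\<^bsub>R\<^esub> v)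
         - order_trace R u v (u \<otimes>\<^bsub>R\<^esub> v) * order_trace R u v (v \<otimes>\<^bsub>R\<^esub> u))"

definition odd_curve :: "weierstrass \<Rightarrow> bool" where
  "odd_curve E \<longleftrightarrow> odd (order_discr (End_ring E))"

definition even_curve :: "weierstrass \<Rightarrow> bool" where
  "even_curve E \<longleftrightarrow> even (order_discr (End_ring E))"


section \<open>Real j-invariants in an isogeny class\<close>

definition real_j_set :: "weierstrass \<Rightarrow> real set" where
  "real_j_set E =
     {r. \<exists>E'. elliptic_curve E' \<and> isogenous E' E \<and> j_inv E' = complex_of_real r \<and>
            (odd_curve E' \<longleftrightarrow> odd_curve E)}"

end

theory Submission
  imports Defs "HOL-Complex_Analysis.Complex_Analysis"
begin

text \<open>
  For a lattice \<open>\<Lambda> = \<int> + \<int> \<tau>\<close>, a quotient of two theta products gives a function \<open>D\<close> whose square is elliptic,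
  and Liouville's theorem yields the differential equation \<open>c\<^sup>2 D'\<^sup>2 = D\<^sup>4 - m D\<^sup>2 + 1\<close>. Hence \<open>\<complex> / \<Lambda>\<close> is the curve
  \<open>Y\<^sup>2 = X\<^sup>3 - m X\<^sup>2 + X\<close>, where \<open>m = \<kappa> + 1 / \<kappa>\<close> and \<open>\<kappa>\<close> is an explicit product in \<open>s = exp (\<pi> \<i> \<tau>)\<close>.
  Differentiating along \<open>z + w = const\<close> shows that the chord construction only depends on \<open>z + w\<close>, which is the
  addition theorem. Algebraic homomorphisms are then the multiplications by complex numbers that map one
  lattice into the other.

  On the lines \<open>Re \<tau> = 0\<close> and \<open>Re \<tau> = 1 / 2\<close> the number \<open>m\<close> is real, and by the intermediate value theorem
  \<open>j\<close> takes all values in \<open>[1728, \<infinity>)\<close> and in \<open>(-\<infinity>, 1728)\<close>, respectively. If \<open>A \<tau>\<^sup>2 + B \<tau> + C = 0\<close> is primitive,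
  then the order has discriminant \<open>B\<^sup>2 - 4 A C\<close>, so its parity is that of \<open>B\<close>. On the line \<open>Re \<tau> = 0\<close> one has
  \<open>B = 0\<close>, so odd curves only occur for \<open>j \<le> 1728\<close>. Conversely, fractions with odd numerator and odd
  denominator are dense, and they give isogenous curves of the required parity on a dense subset of these lines.
\<close>


section \<open>Infinite products\<close>

text \<open>The given curves are abstract Weierstrass equations, so each needs a lattice. This is
  found through j alone: j is the rational function 256 (m^2 - 3)^3 / (m^2 - 4) of m, and as soon as
  some \<tau> has the required j, a twist carries the theta parametrization over to the given
  equation. For real j the two lines supply such a \<tau>.

  D is preferred to x itself because of its symmetries: \<open>qD (z + \<tau>) = - qD z\<close> and
  \<open>qD (z + 1 / 2) = 1 / qD z\<close> make the quartic even and reciprocal, which leaves the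
  single parameter m, and complex conjugation acts visibly on the product for \<kappa>.

  The discriminant condition m^2 \<noteq> 4 is carried along as a hypothesis on \<tau>. It is
  verified at the points delivered by the intermediate value theorem and persists near them by
  continuity.\<close>

definition qprod :: "complex \<Rightarrow> complex \<Rightarrow> complex" where
  "qprod q u = (\<Prod>n. 1 - q ^ n * u)"

lemma abs_convergent_qprod:
  fixes q u :: complex
  assumes "norm q < 1"
  shows "abs_convergent_prod (\<lambda>n. 1 - q ^ n * u)"
proof -
  have "summable (\<lambda>n. norm q ^ n * norm u)"
    using assms by (intro summable_mult2 summable_geometric) auto
  moreover have "norm ((1 - q ^ n * u) - 1) = norm q ^ n * norm u" for n
    by (simp add: norm_mult norm_power)
  ultimately have "summable (\<lambda>n. norm ((1 - q ^ n * u) - 1))"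
    by presburger
  thus ?thesis by (subst abs_convergent_prod_conv_summable)
qed

lemma convergent_qprod:
  fixes q u :: complex
  assumes "norm q < 1"
  shows "convergent_prod (\<lambda>n. 1 - q ^ n * u)"
  by (rule abs_convergent_prod_imp_convergent_prod[OF abs_convergent_qprod[OF assms]])

lemma qprod_LIMSEQ:
  assumes "norm q < 1"
  shows "(\<lambda>N. \<Prod>n<N. 1 - q ^ n * u) \<longlonglongrightarrow> qprod q u"
  using convergent_prod_LIMSEQ[OF convergent_qprod[OF assms, of u]]
  unfolding qprod_def
  by (subst (asm) LIMSEQ_lessThan_iff_atMost [symmetric]) auto

text \<open>Uniformity is joint in q and u, since in \<open>kap\<close> both arguments move with s.
  The M-test uses the majorant \<rho>^n R.\<close>

lemma qprod_uniform_limit: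
  assumes "0 \<le> \<rho>" "\<rho> < 1"
  shows "uniform_limit (cball 0 \<rho> \<times> cball 0 R)
           (\<lambda>N x. \<Prod>n<N. 1 - fst x ^ n * snd x) (\<lambda>x. qprod (fst x) (snd x)) sequentially"
proof -
  let ?S = "cball 0 \<rho> \<times> cball 0 R :: (complex \<times> complex) set"
  have "uniformly_convergent_on ?S (\<lambda>N x. \<Sum>n<N. norm ((1 - fst x ^ n * snd x) - 1))"
  proof (rule Weierstrass_m_test')
    fix n x assume "x \<in> ?S"
    hence "norm (fst x) \<le> \<rho>" "norm (snd x) \<le> R" by (auto simp: mem_Times_iff)
    thus "norm (norm ((1 - fst x ^ n * snd x) - 1)) \<le> \<rho> ^ n * R"
      by (simp add: norm_mult norm_power) (intro mult_mono power_mono, auto simp: assms)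
  next
    show "summable (\<lambda>n. \<rho> ^ n * R)"
      using assms by (intro summable_mult2 summable_geometric) auto
  qed
  hence "uniformly_convergent_on ?S (\<lambda>N x. \<Prod>n<N. 1 - fst x ^ n * snd x)"
    by (intro uniformly_convergent_on_prod') (auto intro!: continuous_intros compact_Times)
  then obtain l where l: "uniform_limit ?S (\<lambda>N x. \<Prod>n<N. 1 - fst x ^ n * snd x) l sequentially"
    by (auto simp: uniformly_convergent_on_def)
  have "l x = qprod (fst x) (snd x)" if "x \<in> ?S" for x
  proof (rule LIMSEQ_unique)
    show "(\<lambda>N. \<Prod>n<N. 1 - fst x ^ n * snd x) \<longlonglongrightarrow> l x"
      using tendsto_uniform_limitI[OF l that] .
    have "norm (fst x) < 1" using that assms by (auto simp: mem_Times_iff)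
    thus "(\<lambda>N. \<Prod>n<N. 1 - fst x ^ n * snd x) \<longlonglongrightarrow> qprod (fst x) (snd x)"
      by (rule qprod_LIMSEQ)
  qed
  hence "uniform_limit ?S (\<lambda>N x. \<Prod>n<N. 1 - fst x ^ n * snd x) l sequentially \<longleftrightarrow>
         uniform_limit ?S (\<lambda>N x. \<Prod>n<N. 1 - fst x ^ n * snd x) (\<lambda>x. qprod (fst x) (snd x)) sequentially"
    by (intro uniform_limit_cong') simp_all
  with l show ?thesis by simp
qed

lemma continuous_on_qprod:
  assumes "\<And>x. x \<in> A \<Longrightarrow> norm (f x) < 1"
    and "continuous_on A f" "continuous_on A g"
  shows "continuous_on A (\<lambda>x. qprod (f x) (g x))"
proof -
  let ?F = "\<lambda>x. qprod (fst x) (snd x)"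
  have "continuous_on (ball 0 1 \<times> UNIV) ?F"
  proof (rule continuous_at_imp_continuous_on, safe)
    fix q u :: complex assume q: "q \<in> ball 0 1"
    then obtain \<rho> where \<rho>: "norm q < \<rho>" "\<rho> < 1" using dense by auto
    hence "0 \<le> \<rho>" using norm_ge_zero[of q] by linarith
    define S where "S = cball (0::complex) \<rho> \<times> cball (0::complex) (norm u + 1)"
    have "continuous_on S ?F"
      unfolding S_def
      by (rule uniform_limit_theorem[OF _ qprod_uniform_limit])
         (use \<open>0 \<le> \<rho>\<close> \<rho> in \<open>auto intro!: always_eventually continuous_intros\<close>)
    moreover have "(q, u) \<in> interior S"
      using \<rho> by (simp add: S_def interior_Times)
    ultimately show "isCont ?F (q, u)"
      using continuous_on_interior by blast
  qed
  hence "continuous_on A (\<lambda>x. ?F (f x, g x))"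
    by (rule continuous_on_compose2) (use assms in \<open>auto intro!: continuous_intros\<close>)
  thus ?thesis by simp
qed

lemma holomorphic_qprod:
  assumes q: "norm q < 1"
  shows "qprod q holomorphic_on UNIV"
proof -
  have "qprod q holomorphic_on ball 0 R" if R: "R > 0" for R
  proof -
    have ul: "uniform_limit (cball 0 R) (\<lambda>N u. \<Prod>n<N. 1 - q ^ n * u) (qprod q) sequentially"
      using uniform_limit_compose'[OF qprod_uniform_limit[of "norm q" R], of "\<lambda>u. (q, u)" "cball 0 R"] q
      by simp
    have "(\<lambda>u. \<Prod>n<N. 1 - q ^ n * u) holomorphic_on A" for N A
      by (intro holomorphic_intros)
    hence "\<forall>\<^sub>F N in sequentially. continuous_on (cball 0 R) (\<lambda>u. \<Prod>n<N. 1 - q ^ n * u) \<and>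
             (\<lambda>u. \<Prod>n<N. 1 - q ^ n * u) holomorphic_on ball 0 R"
      by (intro always_eventually) (simp add: holomorphic_on_imp_continuous_on)
    from holomorphic_uniform_limit[OF this ul] show ?thesis by simp
  qed
  hence "qprod q field_differentiable at u" for u
    by (rule holomorphic_on_imp_differentiable_at[of _ "ball 0 (norm u + 1)"]) (use add_nonneg_pos[OF norm_ge_zero zero_less_one, of u] in auto)
  thus ?thesis by (simp add: holomorphic_on_def)
qed

text \<open>Splitting off the factor n = 0 turns u into q u in all the others. The behaviour of
  \<open>th\<close> under \<tau> comes from this.\<close>

lemma qprod_rec:
  assumes "norm q < 1"
  shows "qprod q u = (1 - u) * qprod q (q * u)"
proof (rule LIMSEQ_unique)
  show "(\<lambda>N. \<Prod>n<Suc N. 1 - q ^ n * u) \<longlonglongrightarrow> qprod q u"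
    using qprod_LIMSEQ[OF assms] by (rule LIMSEQ_Suc)
  have "(\<lambda>N. (1 - u) * (\<Prod>n<N. 1 - q ^ n * (q * u))) \<longlonglongrightarrow> (1 - u) * qprod q (q * u)"
    by (intro tendsto_intros qprod_LIMSEQ assms)
  thus "(\<lambda>N. \<Prod>n<Suc N. 1 - q ^ n * u) \<longlonglongrightarrow> (1 - u) * qprod q (q * u)"
    by (subst prod.lessThan_Suc_shift) (simp add: mult_ac)
qed

text \<open>\<open>has_prod\<close> allows finitely many zero factors and demands a nonzero limit of
  the rest, so the product vanishes only through one of its factors.\<close>

lemma qprod_eq_0_iff:
  assumes "norm q < 1"
  shows "qprod q u = 0 \<longleftrightarrow> (\<exists>n. q ^ n * u = 1)"
proof -
  have has: "(\<lambda>n. 1 - q ^ n * u) has_prod qprod q u"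
    using convergent_prod_has_prod[OF convergent_qprod[OF assms, of u]] by (simp add: qprod_def)
  show ?thesis
  proof
  assume "qprod q u = 0"
  with has have "(\<lambda>n. 1 - q ^ n * u) has_prod 0" by simp
  hence "0 \<in> range (\<lambda>n. 1 - q ^ n * u)" by (rule has_prod_0D)
  thus "\<exists>n. q ^ n * u = 1" by (auto simp: eq_diff_eq)
next
  assume "\<exists>n. q ^ n * u = 1"
  then obtain n where "0 = 1 - q ^ n * u" by auto
  hence "0 \<in> range (\<lambda>n. 1 - q ^ n * u)" by (rule range_eqI)
  thus "qprod q u = 0" using has_prod_eq_0_iff[OF has] by simp
  qed
qed

section \<open>Lattices and elliptic functions\<close>

definition lat :: "complex \<Rightarrow> complex set" where
  "lat \<tau> = {of_int m + of_int n * \<tau> | m n. True}"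

locale half_plane =
  fixes \<tau> :: complex
  assumes Im_pos: "Im \<tau> > 0"
begin

abbreviation "\<Lambda> \<equiv> lat \<tau>"

lemma lat_iff: "z \<in> \<Lambda> \<longleftrightarrow> (\<exists>m n. z = of_int m + of_int n * \<tau>)"
  by (auto simp: lat_def)

text \<open>Imaginary parts isolate the coefficient of \<tau>. Real coefficients cover integer
  coordinates and half periods alike.\<close>

lemma lat_coords_unique:
  assumes "of_real a + of_real b * \<tau> = of_real c + of_real d * \<tau>"
  shows "a = c \<and> b = d"
proof -
  have "b * Im \<tau> = d * Im \<tau>" using arg_cong[OF assms, of Im] by simp
  hence "b = d" using Im_pos by simp
  with assms show ?thesis by simp
qed

lemma lat_add [intro]: "z \<in> \<Lambda> \<Longrightarrow> w \<in> \<Lambda> \<Longrightarrow> z + w \<in> \<Lambda>"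
proof -
  assume "z \<in> \<Lambda>" "w \<in> \<Lambda>"
  then obtain a b c d where "z = of_int a + of_int b * \<tau>" "w = of_int c + of_int d * \<tau>"
    by (auto simp: lat_iff)
  hence "z + w = of_int (a + c) + of_int (b + d) * \<tau>" by (simp add: algebra_simps)
  thus ?thesis unfolding lat_iff by blast
qed

lemma lat_minus [simp]: "- z \<in> \<Lambda> \<longleftrightarrow> z \<in> \<Lambda>"
proof -
  have "- z \<in> \<Lambda>" if "z \<in> \<Lambda>" for z
  proof -
    from that obtain a b where "z = of_int a + of_int b * \<tau>" by (auto simp: lat_iff)
    hence "- z = of_int (- a) + of_int (- b) * \<tau>" by simp
    thus ?thesis unfolding lat_iff by blast
  qed
  from this[of z] this[of "-z"] show ?thesis by auto
qed

lemma lat_diff [intro]: "z \<in> \<Lambda> \<Longrightarrow> w \<in> \<Lambda> \<Longrightarrow> z - w \<in> \<Lambda>"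
  using lat_add[of z "-w"] by simp

lemma lat_0 [simp]: "0 \<in> \<Lambda>"
  by (force simp: lat_iff intro: exI[of _ 0])

lemma lat_1 [simp]: "1 \<in> \<Lambda>"
proof -
  have "1 = of_int 1 + of_int 0 * \<tau>" by simp
  thus ?thesis unfolding lat_iff by blast
qed

lemma lat_tau [simp]: "\<tau> \<in> \<Lambda>"
proof -
  have "\<tau> = of_int 0 + of_int 1 * \<tau>" by simp
  thus ?thesis unfolding lat_iff by blast
qed

lemma lat_of_int_mult [intro]: "z \<in> \<Lambda> \<Longrightarrow> of_int n * z \<in> \<Lambda>"
proof -
  assume "z \<in> \<Lambda>"
  then obtain a b where "z = of_int a + of_int b * \<tau>" by (auto simp: lat_iff)
  hence "of_int n * z = of_int (n * a) + of_int (n * b) * \<tau>" by (simp add: algebra_simps)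
  thus ?thesis unfolding lat_iff by blast
qed

lemma lat_add_cancel [simp]:
  assumes "w \<in> \<Lambda>"
  shows "z + w \<in> \<Lambda> \<longleftrightarrow> z \<in> \<Lambda>" "w + z \<in> \<Lambda> \<longleftrightarrow> z \<in> \<Lambda>" "z - w \<in> \<Lambda> \<longleftrightarrow> z \<in> \<Lambda>" "w - z \<in> \<Lambda> \<longleftrightarrow> z \<in> \<Lambda>"
proof -
  show 1: "z + w \<in> \<Lambda> \<longleftrightarrow> z \<in> \<Lambda>" using lat_add[of z w] lat_diff[of "z + w" w] assms by auto
  thus "w + z \<in> \<Lambda> \<longleftrightarrow> z \<in> \<Lambda>" by (simp add: add.commute)
  show 2: "z - w \<in> \<Lambda> \<longleftrightarrow> z \<in> \<Lambda>" using lat_diff[of z w] lat_add[of "z - w" w] assms by auto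
  thus "w - z \<in> \<Lambda> \<longleftrightarrow> z \<in> \<Lambda>" using lat_minus[of "z - w"] by simp
qed

text \<open>The imaginary part of m + n \<tau> is n Im \<tau>, which forces n = 0 for a short
  vector; an integer of modulus below 1 remains.\<close>

lemma lat_discrete:
  assumes "w \<in> \<Lambda>" "norm w < min 1 (Im \<tau>)"
  shows "w = 0"
proof -
  from assms obtain m n where w: "w = of_int m + of_int n * \<tau>" by (auto simp: lat_iff)
  have "\<bar>of_int n\<bar> * Im \<tau> = \<bar>Im w\<bar>" using Im_pos by (simp add: w abs_mult)
  also have "\<dots> < Im \<tau>" using abs_Im_le_cmod[of w] assms(2) by linarith
  finally have "\<bar>of_int n\<bar> * Im \<tau> < Im \<tau>" .
  hence "\<bar>n\<bar> < 1" using Im_pos by (simp flip: of_int_abs)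
  hence n: "n = 0" by simp
  hence "norm w = \<bar>of_int m\<bar>" by (simp add: w)
  hence "\<bar>m\<bar> < 1" using assms(2) by (simp flip: of_int_abs)
  with n w show ?thesis by simp
qed

lemma closed_lat: "closed \<Lambda>"
proof (rule discrete_imp_closed)
  show "0 < min 1 (Im \<tau>)" using Im_pos by simp
  show "\<forall>x\<in>\<Lambda>. \<forall>y\<in>\<Lambda>. dist y x < min 1 (Im \<tau>) \<longrightarrow> y = x"
  proof safe
    fix x y assume "x \<in> \<Lambda>" "y \<in> \<Lambda>" "dist y x < min 1 (Im \<tau>)"
    with lat_discrete[of "y - x"] show "y = x" by (auto simp: dist_norm)
  qed
qed

lemma countable_lat: "countable \<Lambda>"
proof -
  have "\<Lambda> = (\<lambda>(m, n). of_int m + of_int n * \<tau>) ` (UNIV :: (int \<times> int) set)"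
    by (auto simp: lat_def)
  thus ?thesis by simp
qed

lemma open_compl_lat: "open (- \<Lambda>)"
  using closed_lat by auto

lemma connected_compl_countable: "countable A \<Longrightarrow> connected (- A :: complex set)"
  by (intro path_connected_imp_connected path_connected_complement_countable) auto

text \<open>A ball of half the radius \<open>min 1 (Im \<tau>)\<close> contains at most one lattice
  point. If this point is not p itself, it is removed from the neighbourhood as well.\<close>

lemma eventually_not_lat: "\<forall>\<^sub>F z in at p. z \<notin> \<Lambda>"
proof -
  have near: "\<forall>\<^sub>F z in at p. z \<in> ball p (min 1 (Im \<tau>) / 2) - {p}"
    using Im_pos by (intro eventually_at_in_open) auto
  show ?thesis
  proof (cases "\<exists>w\<in>\<Lambda>. w \<noteq> p \<and> w \<in> ball p (min 1 (Im \<tau>) / 2)")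
    case False
    thus ?thesis using near by (auto elim!: eventually_mono)
  next
    case True
    then obtain w where w: "w \<in> \<Lambda>" "w \<noteq> p" "w \<in> ball p (min 1 (Im \<tau>) / 2)" by auto
    have "\<forall>\<^sub>F z in at p. z \<in> ball p (min 1 (Im \<tau>) / 2) - {w}"
      using Im_pos w by (intro eventually_at_in_open') auto
    thus ?thesis
    proof eventually_elim
      case (elim z)
      hence "dist z w < min 1 (Im \<tau>)"
        using w dist_triangle2[of z w p] by (auto simp: dist_commute)
      hence "z \<in> \<Lambda> \<Longrightarrow> z = w"
        using lat_discrete[of "z - w"] w by (auto simp: dist_norm)
      with elim show ?case by auto
    qed
  qed
qed

text \<open>The representative is moved into the rectangle with sides 1 and Im \<tau> instead of the
  period parallelogram, which makes the norm bound immediate.\<close>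

lemma lat_reduce:
  obtains w where "w \<in> \<Lambda>" "norm (z - w) \<le> 1 + norm \<tau>"
proof -
  define n where "n = \<lfloor>Im z / Im \<tau>\<rfloor>"
  define m where "m = \<lfloor>Re (z - of_int n * \<tau>)\<rfloor>"
  define b where "b = Im z / Im \<tau> - of_int n"
  define a where "a = Re (z - of_int n * \<tau>) - of_int m"
  have ab: "0 \<le> b" "b \<le> 1" "0 \<le> frac (Re (z - of_int n * \<tau>))"
    unfolding b_def n_def by (linarith, linarith, simp)
  define c where "c = frac (Re (z - of_int n * \<tau>))"
  have "z - (of_int m + of_int n * \<tau>) = Complex c (b * Im \<tau>)"
    using Im_pos by (intro complex_eqI) (simp_all add: c_def b_def m_def frac_def field_simps)
  hence "norm (z - (of_int m + of_int n * \<tau>)) \<le> \<bar>c\<bar> + \<bar>b * Im \<tau>\<bar>"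
    by (metis cmod_le complex.sel)
  also have "\<bar>c\<bar> \<le> 1" using frac_lt_1[of "Re (z - of_int n * \<tau>)"] ab unfolding c_def by linarith
  also have "\<bar>b * Im \<tau>\<bar> \<le> Im \<tau>" using ab Im_pos by (simp add: abs_mult mult_left_le_one_le)
  also have "Im \<tau> \<le> norm \<tau>" using abs_Im_le_cmod[of \<tau>] by linarith
  finally show ?thesis by (intro that[of "of_int m + of_int n * \<tau>"]) (auto simp: lat_iff)
qed

text \<open>The set A allows the periods to be checked off the lattice only, where a function with
  poles has meaningful values.\<close>

lemma periodic_lat:
  assumes per: "\<And>z. z \<in> A \<Longrightarrow> f (z + 1) = f z" "\<And>z. z \<in> A \<Longrightarrow> f (z + \<tau>) = f z"
    and A: "\<And>z w. z \<in> A \<Longrightarrow> w \<in> \<Lambda> \<Longrightarrow> z + w \<in> A"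
    and "w \<in> \<Lambda>" "z \<in> A"
  shows "f (z + w) = f z"
proof -
  have gen: "f (z + of_int n * p) = f z"
    if p: "p \<in> \<Lambda>" "\<And>z. z \<in> A \<Longrightarrow> f (z + p) = f z" and z: "z \<in> A" for n p z
  proof (induction n rule: int_induct[of _ 0])
    case (step1 i)
    have "f (z + of_int i * p + p) = f (z + of_int i * p)"
      using p z by (intro p(2) A lat_of_int_mult)
    thus ?case using step1 by (simp add: algebra_simps)
  next
    case (step2 i)
    have "f (z + of_int (i - 1) * p + p) = f (z + of_int (i - 1) * p)"
      using p z by (intro p(2) A lat_of_int_mult)
    thus ?case using step2 by (simp add: algebra_simps)
  qed auto
  from assms obtain m n where w: "w = of_int m + of_int n * \<tau>" by (auto simp: lat_iff)
  have "f (z + of_int m * 1 + of_int n * \<tau>) = f (z + of_int m * 1)"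
    using assms(5) by (intro gen per A lat_of_int_mult) auto
  also have "\<dots> = f z" using assms(5) by (intro gen per) auto
  finally show ?thesis by (simp add: w add_ac)
qed

lemma entire_elliptic_const:
  assumes hol: "g holomorphic_on UNIV" and per: "\<And>z. g (z + 1) = g z" "\<And>z. g (z + \<tau>) = g z"
  obtains c where "\<And>z. g z = c"
proof -
  have "range g \<subseteq> g ` cball 0 (1 + norm \<tau>)"
  proof safe
    fix z
    obtain w where w: "w \<in> \<Lambda>" "norm (z - w) \<le> 1 + norm \<tau>" using lat_reduce .
    have "g z = g ((z - w) + w)" by simp
    also have "\<dots> = g (z - w)" by (rule periodic_lat[of UNIV]) (use per w in auto)
    finally show "g z \<in> g ` cball 0 (1 + norm \<tau>)" using w by auto
  qed
  moreover have "compact (g ` cball 0 (1 + norm \<tau>))"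
    by (intro compact_continuous_image holomorphic_on_imp_continuous_on holomorphic_on_subset[OF hol]) auto
  ultimately have "bounded (range g)" by (meson bounded_subset compact_imp_bounded)
  with hol have "g constant_on UNIV" by (rule Liouville_theorem)
  thus ?thesis using that by (auto simp: constant_on_def)
qed

end

text \<open>A holds the points where f is not controlled, B the points where a pole may remain. The
  case of empty B serves Liouville arguments; with B = \<open>lat \<tau>\<close> the poles on the
  lattice survive.\<close>

lemma remove_sings_holomorphic:
  assumes hol: "f holomorphic_on - A" and disc: "\<And>p. \<forall>\<^sub>F z in at p. z \<notin> A"
    and lim: "\<And>p. p \<in> A - B \<Longrightarrow> \<exists>l. (f \<longlongrightarrow> l) (at p)" and B: "closed B"
  shows "remove_sings f holomorphic_on - B" "\<And>z. z \<notin> A \<Longrightarrow> remove_sings f z = f z"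
proof -
  have "open (- A)"
  proof (subst open_subopen, safe)
    fix p assume "p \<notin> A"
    from disc[of p] obtain T where T: "open T" "p \<in> T" "\<And>z. z \<in> T \<Longrightarrow> z \<noteq> p \<Longrightarrow> z \<notin> A"
      by (auto simp: eventually_at_topological)
    thus "\<exists>T. open T \<and> p \<in> T \<and> T \<subseteq> - A" using \<open>p \<notin> A\<close> by blast
  qed
  with hol have an: "f analytic_on - A" by (simp add: analytic_on_open)
  show *: "remove_sings f z = f z" if "z \<notin> A" for z
    using an that by (intro remove_sings_at_analytic) (auto intro: analytic_on_subset)
  have "remove_sings f analytic_on {p}" if pB: "p \<notin> B" for p
  proof (cases "p \<in> A")
    case False
    hence "f analytic_on {p}" using an by (auto intro: analytic_on_subset)
    thus ?thesis by (rule remove_sings_analytic_on)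
  next
    case True
    from disc[of p] obtain r where r: "r > 0" "\<And>z. z \<noteq> p \<Longrightarrow> dist z p < r \<Longrightarrow> z \<notin> A"
      by (auto simp: eventually_at)
    have "f analytic_on ball p r - {p}"
      by (rule analytic_on_subset[OF an]) (use r in \<open>auto simp: dist_commute\<close>)
    hence "isolated_singularity_at f p" using r by (auto simp: isolated_singularity_at_def)
    moreover obtain l where "f \<midarrow>p\<rightarrow> l" using lim[of p] True pB by auto
    ultimately show ?thesis by (rule remove_sings_analytic_at)
  qed
  hence "remove_sings f analytic_on - B" by (subst analytic_on_analytic_at) auto
  thus "remove_sings f holomorphic_on - B" using B by (simp add: analytic_on_open open_Compl)
qed

text \<open>Once the value 0 is filled in at 0, the function f(z) / z is odd, so it vanishes at 0
  too and a second division by z is possible. Hence pole orders of even functions drop in steps of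
  two.\<close>

lemma even_removable_div_square:
  assumes iso: "isolated_singularity_at f (0 :: complex)" and lim: "(f \<longlongrightarrow> 0) (at 0)"
    and even: "\<forall>\<^sub>F z in at 0. f (- z) = f z"
  shows "\<exists>l. ((\<lambda>z. f z / z\<^sup>2) \<longlongrightarrow> l) (at 0)"
proof -
  define g where "g = (\<lambda>z. if z = 0 then 0 else f z)"
  have g: "g analytic_on {0}" unfolding g_def by (rule removable_singularity'[OF iso lim])
  then obtain d where d: "(g has_field_derivative d) (at 0)"
    by (meson analytic_on_imp_differentiable_at field_differentiable_def insertI1)
  define h where "h = (\<lambda>z. if z = 0 then d else g z / z)"
  have dlim: "((\<lambda>z. g z / z) \<longlongrightarrow> d) (at 0)"
    using d by (simp add: has_field_derivative_iff g_def)
  obtain r where r: "r > 0" "g holomorphic_on ball 0 r" using g by (auto simp: analytic_at_ball)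
  have "(\<lambda>z. g z / z) analytic_on ball 0 r - {0}"
    by (subst analytic_on_open) (auto intro!: holomorphic_intros holomorphic_on_subset[OF r(2)])
  hence "isolated_singularity_at (\<lambda>z. g z / z) 0" using r by (auto simp: isolated_singularity_at_def)
  hence h: "h analytic_on {0}" unfolding h_def using dlim by (rule removable_singularity')
  have hlim: "h \<midarrow>0\<rightarrow> d" using h h_def by (metis analytic_at_imp_isCont isCont_def)
  have "((\<lambda>z. h (- z)) \<longlongrightarrow> d) (at 0)"
    by (rule filterlim_compose[OF hlim]) (auto intro!: filterlim_atI tendsto_eq_intros simp: eventually_at_filter)
  moreover have "\<forall>\<^sub>F z in at 0. h (- z) = - h z"
    using even eventually_neq_at_within[of 0]
    by eventually_elim (auto simp: h_def g_def)
  ultimately have "((\<lambda>z. - h z) \<longlongrightarrow> d) (at 0)" by (rule Lim_transform_eventually)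
  with tendsto_minus[OF hlim] have "d = - d" using tendsto_unique[OF at_neq_bot] by blast
  hence d0: "d = 0" by simp
  from h obtain d' where "(h has_field_derivative d') (at 0)"
    by (meson analytic_on_imp_differentiable_at field_differentiable_def insertI1)
  hence "((\<lambda>z. h z / z) \<longlongrightarrow> d') (at 0)" by (simp add: has_field_derivative_iff h_def d0)
  moreover have "\<forall>\<^sub>F z in at 0. h z / z = f z / z\<^sup>2"
    using eventually_neq_at_within[of 0]
    by eventually_elim (simp add: h_def g_def power2_eq_square)
  ultimately have "((\<lambda>z. f z / z\<^sup>2) \<longlongrightarrow> d') (at 0)" by (rule Lim_transform_eventually)
  thus ?thesis by blast
qed

text \<open>An abstract Weierstrass p-function up to affine change. It is instantiated by the square
  of \<open>qD\<close> and by the x-coordinate of every uniformized curve.\<close>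

locale even_elliptic = half_plane +
  fixes x :: "complex \<Rightarrow> complex" and L :: complex
  assumes x_hol: "x holomorphic_on - \<Lambda>"
    and x_per: "\<And>z. x (z + 1) = x z" "\<And>z. x (z + \<tau>) = x z"
    and x_even: "\<And>z. x (- z) = x z"
    and x_pole: "((\<lambda>z. z\<^sup>2 * x z) \<longlongrightarrow> L) (at 0)" and L_nz: "L \<noteq> 0"
begin

lemma x_lat: "w \<in> \<Lambda> \<Longrightarrow> x (z + w) = x z"
  by (rule periodic_lat[of UNIV]) (auto simp: x_per)

end

context half_plane
begin

text \<open>Periodicity carries the limit at 0 to every lattice point, so all singularities are
  removable and Liouville applies to the extension.\<close>

lemma elliptic_removable_const:
  assumes hol: "F holomorphic_on - \<Lambda>"
    and per: "\<And>z. z \<notin> \<Lambda> \<Longrightarrow> F (z + 1) = F z" "\<And>z. z \<notin> \<Lambda> \<Longrightarrow> F (z + \<tau>) = F z"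
    and lim: "(F \<longlongrightarrow> l) (at 0)"
  obtains c where "\<And>z. z \<notin> \<Lambda> \<Longrightarrow> F z = c"
proof -
  have perL: "F (z + w) = F z" if "w \<in> \<Lambda>" "z \<notin> \<Lambda>" for z w
    by (rule periodic_lat[of "- \<Lambda>"]) (use per that in auto)
  define g where "g = (\<lambda>z. if z \<in> \<Lambda> then l else F z)"
  have glim: "(F \<longlongrightarrow> l) (at p)" if p: "p \<in> \<Lambda>" for p
  proof -
    have "((\<lambda>z. F (z - p)) \<longlongrightarrow> l) (at p)"
      by (rule filterlim_compose[OF lim]) (auto intro!: filterlim_atI tendsto_eq_intros simp: eventually_at_filter)
    moreover have "\<forall>\<^sub>F z in at p. F (z - p) = F z"
      using eventually_not_lat[of p]
    proof eventually_elim
      case (elim z)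
      thus ?case using perL[of p "z - p"] p by simp
    qed
    ultimately show ?thesis by (rule Lim_transform_eventually)
  qed
  have rs: "remove_sings F holomorphic_on UNIV" "\<And>z. z \<notin> \<Lambda> \<Longrightarrow> remove_sings F z = F z"
    using remove_sings_holomorphic[OF hol eventually_not_lat, of "{}"] glim by auto
  have "remove_sings F z = g z" for z
    using rs(2)[of z] glim by (cases "z \<in> \<Lambda>") (auto simp: g_def intro!: remove_sings_eqI)
  hence "g holomorphic_on UNIV" using rs(1) by (simp add: holomorphic_cong[of UNIV UNIV "remove_sings F" g])
  moreover have "g (z + w) = g z" if "w \<in> \<Lambda>" for z w using perL[OF that] that by (auto simp: g_def)
  ultimately obtain c where "\<And>z. g z = c" using entire_elliptic_const[of g] by auto
  thus ?thesis using that[of c] by (metis g_def)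
qed

end

context even_elliptic
begin

text \<open>Induction on the pole order: subtracting a multiple of \<open>x z ^ Suc N\<close> kills
  the leading coefficient at 0, and evenness then lowers the order by two.\<close>

lemma even_elliptic_poly:
  assumes "F holomorphic_on - \<Lambda>"
    and "\<And>z. z \<notin> \<Lambda> \<Longrightarrow> F (z + 1) = F z" "\<And>z. z \<notin> \<Lambda> \<Longrightarrow> F (z + \<tau>) = F z"
    and "\<And>z. z \<notin> \<Lambda> \<Longrightarrow> F (- z) = F z"
    and "((\<lambda>z. z ^ (2 * N) * F z) \<longlongrightarrow> l) (at 0)"
  shows "\<exists>p. degree p \<le> N \<and> (\<forall>z. z \<notin> \<Lambda> \<longrightarrow> F z = poly p (x z))"
  using assms
proof (induction N arbitrary: F l)
  case 0
  have "(F \<longlongrightarrow> l) (at 0)" using "0.prems"(5) by simp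
  then obtain c where "\<And>z. z \<notin> \<Lambda> \<Longrightarrow> F z = c"
    using elliptic_removable_const[OF "0.prems"(1-3)] by blast
  thus ?case by (intro exI[of _ "[:c:]"]) auto
next
  case (Suc N)
  define k where "k = l / L ^ Suc N"
  define F1 where "F1 = (\<lambda>z. F z - k * x z ^ Suc N)"
  define f where "f = (\<lambda>z. z ^ (2 * Suc N) * F1 z)"
  have hol: "F1 holomorphic_on - \<Lambda>"
    unfolding F1_def by (intro holomorphic_intros Suc.prems x_hol)
  have "((\<lambda>z. z ^ (2 * Suc N) * F z - k * (z\<^sup>2 * x z) ^ Suc N) \<longlongrightarrow> l - k * L ^ Suc N) (at 0)"
    by (intro tendsto_intros Suc.prems x_pole)
  also have "l - k * L ^ Suc N = 0" using L_nz by (simp add: k_def)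
  also have "(\<lambda>z. z ^ (2 * Suc N) * F z - k * (z\<^sup>2 * x z) ^ Suc N) = f"
    by (simp add: fun_eq_iff f_def F1_def right_diff_distrib power_mult_distrib
        flip: power_mult del: power_Suc)
  finally have f0: "(f \<longlongrightarrow> 0) (at 0)" .
  have "isolated_singularity_at f 0"
  proof -
    obtain r where r: "r > 0" "\<And>z. z \<noteq> 0 \<Longrightarrow> dist z 0 < r \<Longrightarrow> z \<notin> \<Lambda>"
      using eventually_not_lat[of 0] by (auto simp: eventually_at)
    have "f holomorphic_on - \<Lambda>" unfolding f_def by (intro holomorphic_intros hol)
    hence "f analytic_on - \<Lambda>" using open_compl_lat by (simp add: analytic_on_open)
    hence "f analytic_on ball 0 r - {0}"
      by (rule analytic_on_subset) (use r in \<open>auto simp: dist_commute\<close>)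
    thus ?thesis using r by (auto simp: isolated_singularity_at_def)
  qed
  moreover have "\<forall>\<^sub>F z in at 0. f (- z) = f z"
    using eventually_not_lat[of 0] by eventually_elim (simp add: f_def F1_def x_even Suc.prems)
  ultimately obtain l' where "((\<lambda>z. f z / z\<^sup>2) \<longlongrightarrow> l') (at 0)"
    using even_removable_div_square f0 by blast
  moreover have "\<forall>\<^sub>F z in at 0. f z / z\<^sup>2 = z ^ (2 * N) * F1 z"
    using eventually_neq_at_within[of 0]
    by eventually_elim (simp add: f_def power2_eq_square)
  ultimately have "((\<lambda>z. z ^ (2 * N) * F1 z) \<longlongrightarrow> l') (at 0)" by (rule Lim_transform_eventually)
  from Suc.IH[OF hol _ _ _ this]
  obtain p where p: "degree p \<le> N" "\<And>z. z \<notin> \<Lambda> \<Longrightarrow> F1 z = poly p (x z)"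
    using Suc.prems by (auto simp: F1_def x_per x_even)
  show ?case
  proof (intro exI[of _ "p + monom k (Suc N)"] conjI allI impI)
    show "degree (p + monom k (Suc N)) \<le> Suc N"
      using p(1) by (intro degree_add_le) (auto intro: order.trans[OF degree_monom_le])
    show "F z = poly (p + monom k (Suc N)) (x z)" if "z \<notin> \<Lambda>" for z
      using p(2)[OF that] by (simp add: F1_def poly_monom algebra_simps)
  qed
qed

end

section \<open>A theta quotient\<close>

text \<open>Normalized to period 1: \<open>cexp \<tau>\<close> is the base q of the theta product,
  and \<open>cexp (\<tau> / 2)\<close> is s = exp (\<pi> \<i> \<tau>).\<close>

definition cexp :: "complex \<Rightarrow> complex" where
  "cexp z = exp (2 * of_real pi * \<i> * z)"

lemma cexp_nz [simp]: "cexp z \<noteq> 0"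
  and cexp_add: "cexp (z + w) = cexp z * cexp w"
  and cexp_minus: "cexp (- z) = 1 / cexp z"
  and cexp_diff: "cexp (z - w) = cexp z / cexp w"
  and cexp_power: "cexp z ^ n = cexp (of_nat n * z)"
  by (simp_all add: cexp_def exp_add exp_diff exp_minus field_simps flip: exp_of_nat_mult)

lemma cexp_0 [simp]: "cexp 0 = 1" by (simp add: cexp_def)

lemma cexp_1 [simp]: "cexp 1 = 1"
  using exp_two_pi_i by (simp add: cexp_def mult_ac)

lemma cexp_half [simp]: "cexp (1 / 2) = -1"
  using exp_pi_i by (simp add: cexp_def)

lemma cexp_eq_1_iff: "cexp z = 1 \<longleftrightarrow> (\<exists>m. z = of_int m)"
proof
  assume "cexp z = 1"
  then obtain n :: int where n: "Im z = 0" "2 * pi * Re z = real_of_int (2 * n) * pi"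
    by (auto simp: cexp_def exp_eq_1)
  hence "Re z = of_int n" by simp
  with n show "\<exists>m. z = of_int m" by (intro exI[of _ n]) (simp add: complex_eq_iff)
next
  assume "\<exists>m. z = of_int m"
  then obtain m where "z = of_int m" by auto
  thus "cexp z = 1"
    using exp_integer_2pi[of "of_int m"] by (simp add: cexp_def mult_ac)
qed

lemma norm_cexp: "norm (cexp z) = exp (- 2 * pi * Im z)"
  by (simp add: cexp_def)

lemma has_field_derivative_cexp:
  "(cexp has_field_derivative 2 * of_real pi * \<i> * cexp z) (at z within A)"
  unfolding cexp_def by (rule derivative_eq_intros refl | simp)+

lemma holomorphic_on_cexp [holomorphic_intros]:
  "f holomorphic_on A \<Longrightarrow> (\<lambda>z. cexp (f z)) holomorphic_on A"
  unfolding cexp_def by (intro holomorphic_intros)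

context half_plane
begin

lemma lat_real_iff: "of_real a + of_real b * \<tau> \<in> \<Lambda> \<longleftrightarrow> a \<in> \<int> \<and> b \<in> \<int>"
proof
  assume "of_real a + of_real b * \<tau> \<in> \<Lambda>"
  then obtain m n where "of_real a + of_real b * \<tau> = of_real (of_int m) + of_real (of_int n) * \<tau>"
    by (auto simp: lat_iff)
  from lat_coords_unique[OF this] show "a \<in> \<int> \<and> b \<in> \<int>" by auto
next
  assume "a \<in> \<int> \<and> b \<in> \<int>"
  thus "of_real a + of_real b * \<tau> \<in> \<Lambda>" by (force elim!: Ints_cases simp: lat_iff)
qed

lemma half_not_Ints: "(1/2 :: real) \<notin> \<int>"
proof
  assume "(1/2 :: real) \<in> \<int>"
  then obtain n :: int where "1 / 2 = real_of_int n" by (auto elim: Ints_cases)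
  hence "of_int (2 * n) = (of_int 1 :: real)" by simp
  hence "2 * n = 1" by (subst (asm) of_int_eq_iff)
  thus False by presburger
qed

lemma half_periods [simp]:
  "1 / 2 \<notin> \<Lambda>" "\<tau> / 2 \<notin> \<Lambda>" "\<tau> / 2 + 1 / 2 \<notin> \<Lambda>"
  using lat_real_iff[of "1/2" 0] lat_real_iff[of 0 "1/2"] lat_real_iff[of "1/2" "1/2"] half_not_Ints
  by (auto simp: add.commute)

text \<open>By the triple product this is Jacobi's theta_1 up to a constant and the factor exp
  (\<pi> \<i> z).\<close>

definition th :: "complex \<Rightarrow> complex" where
  "th z = qprod (cexp \<tau>) (cexp z) * qprod (cexp \<tau>) (cexp \<tau> / cexp z)"

lemma norm_q: "norm (cexp \<tau>) < 1"
  using Im_pos by (simp add: norm_cexp)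

lemma qprod_cexp_eq_0_iff: "qprod (cexp \<tau>) (cexp z) = 0 \<longleftrightarrow> (\<exists>m n. z = of_int m - of_nat n * \<tau>)"
proof -
  have "cexp \<tau> ^ n * cexp z = 1 \<longleftrightarrow> (\<exists>m. of_nat n * \<tau> + z = of_int m)" for n
    by (subst cexp_eq_1_iff [symmetric]) (simp add: cexp_add cexp_power)
  hence "qprod (cexp \<tau>) (cexp z) = 0 \<longleftrightarrow> (\<exists>n m. of_nat n * \<tau> + z = of_int m)"
    by (simp add: qprod_eq_0_iff norm_q)
  also have "\<dots> \<longleftrightarrow> (\<exists>m n. z = of_int m - of_nat n * \<tau>)"
    by (auto simp: algebra_simps)
  finally show ?thesis .
qed

text \<open>The first product accounts for the lattice points m + n \<tau> with n \<le> 0, the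
  second for those with n \<ge> 1.\<close>

lemma th_eq_0_iff: "th z = 0 \<longleftrightarrow> z \<in> \<Lambda>"
proof -
  have "th z = 0 \<longleftrightarrow> (\<exists>m n. z = of_int m - of_nat n * \<tau>) \<or> (\<exists>m n. \<tau> - z = of_int m - of_nat n * \<tau>)"
    by (simp add: th_def qprod_cexp_eq_0_iff flip: cexp_diff)
  also have "\<dots> \<longleftrightarrow> z \<in> \<Lambda>"
  proof
    assume "z \<in> \<Lambda>"
    then obtain m n where z: "z = of_int m + of_int n * \<tau>" by (auto simp: lat_iff)
    show "(\<exists>m n. z = of_int m - of_nat n * \<tau>) \<or> (\<exists>m n. \<tau> - z = of_int m - of_nat n * \<tau>)"
    proof (cases "n \<le> 0")
      case True
      hence "z = of_int m - of_nat (nat (- n)) * \<tau>" by (simp add: z)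
      thus ?thesis by blast
    next
      case False
      hence "\<tau> - z = of_int (- m) - of_nat (nat (n - 1)) * \<tau>" by (simp add: z algebra_simps)
      thus ?thesis by blast
    qed
  next
    assume "(\<exists>m n. z = of_int m - of_nat n * \<tau>) \<or> (\<exists>m n. \<tau> - z = of_int m - of_nat n * \<tau>)"
    then obtain m n where "z = of_int m - of_nat n * \<tau> \<or> \<tau> - z = of_int m - of_nat n * \<tau>" by auto
    hence "z = of_int m + of_int (- int n) * \<tau> \<or> z = of_int (- m) + of_int (int n + 1) * \<tau>"
      by (auto simp: algebra_simps)
    thus "z \<in> \<Lambda>" unfolding lat_iff by blast
  qed
  finally show ?thesis .
qed

lemma th_holomorphic [holomorphic_intros]:
  "f holomorphic_on A \<Longrightarrow> (\<lambda>z. th (f z)) holomorphic_on A"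
proof -
  assume f: "f holomorphic_on A"
  have q: "(\<lambda>z. qprod (cexp \<tau>) (g z)) holomorphic_on A" if "g holomorphic_on A" for g
    using holomorphic_on_compose_gen[OF that holomorphic_qprod[OF norm_q]] by (simp add: o_def)
  show ?thesis unfolding th_def by (intro holomorphic_intros q f) auto
qed

lemma th_1: "th (z + 1) = th z"
  by (simp add: th_def cexp_add)

lemma th_tau: "th (z + \<tau>) = - th z / cexp z"
proof -
  let ?u = "cexp z" and ?q = "cexp \<tau>"
  have "th z = (1 - ?u) * qprod ?q (?q * ?u) * qprod ?q (?q / ?u)"
    unfolding th_def by (subst (1) qprod_rec[OF norm_q]) simp
  moreover have "th (z + \<tau>) = qprod ?q (?q * ?u) * ((1 - 1 / ?u) * qprod ?q (?q / ?u))"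
    using qprod_rec[OF norm_q, of "1 / ?u"] by (simp add: th_def cexp_add mult.commute)
  moreover have "a * ((1 - 1 / u) * b) = - ((1 - u) * a * b) / u" if "u \<noteq> 0" for a b u :: complex
    using that by (simp add: field_simps)
  ultimately show ?thesis by simp
qed

text \<open>Reflecting z and shifting z by \<tau> lead to the same two products in opposite
  order.\<close>

lemma th_minus: "th (- z) = - th z / cexp z"
  unfolding th_tau [symmetric] by (simp add: th_def cexp_add cexp_minus mult_ac)

text \<open>The factor 1 - \<open>cexp z\<close> of the product carries a simple zero at 0, and the
  remaining product is nonzero there because q has modulus below 1.\<close>

lemma deriv_th_0: "deriv th 0 \<noteq> 0"
proof -
  let ?q = "cexp \<tau>"
  define R where "R = (\<lambda>z. qprod ?q (?q * cexp z) * qprod ?q (?q / cexp z))"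
  have q: "(\<lambda>z. qprod ?q (g z)) holomorphic_on UNIV" if "g holomorphic_on UNIV" for g
    using holomorphic_on_compose_gen[OF that holomorphic_qprod[OF norm_q]] by (simp add: o_def)
  have "R holomorphic_on UNIV" unfolding R_def by (intro holomorphic_intros q) auto
  hence R: "(R has_field_derivative deriv R 0) (at 0)" by (intro holomorphic_derivI) auto
  have "th = (\<lambda>z. (1 - cexp z) * R z)"
    by (rule ext, unfold th_def R_def, subst (1) qprod_rec[OF norm_q]) simp
  moreover have "((\<lambda>z. (1 - cexp z) * R z) has_field_derivative - (2 * of_real pi * \<i>) * R 0) (at 0)"
    by (rule derivative_eq_intros has_field_derivative_cexp R refl | simp)+
  ultimately have "deriv th 0 = - (2 * of_real pi * \<i>) * R 0" by (simp add: DERIV_imp_deriv)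
  moreover have "R 0 \<noteq> 0"
  proof -
    have "?q ^ n * ?q \<noteq> 1" for n
    proof -
      have "norm (?q ^ n * ?q) < 1"
        using power_less_one_iff[of "norm ?q" "Suc n"] norm_q by (simp add: norm_mult norm_power mult.commute)
      thus ?thesis by (metis norm_one less_irrefl)
    qed
    thus ?thesis by (simp add: R_def qprod_eq_0_iff norm_q)
  qed
  ultimately show ?thesis by simp
qed

text \<open>A constant multiple of theta_2 / theta_1, that is, of Jacobi's function cs = cn / sn. It
  is normalized so that the shift by 1 / 2 inverts it exactly.\<close>

definition qD :: "complex \<Rightarrow> complex" where
  "qD z = th (z + 1 / 2) / th z"

lemma qD_1: "qD (z + 1) = qD z"
  using th_1[of "z + 1/2"] th_1[of z] by (simp add: qD_def add_ac)

lemma qD_tau: "qD (z + \<tau>) = - qD z"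
proof -
  have "th (z + \<tau> + 1 / 2) = th (z + 1 / 2) / cexp z"
    using th_tau[of "z + 1/2"] by (simp add: add_ac cexp_add[of z "1/2"])
  thus ?thesis using th_tau[of z] by (simp add: qD_def)
qed

lemma qD_minus: "qD (- z) = - qD z"
proof -
  have "th (- z + 1 / 2) = th (- (z + 1 / 2) + 1)" by (simp add: add_ac)
  also have "\<dots> = th (z + 1 / 2) / cexp z"
    using th_minus[of "z + 1 / 2"] by (subst th_1) (simp add: cexp_add)
  finally show ?thesis by (simp add: qD_def th_minus)
qed

lemma qD_half: "qD (z + 1 / 2) = 1 / qD z"
  using th_1[of z] by (simp add: qD_def add.assoc)

lemma qD_tau_minus: "qD (\<tau> - z) = qD z"
  using qD_tau[of "- z"] by (simp add: qD_minus)

lemma qD_holomorphic: "qD holomorphic_on - \<Lambda>"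
  unfolding qD_def by (intro holomorphic_intros) (simp add: th_eq_0_iff)

lemma DERIV_qD: "z \<notin> \<Lambda> \<Longrightarrow> (qD has_field_derivative deriv qD z) (at z)"
  using holomorphic_derivI[OF qD_holomorphic open_compl_lat, of z UNIV] by simp

lemma deriv_qD_1: "z \<notin> \<Lambda> \<Longrightarrow> deriv qD (z + 1) = deriv qD z"
proof -
  assume z: "z \<notin> \<Lambda>"
  have "((\<lambda>z. qD (z + 1)) has_field_derivative deriv qD z) (at z)"
    unfolding qD_1 by (rule DERIV_qD[OF z])
  thus ?thesis by (simp add: DERIV_shift DERIV_imp_deriv)
qed

lemma deriv_qD_tau: "z \<notin> \<Lambda> \<Longrightarrow> deriv qD (z + \<tau>) = - deriv qD z"
proof -
  assume z: "z \<notin> \<Lambda>"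
  have "((\<lambda>z. qD (z + \<tau>)) has_field_derivative - deriv qD z) (at z)"
    unfolding qD_tau by (intro derivative_intros DERIV_qD[OF z])
  thus ?thesis by (simp add: DERIV_shift DERIV_imp_deriv)
qed

lemma deriv_qD_reflect:
  assumes "\<And>z. qD (w - z) = s * qD z" "z \<notin> \<Lambda>" "w - z \<notin> \<Lambda>"
  shows "deriv qD (w - z) = - s * deriv qD z"
proof -
  have "((\<lambda>z. qD (w - z)) has_field_derivative deriv qD (w - z) * (-1)) (at z)"
    by (rule DERIV_chain2[where f = qD and g = "\<lambda>z. w - z" and x = z, OF DERIV_qD[OF assms(3)]]) (auto intro!: derivative_eq_intros)
  moreover have "((\<lambda>z. qD (w - z)) has_field_derivative s * deriv qD z) (at z)"
    unfolding assms(1) by (intro DERIV_cmult DERIV_qD assms)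
  ultimately have "deriv qD (w - z) * (-1) = s * deriv qD z" by (rule DERIV_unique)
  thus ?thesis by (simp add: eq_neg_iff_add_eq_0 add_eq_0_iff algebra_simps)
qed

lemma deriv_qD_minus: "z \<notin> \<Lambda> \<Longrightarrow> deriv qD (- z) = deriv qD z"
  using deriv_qD_reflect[of 0 "-1" z] by (simp add: qD_minus)

text \<open>Oddness combined with the sign change under \<tau> makes \<open>qD\<close> symmetric
  about both points, and a derivative vanishes at a centre of symmetry.\<close>

lemma deriv_qD_half_periods: "deriv qD (\<tau> / 2) = 0" "deriv qD (\<tau> / 2 + 1 / 2) = 0"
proof -
  show "deriv qD (\<tau> / 2) = 0"
    using deriv_qD_reflect[of \<tau> 1 "\<tau> / 2"] by (simp add: qD_tau_minus eq_neg_iff_add_eq_0)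
  have "qD (\<tau> + 1 - z) = 1 * qD z" for z
    using qD_1[of "\<tau> - z"] by (simp add: qD_tau_minus algebra_simps)
  moreover have "\<tau> + 1 - (\<tau> / 2 + 1 / 2) = \<tau> / 2 + 1 / 2" by (simp add: field_simps)
  ultimately show "deriv qD (\<tau> / 2 + 1 / 2) = 0"
    using deriv_qD_reflect[of "\<tau> + 1" 1 "\<tau> / 2 + 1 / 2"] by (simp add: eq_neg_iff_add_eq_0)
qed

text \<open>The residue of \<open>qD\<close> at 0; its square makes the quartic in the differential
  equation monic.\<close>

definition qc :: complex where "qc = th (1 / 2) / deriv th 0"

lemma qc_nz: "qc \<noteq> 0"
  using deriv_th_0 by (simp add: qc_def th_eq_0_iff)

lemma th_entire: "th holomorphic_on UNIV"
  using th_holomorphic[of "\<lambda>z. z"] by simp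

lemma DERIV_th: "(th has_field_derivative deriv th z) (at z)"
  using holomorphic_derivI[OF th_entire, of z UNIV] by simp

lemma th_tendsto: "((\<lambda>z. th (z + w)) \<longlongrightarrow> th w) (at 0)" "((\<lambda>z. deriv th (z + w)) \<longlongrightarrow> deriv th w) (at 0)"
proof -
  have *: "((\<lambda>z. f (z + w)) \<longlongrightarrow> f w) (at 0)" if "f holomorphic_on UNIV" for f
  proof -
    have "isCont f w" using that holomorphic_on_imp_continuous_on continuous_on_eq_continuous_at by blast
    thus ?thesis by (simp add: isCont_iff add.commute)
  qed
  show "((\<lambda>z. th (z + w)) \<longlongrightarrow> th w) (at 0)" "((\<lambda>z. deriv th (z + w)) \<longlongrightarrow> deriv th w) (at 0)"
    by (intro * th_entire holomorphic_deriv; simp)+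
qed

lemma th_over_z: "((\<lambda>z. z / th z) \<longlongrightarrow> 1 / deriv th 0) (at 0)"
proof -
  have "((\<lambda>z. th z / z) \<longlongrightarrow> deriv th 0) (at 0)"
    using DERIV_th[of 0] th_eq_0_iff[of 0] by (simp add: has_field_derivative_iff)
  from tendsto_divide[OF tendsto_const this deriv_th_0, of 1] show ?thesis by simp
qed

lemma qD_pole: "((\<lambda>z. z * qD z) \<longlongrightarrow> qc) (at 0)"
proof -
  have "((\<lambda>z. th (z + 1 / 2) * (z / th z)) \<longlongrightarrow> th (1 / 2) * (1 / deriv th 0)) (at 0)"
    by (intro tendsto_mult th_tendsto th_over_z)
  thus ?thesis by (simp add: qc_def qD_def mult_ac)
qed

lemma deriv_qD_pole: "((\<lambda>z. z\<^sup>2 * deriv qD z) \<longlongrightarrow> - qc) (at 0)"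
proof -
  have "((\<lambda>z. (deriv th (z + 1 / 2) * th z - th (z + 1 / 2) * deriv th z) * (z / th z)\<^sup>2) \<longlongrightarrow>
          (deriv th (1 / 2) * th 0 - th (1 / 2) * deriv th 0) * (1 / deriv th 0)\<^sup>2) (at 0)"
    using th_tendsto[of 0] by (intro tendsto_intros th_tendsto th_over_z) auto
  also have "(deriv th (1 / 2) * th 0 - th (1 / 2) * deriv th 0) * (1 / deriv th 0)\<^sup>2 = - qc"
    using deriv_th_0 th_eq_0_iff[of 0] by (simp add: qc_def field_simps power2_eq_square)
  finally show ?thesis
  proof (rule Lim_transform_eventually)
    show "\<forall>\<^sub>F z in at 0. (deriv th (z + 1 / 2) * th z - th (z + 1 / 2) * deriv th z) * (z / th z)\<^sup>2 =
            z\<^sup>2 * deriv qD z"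
      using eventually_not_lat[of 0]
    proof eventually_elim
      case (elim z)
      hence nz: "th z \<noteq> 0" by (simp add: th_eq_0_iff)
      have "((\<lambda>z. th (z + 1 / 2)) has_field_derivative deriv th (z + 1 / 2)) (at z)"
        using DERIV_th[of "z + 1/2"] by (simp add: DERIV_shift)
      from DERIV_divide[OF this DERIV_th nz]
      have "(qD has_field_derivative (deriv th (z + 1 / 2) * th z - th (z + 1 / 2) * deriv th z) / (th z * th z)) (at z)"
        by (simp add: qD_def [abs_def])
      hence "deriv qD z = (deriv th (z + 1 / 2) * th z - th (z + 1 / 2) * deriv th z) / (th z * th z)"
        by (rule DERIV_imp_deriv)
      thus ?case by (simp add: power_divide power2_eq_square)
    qed
  qed
qed

sublocale qD2: even_elliptic \<tau> "\<lambda>z. (qD z)\<^sup>2" "qc\<^sup>2"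
proof
  show "(\<lambda>z. (qD z)\<^sup>2) holomorphic_on - \<Lambda>" by (intro holomorphic_intros qD_holomorphic)
  show "((\<lambda>z. z\<^sup>2 * (qD z)\<^sup>2) \<longlongrightarrow> qc\<^sup>2) (at 0)"
    using tendsto_power[OF qD_pole, of 2] by (simp add: power_mult_distrib)
qed (use qc_nz in \<open>simp_all add: qD_1 qD_tau qD_minus\<close>)

definition kappa :: complex where "kappa = (qD (\<tau> / 2))\<^sup>2"

lemma kappa_nz: "kappa \<noteq> 0"
  by (simp add: kappa_def qD_def th_eq_0_iff)

text \<open>By evenness, the square of \<open>deriv qD\<close> is a polynomial of degree at most 2
  in the square of \<open>qD\<close>. The pole at 0 gives the leading coefficient. The zeros \<tau>
  / 2 and \<tau> / 2 + 1 / 2 of \<open>deriv qD\<close> give the roots \<kappa> and 1 /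
  \<kappa>.\<close>

lemma qD_ode:
  assumes k1: "kappa\<^sup>2 \<noteq> 1" and z: "z \<notin> \<Lambda>"
  shows "qc\<^sup>2 * (deriv qD z)\<^sup>2 = (qD z) ^ 4 - (kappa + 1 / kappa) * (qD z)\<^sup>2 + 1"
proof -
  have lim: "((\<lambda>z. z ^ (2 * 2) * (deriv qD z)\<^sup>2) \<longlongrightarrow> qc\<^sup>2) (at 0)"
    using tendsto_power[OF deriv_qD_pole, of 2] by (simp add: power_mult_distrib flip: power_mult)
  have "(\<lambda>z. (deriv qD z)\<^sup>2) holomorphic_on - \<Lambda>"
    by (intro holomorphic_intros holomorphic_deriv qD_holomorphic open_compl_lat)
  from qD2.even_elliptic_poly[OF this _ _ _ lim]
  obtain p where p: "degree p \<le> 2" "\<And>z. z \<notin> \<Lambda> \<Longrightarrow> (deriv qD z)\<^sup>2 = poly p ((qD z)\<^sup>2)"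
    by (auto simp: deriv_qD_1 deriv_qD_tau deriv_qD_minus)
  define a b c where "a = coeff p 0" and "b = coeff p 1" and "c = coeff p 2"
  have poly: "poly p t = a + b * t + c * t\<^sup>2" for t
  proof -
    have "poly p t = (\<Sum>i\<le>2. coeff p i * t ^ i)"
      unfolding poly_altdef
      by (rule sum.mono_neutral_left) (use p(1) in \<open>auto simp: coeff_eq_0\<close>)
    thus ?thesis by (simp add: a_def b_def c_def numeral_2_eq_2)
  qed
  have "((\<lambda>z. z ^ 4 * a + b * z\<^sup>2 * (z * qD z)\<^sup>2 + c * (z * qD z) ^ 4) \<longlongrightarrow> 0 ^ 4 * a + b * 0\<^sup>2 * qc\<^sup>2 + c * qc ^ 4) (at 0)"
    by (intro tendsto_intros qD_pole)
  moreover have "\<forall>\<^sub>F z in at 0. z ^ 4 * a + b * z\<^sup>2 * (z * qD z)\<^sup>2 + c * (z * qD z) ^ 4 =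
                   z ^ (2 * 2) * (deriv qD z)\<^sup>2"
    using eventually_not_lat[of 0]
    by eventually_elim (simp add: p(2) poly, simp add: algebra_simps eval_nat_numeral)
  ultimately have "((\<lambda>z. z ^ (2 * 2) * (deriv qD z)\<^sup>2) \<longlongrightarrow> 0 ^ 4 * a + b * 0\<^sup>2 * qc\<^sup>2 + c * qc ^ 4) (at 0)"
    by (rule Lim_transform_eventually)
  hence "((\<lambda>z. z ^ (2 * 2) * (deriv qD z)\<^sup>2) \<longlongrightarrow> c * qc ^ 4) (at 0)" by simp
  with lim have "c * qc ^ 4 = qc\<^sup>2" using tendsto_unique[OF at_neq_bot] by blast
  hence c: "c * qc\<^sup>2 = 1" using qc_nz by (simp add: eval_nat_numeral)
  have 1: "a + b * kappa + c * kappa\<^sup>2 = 0"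
    using p(2)[of "\<tau> / 2"] by (simp add: poly kappa_def deriv_qD_half_periods)
  have "a + b * (1 / kappa) + c * (1 / kappa)\<^sup>2 = 0"
    using p(2)[of "\<tau> / 2 + 1 / 2"]
    by (simp add: poly kappa_def deriv_qD_half_periods qD_half power_divide)
  hence 2: "a * kappa\<^sup>2 + b * kappa + c = 0"
    using kappa_nz by (simp add: field_simps power2_eq_square)
  \<comment> \<open>Subtracting the two root conditions eliminates b; for \<kappa>^2 \<noteq> 1 the
    polynomial is therefore reciprocal.\<close>
  have "(a - c) * (kappa\<^sup>2 - 1) = (a * kappa\<^sup>2 + b * kappa + c) - (a + b * kappa + c * kappa\<^sup>2)"
    by (simp add: algebra_simps)
  hence ac: "a = c" using 1 2 k1 by simp
  hence b: "b = - c * (kappa + 1 / kappa)"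
    using 1 kappa_nz by (simp add: field_simps power2_eq_square eq_neg_iff_add_eq_0)
  have "qc\<^sup>2 * (deriv qD z)\<^sup>2 = (c * qc\<^sup>2) * (1 - (kappa + 1 / kappa) * (qD z)\<^sup>2 + (qD z)\<^sup>2 ^ 2)"
    by (simp add: p(2)[OF z] poly ac b algebra_simps)
  thus ?thesis by (simp add: c flip: power_mult)
qed

end

text \<open>In Jacobi's notation (theta_3 / theta_4)^2 at 0 for the nome s, the reciprocal of the
  complementary modulus.\<close>

definition kap :: "complex \<Rightarrow> complex" where
  "kap s = (qprod (s\<^sup>2) (- s) / qprod (s\<^sup>2) s) ^ 4"

lemma (in half_plane) kappa_eq: "kappa = kap (cexp (\<tau> / 2))"
proof -
  let ?s = "cexp (\<tau> / 2)"
  have q: "cexp \<tau> = ?s\<^sup>2" by (simp add: cexp_power)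
  have "th (\<tau> / 2) = (qprod (?s\<^sup>2) ?s)\<^sup>2"
    by (simp add: th_def q power2_eq_square)
  moreover have "th (\<tau> / 2 + 1 / 2) = (qprod (?s\<^sup>2) (- ?s))\<^sup>2"
    by (simp add: th_def q power2_eq_square cexp_add)
  ultimately show ?thesis
    by (simp add: kappa_def kap_def qD_def power_divide flip: power_mult)
qed

section \<open>Uniformization and the addition theorem\<close>

text \<open>The addition theorem and the study of homomorphisms rest on this interface. The scalar
  \<delta> absorbs the normalization of the lattice, so that an arbitrary Weierstrass equation
  fits.\<close>

locale uniformization = even_elliptic +
  fixes E :: weierstrass and y :: "complex \<Rightarrow> complex" and \<delta> :: complex
  assumes ell: "elliptic_curve E"
    and delta_nz: "\<delta> \<noteq> 0"
    and x_deriv: "\<And>z. z \<notin> \<Lambda> \<Longrightarrow> (x has_field_derivative \<delta> * y z) (at z)"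
    and curve_eq: "\<And>z. z \<notin> \<Lambda> \<Longrightarrow> y z ^ 2 = x z ^ 3 + coeff_a E * x z + coeff_b E"
begin

abbreviation "a \<equiv> coeff_a E"
abbreviation "b \<equiv> coeff_b E"

lemma y_hol: "y holomorphic_on - \<Lambda>"
proof -
  have "(\<lambda>z. deriv x z / \<delta>) holomorphic_on - \<Lambda>"
    by (intro holomorphic_intros holomorphic_deriv x_hol open_compl_lat) (rule delta_nz)
  thus ?thesis
    by (rule holomorphic_transform) (use DERIV_imp_deriv[OF x_deriv] delta_nz in auto)
qed

lemma y_lat:
  assumes "w \<in> \<Lambda>" "z \<notin> \<Lambda>"
  shows "y (z + w) = y z"
proof -
  have "((\<lambda>z. x (z + w)) has_field_derivative \<delta> * y z) (at z)"
    using x_deriv assms by (simp add: x_lat)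
  hence "(x has_field_derivative \<delta> * y z) (at (z + w))" by (simp add: DERIV_shift)
  moreover have "(x has_field_derivative \<delta> * y (z + w)) (at (z + w))"
    using assms by (intro x_deriv) simp
  ultimately have "\<delta> * y z = \<delta> * y (z + w)" by (rule DERIV_unique)
  thus ?thesis using delta_nz by simp
qed

lemma y_odd:
  assumes "z \<notin> \<Lambda>"
  shows "y (- z) = - y z"
proof -
  have "((\<lambda>z. x (- z)) has_field_derivative \<delta> * y (- z) * (-1)) (at z)"
    by (rule DERIV_chain2[where g = uminus, OF x_deriv]) (use assms in \<open>auto intro!: derivative_eq_intros\<close>)
  hence "(x has_field_derivative - (\<delta> * y (- z))) (at z)" by (simp add: x_even)
  with x_deriv[OF assms] have "\<delta> * y z = - (\<delta> * y (- z))" using DERIV_unique by blast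
  thus ?thesis using delta_nz by (metis minus_mult_right mult_cancel_left minus_minus)
qed

lemma x_at_infinity: "filterlim x at_infinity (at 0)"
proof -
  have "((\<lambda>z::complex. z\<^sup>2) \<longlongrightarrow> 0\<^sup>2) (at 0)" by (intro tendsto_intros)
  hence "filterlim (\<lambda>z::complex. z\<^sup>2) (at 0) (at 0)"
    by (intro filterlim_atI) (simp_all add: eventually_at_filter)
  from filterlim_divide_at_infinity[OF x_pole this L_nz]
  have 1: "filterlim (\<lambda>z. z\<^sup>2 * x z / z\<^sup>2) at_infinity (at 0)" .
  have ev: "\<forall>\<^sub>F z in at 0. z\<^sup>2 * x z / z\<^sup>2 = x z"
    using eventually_neq_at_within[of 0] by eventually_elim simp
  from 1 show ?thesis unfolding filterlim_cong[OF refl refl ev] .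
qed

lemma x_nonconst: "\<exists>z. z \<notin> \<Lambda> \<and> x z \<noteq> c"
proof (rule ccontr)
  assume *: "\<nexists>z. z \<notin> \<Lambda> \<and> x z \<noteq> c"
  have "\<forall>\<^sub>F z in at 0. x z = c" using eventually_not_lat[of 0] by eventually_elim (use * in auto)
  hence "(x \<longlongrightarrow> c) (at 0)" by (rule tendsto_eventually)
  from not_tendsto_and_filterlim_at_infinity[OF at_neq_bot this x_at_infinity] show False .
qed

lemma eventually_x_neq:
  assumes "p \<notin> \<Lambda>"
  shows "\<forall>\<^sub>F z in at p. x z \<noteq> c"
proof -
  obtain z where z: "z \<notin> \<Lambda>" "x z \<noteq> c" using x_nonconst by blast
  have "\<forall>\<^sub>F w in at p. x w - c \<noteq> 0 \<and> w \<in> - \<Lambda>"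
    by (rule non_zero_neighbour_alt[where \<beta> = z])
       (use z assms in \<open>auto intro!: holomorphic_intros x_hol open_compl_lat connected_compl_countable countable_lat\<close>)
  thus ?thesis by (rule eventually_mono) auto
qed

lemma x_isCont: "z \<notin> \<Lambda> \<Longrightarrow> isCont x z"
  using x_deriv DERIV_isCont by blast

text \<open>Differentiating the curve equation gives the formula multiplied by y, which has zeros at
  the half periods. It is cancelled on an open set without zeros of y, and the identity theorem does
  the rest.\<close>

lemma y_deriv:
  assumes "z \<notin> \<Lambda>"
  shows "(y has_field_derivative \<delta> / 2 * (3 * x z ^ 2 + a)) (at z)"
proof -
  define g where "g = (\<lambda>z. deriv y z - \<delta> / 2 * (3 * x z ^ 2 + a))"
  have y': "(y has_field_derivative deriv y z) (at z)" if "z \<notin> \<Lambda>" for z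
    using holomorphic_derivI[OF y_hol open_compl_lat, of z UNIV] that by simp
  have g_hol: "g holomorphic_on - \<Lambda>"
    unfolding g_def by (intro holomorphic_intros x_hol holomorphic_deriv y_hol open_compl_lat) auto
  have yg: "y z * g z = 0" if z: "z \<notin> \<Lambda>" for z
  proof -
    have "((\<lambda>z. y z ^ 2) has_field_derivative 2 * y z * deriv y z) (at z)"
      by (rule derivative_eq_intros y'[OF z] refl | simp)+
    moreover have "((\<lambda>z. x z ^ 3 + a * x z + b) has_field_derivative (3 * x z ^ 2 + a) * (\<delta> * y z)) (at z)"
      by (rule derivative_eq_intros x_deriv[OF z] refl | simp add: algebra_simps)+
    hence "((\<lambda>z. y z ^ 2) has_field_derivative (3 * x z ^ 2 + a) * (\<delta> * y z)) (at z)"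
      by (rule has_field_derivative_transform_within_open[OF _ open_compl_lat])
         (use z curve_eq in auto)
    ultimately have "2 * y z * deriv y z = (3 * x z ^ 2 + a) * (\<delta> * y z)" by (rule DERIV_unique)
    hence "2 * (y z * g z) = 0" by (simp add: g_def algebra_simps)
    thus ?thesis by simp
  qed
  have "\<exists>z0. z0 \<notin> \<Lambda> \<and> y z0 \<noteq> 0"
  proof (rule ccontr)
    assume "\<nexists>z0. z0 \<notin> \<Lambda> \<and> y z0 \<noteq> 0"
    hence "\<And>z. z \<in> - \<Lambda> \<Longrightarrow> (x has_field_derivative 0) (at z)"
      using x_deriv by fastforce
    hence "x constant_on - \<Lambda>"
      by (intro DERIV_zero_connected_constant_on[of _ "{}"] connected_compl_countable countable_lat open_compl_lat)
         (use x_hol holomorphic_on_imp_continuous_on in auto)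
    thus False using x_nonconst by (auto simp: constant_on_def)
  qed
  then obtain z0 where z0: "z0 \<notin> \<Lambda>" "y z0 \<noteq> 0" by blast
  have "isCont y z0" using y'[OF z0(1)] DERIV_isCont by blast
  hence "\<forall>\<^sub>F z in nhds z0. y z \<noteq> 0 \<and> z \<in> - \<Lambda>"
    using z0 open_compl_lat
    by (intro eventually_conj eventually_nhds_in_open tendsto_imp_eventually_ne[where c = "y z0"])
       (auto simp: isCont_def tendsto_at_iff_tendsto_nhds)
  then obtain S where S: "open S" "z0 \<in> S" "\<And>z. z \<in> S \<Longrightarrow> y z \<noteq> 0 \<and> z \<notin> \<Lambda>"
    by (auto simp: eventually_nhds)
  have "g z = 0"
    by (rule analytic_continuation_open[of S "- \<Lambda>" g "\<lambda>_. 0"])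
       (use S g_hol yg assms in \<open>auto intro!: open_compl_lat connected_compl_countable countable_lat\<close>)
  hence "deriv y z = \<delta> / 2 * (3 * x z ^ 2 + a)" by (simp add: g_def)
  thus ?thesis using y'[OF assms] by metis
qed

lemma y_isCont: "z \<notin> \<Lambda> \<Longrightarrow> isCont y z"
  using y_deriv DERIV_isCont by blast

lemma x_tendsto: "(f \<longlongrightarrow> p) F \<Longrightarrow> p \<notin> \<Lambda> \<Longrightarrow> ((\<lambda>z. x (f z)) \<longlongrightarrow> x p) F"
  using x_isCont isCont_tendsto_compose by blast

lemma y_tendsto: "(f \<longlongrightarrow> p) F \<Longrightarrow> p \<notin> \<Lambda> \<Longrightarrow> ((\<lambda>z. y (f z)) \<longlongrightarrow> y p) F"
  using y_isCont isCont_tendsto_compose by blast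

text \<open>The curve equation gives (y / x^2)^2 = 1 / x + a / x^3 + b / x^4, and 1 / x tends to 0.
  This controls y at the pole.\<close>

lemma y_over_x_sq: "((\<lambda>w. y w * inverse (x w) ^ 2) \<longlongrightarrow> 0) (at 0)"
proof -
  define t where "t = (\<lambda>w. inverse (x w))"
  have t: "(t \<longlongrightarrow> 0) (at 0)"
    unfolding t_def by (rule filterlim_compose[OF tendsto_inverse_0 x_at_infinity])
  have "((\<lambda>w. t w + a * t w ^ 3 + b * t w ^ 4) \<longlongrightarrow> 0 + a * 0 ^ 3 + b * 0 ^ 4) (at 0)"
    by (intro tendsto_intros t)
  moreover have "\<forall>\<^sub>F w in at 0. t w + a * t w ^ 3 + b * t w ^ 4 = (y w * t w ^ 2) ^ 2"
    using eventually_not_lat[of 0] filterlim_at_infinity_imp_eventually_ne[OF x_at_infinity, of 0]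
  proof eventually_elim
    case (elim w)
    have 1: "x w * t w = 1" using elim by (simp add: t_def)
    have "(y w * t w ^ 2) ^ 2 = (x w ^ 3 + a * x w + b) * t w ^ 4"
      using elim by (simp add: power_mult_distrib curve_eq flip: power_mult)
    also have "\<dots> = (x w * t w) ^ 3 * t w + a * (x w * t w) * t w ^ 3 + b * t w ^ 4"
      by (simp add: algebra_simps eval_nat_numeral)
    finally show ?case by (simp add: 1)
  qed
  ultimately have "((\<lambda>w. (y w * t w ^ 2) ^ 2) \<longlongrightarrow> 0 + a * 0 ^ 3 + b * 0 ^ 4) (at 0)"
    by (rule Lim_transform_eventually)
  hence "((\<lambda>w. norm ((y w * t w ^ 2) ^ 2)) \<longlongrightarrow> 0) (at 0)" by (simp add: tendsto_norm_zero)
  hence "((\<lambda>w. sqrt (norm (y w * t w ^ 2) ^ 2)) \<longlongrightarrow> sqrt 0) (at 0)"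
    unfolding norm_power by (rule tendsto_real_sqrt)
  thus ?thesis by (simp add: t_def tendsto_norm_zero_iff)
qed

section \<open>The addition theorem\<close>

definition chord :: "complex \<Rightarrow> complex \<Rightarrow> complex" where
  "chord c w = ((y w - y (c - w)) / (x w - x (c - w)))\<^sup>2 - x (c - w) - x w"

text \<open>By the curve equations the slope l has derivative \<delta> / 2 times x w - x (c - w). So
  l^2 has derivative \<delta> (y w - y (c - w)), which cancels against the two x terms.\<close>

lemma chord_deriv:
  assumes w: "w \<notin> \<Lambda>" "c - w \<notin> \<Lambda>" "x w \<noteq> x (c - w)"
  shows "(chord c has_field_derivative 0) (at w)"
proof -
  define d where "d = x w - x (c - w)"
  define e where "e = y w - y (c - w)"
  have d: "d \<noteq> 0" using w by (simp add: d_def)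
  have cw: "((\<lambda>w. c - w) has_field_derivative -1) (at w)"
    by (auto intro!: derivative_eq_intros)
  have X: "((\<lambda>w. x (c - w)) has_field_derivative - (\<delta> * y (c - w))) (at w)"
    using DERIV_chain2[where g = "\<lambda>w. c - w" and x = w, OF x_deriv[OF w(2)] cw] by simp
  have Y: "((\<lambda>w. y (c - w)) has_field_derivative - (\<delta> / 2 * (3 * x (c - w) ^ 2 + a))) (at w)"
    using DERIV_chain2[where g = "\<lambda>w. c - w" and x = w, OF y_deriv[OF w(2)] cw] by simp
  have key: "(\<delta> / 2 * (3 * x w ^ 2 + a) + \<delta> / 2 * (3 * x (c - w) ^ 2 + a)) * d - e * (\<delta> * y w + \<delta> * y (c - w))
          = \<delta> / 2 * d * (d * d)"
  proof -
    have "e * (\<delta> * y w + \<delta> * y (c - w)) = \<delta> * (y w ^ 2 - y (c - w) ^ 2)"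
      by (simp add: e_def algebra_simps power2_eq_square)
    also have "\<dots> = \<delta> * (x w ^ 3 + a * x w - x (c - w) ^ 3 - a * x (c - w))"
      by (simp add: curve_eq[OF w(1)] curve_eq[OF w(2)])
    finally have ek: "e * (\<delta> * y w + \<delta> * y (c - w)) =
      \<delta> * (x w ^ 3 + a * x w - x (c - w) ^ 3 - a * x (c - w))" .
    show ?thesis unfolding ek d_def by (simp add: field_simps eval_nat_numeral)
  qed
  have "((\<lambda>w. (y w - y (c - w)) / (x w - x (c - w))) has_field_derivative
      ((\<delta> / 2 * (3 * x w ^ 2 + a) - - (\<delta> / 2 * (3 * x (c - w) ^ 2 + a))) * (x w - x (c - w)) -
       (y w - y (c - w)) * (\<delta> * y w - - (\<delta> * y (c - w)))) / ((x w - x (c - w)) * (x w - x (c - w)))) (at w)"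
    by (intro DERIV_divide DERIV_diff X Y x_deriv y_deriv w) (use w in simp)
  moreover have "((\<delta> / 2 * (3 * x w ^ 2 + a) - - (\<delta> / 2 * (3 * x (c - w) ^ 2 + a))) * (x w - x (c - w)) -
       (y w - y (c - w)) * (\<delta> * y w - - (\<delta> * y (c - w)))) / ((x w - x (c - w)) * (x w - x (c - w))) = \<delta> / 2 * d"
    unfolding d_def [symmetric] e_def [symmetric] diff_minus_eq_add key using d by simp
  ultimately have l: "((\<lambda>w. (y w - y (c - w)) / (x w - x (c - w))) has_field_derivative \<delta> / 2 * d) (at w)"
    by (rule back_subst[of "\<lambda>D. (_ has_field_derivative D) _"])
  have "((\<lambda>w. ((y w - y (c - w)) / (x w - x (c - w)))\<^sup>2) has_field_derivative \<delta> * e) (at w)"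
    using DERIV_power[OF l, of 2] d by (simp flip: d_def e_def)
  hence "(chord c has_field_derivative \<delta> * e - - (\<delta> * y (c - w)) - \<delta> * y w) (at w)"
    unfolding chord_def by (intro DERIV_diff X x_deriv w)
  also have "\<delta> * e - - (\<delta> * y (c - w)) - \<delta> * y w = 0"
    by (simp add: e_def algebra_simps)
  finally show ?thesis .
qed

text \<open>The squared slope and x w both blow up at w = 0. Multiplying numerator and denominator
  by t^2, where t = 1 / x w, and replacing (y w)^2 by the cubic cancels the poles; in the result
  \<open>g\<close> the singular quantities enter only through t and y t^2, both tending to
  0.\<close>

lemma chord_limit:
  assumes c: "c \<notin> \<Lambda>"
  shows "(chord c \<longlongrightarrow> x c) (at 0)"
proof -
  define t where "t = (\<lambda>w. inverse (x w))"
  have t: "(t \<longlongrightarrow> 0) (at 0)"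
    unfolding t_def by (rule filterlim_compose[OF tendsto_inverse_0 x_at_infinity])
  have v: "((\<lambda>w. y w * t w ^ 2) \<longlongrightarrow> 0) (at 0)" unfolding t_def by (rule y_over_x_sq)
  have cw: "((\<lambda>w. c - w) \<longlongrightarrow> c) (at 0)" by (auto intro!: tendsto_eq_intros)
  note X = x_tendsto[OF cw c] and Y = y_tendsto[OF cw c]
  define g where "g = (\<lambda>w. (a * t w + b * t w ^ 2 - 2 * y (c - w) * (y w * t w ^ 2) + y (c - w) ^ 2 * t w ^ 2
             + x (c - w) + x (c - w) ^ 2 * t w - x (c - w) ^ 3 * t w ^ 2) / (1 - x (c - w) * t w) ^ 2)"
  have "(g \<longlongrightarrow> (a * 0 + b * 0 ^ 2 - 2 * y c * 0 + y c ^ 2 * 0 ^ 2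
             + x c + x c ^ 2 * 0 - x c ^ 3 * 0 ^ 2) / (1 - x c * 0) ^ 2) (at 0)"
    unfolding g_def by (intro tendsto_intros t v X Y) auto
  hence "(g \<longlongrightarrow> x c) (at 0)" by simp
  moreover have "\<forall>\<^sub>F w in at 0. c - w \<in> - \<Lambda>"
    using c by (intro topological_tendstoD[OF cw open_compl_lat]) simp
  hence "\<forall>\<^sub>F w in at 0. g w = chord c w"
    using eventually_not_lat[of 0] filterlim_at_infinity_imp_eventually_ne[OF x_at_infinity, of 0]
      filterlim_at_infinity_imp_eventually_ne[OF tendsto_add_filterlim_at_infinity'[OF x_at_infinity tendsto_minus[OF X]], of 0]
  proof eventually_elim
    case (elim w)
    define X Y \<xi> \<eta> where "X = x (c - w)" and "Y = y (c - w)" and "\<xi> = x w" and "\<eta> = y w"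
    have nz: "\<xi> \<noteq> 0" "\<xi> \<noteq> X" using elim by (auto simp: \<xi>_def X_def)
    have eq: "\<eta> ^ 2 = \<xi> ^ 3 + a * \<xi> + b" using curve_eq elim by (simp add: \<xi>_def \<eta>_def)
    define T where "T = inverse \<xi>"
    have T: "T * \<xi> = 1" using nz by (simp add: T_def)
    define N where "N = a * T + b * T ^ 2 - 2 * Y * (\<eta> * T ^ 2) + Y ^ 2 * T ^ 2 + X + X ^ 2 * T - X ^ 3 * T ^ 2"
    have "N * \<xi> ^ 2 = a * \<xi> * (T * \<xi>) + b * (T * \<xi>) ^ 2 - 2 * Y * \<eta> * (T * \<xi>) ^ 2 + Y ^ 2 * (T * \<xi>) ^ 2
        + X * \<xi> ^ 2 + X ^ 2 * \<xi> * (T * \<xi>) - X ^ 3 * (T * \<xi>) ^ 2"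
      by (simp add: N_def algebra_simps power2_eq_square)
    also have "\<dots> = (\<eta> - Y) ^ 2 - (X + \<xi>) * (\<xi> - X) ^ 2"
      unfolding T using eq by (simp add: algebra_simps power2_eq_square power3_eq_cube)
    finally have 1: "N * \<xi> ^ 2 = (\<eta> - Y) ^ 2 - (X + \<xi>) * (\<xi> - X) ^ 2" .
    have "(1 - X * T) * \<xi> = \<xi> - X * (T * \<xi>)" by (simp add: algebra_simps)
    hence 2: "(1 - X * T) ^ 2 * \<xi> ^ 2 = (\<xi> - X) ^ 2" unfolding T by (simp flip: power_mult_distrib)
    have "N / (1 - X * T) ^ 2 = N * \<xi> ^ 2 / ((1 - X * T) ^ 2 * \<xi> ^ 2)" using nz by simp
    also have "\<dots> = (\<eta> - Y) ^ 2 / (\<xi> - X) ^ 2 - (X + \<xi>)"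
      unfolding 1 2 diff_divide_distrib[of "(\<eta> - Y) ^ 2"] using nz by simp
    also have "\<dots> = ((\<eta> - Y) / (\<xi> - X))\<^sup>2 - X - \<xi>"
      by (simp only: power_divide diff_diff_eq)
    finally have "N / (1 - X * T) ^ 2 = ((\<eta> - Y) / (\<xi> - X))\<^sup>2 - X - \<xi>" .
    thus ?case by (simp add: g_def chord_def N_def T_def X_def Y_def \<xi>_def \<eta>_def t_def)
  qed
  ultimately show ?thesis by (rule Lim_transform_eventually)
qed

text \<open>On a punctured ball around 0 the chord value is constant, with limit x c. With the
  denominator cleared, the relation also makes sense where x w = x (c - w), so the identity theorem
  extends it to \<open>V\<close>, which is connected as the complement of a countable set.\<close>

lemma chord_identity:
  assumes c: "c \<notin> \<Lambda>" and w: "w \<notin> \<Lambda>" "c - w \<notin> \<Lambda>"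
  shows "(y w - y (c - w))\<^sup>2 = (x (c - w) + x w + x c) * (x w - x (c - w))\<^sup>2"
proof -
  define V where "V = - (\<Lambda> \<union> (\<lambda>w. c - w) ` \<Lambda>)"
  have V_iff: "w \<in> V \<longleftrightarrow> w \<notin> \<Lambda> \<and> c - w \<notin> \<Lambda>" for w
    by (auto simp: V_def image_iff intro: bexI[of _ "c - w"])
  have "open V"
  proof -
    have "V = - \<Lambda> \<inter> (\<lambda>w. c - w) -` (- \<Lambda>)" by (auto simp: V_iff)
    thus ?thesis using open_compl_lat by (auto intro!: open_Int open_vimage continuous_intros)
  qed
  have "connected V"
    unfolding V_def by (intro connected_compl_countable countable_Un countable_image countable_lat)
  have cw: "((\<lambda>w. c - w) \<longlongrightarrow> c) (at 0)" by (auto intro!: tendsto_eq_intros)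
  have "\<forall>\<^sub>F w in at 0. c - w \<in> - \<Lambda>"
    using topological_tendstoD[OF cw open_compl_lat] c by auto
  hence "\<forall>\<^sub>F w in at 0. w \<in> V \<and> x w \<noteq> x (c - w)"
    using eventually_not_lat[of 0]
      filterlim_at_infinity_imp_eventually_ne[OF tendsto_add_filterlim_at_infinity'[OF x_at_infinity tendsto_minus[OF x_tendsto[OF cw c]]], of 0]
    by eventually_elim (auto simp: V_iff)
  then obtain r where r: "r > 0" "\<And>w. w \<noteq> 0 \<Longrightarrow> dist w 0 < r \<Longrightarrow> w \<in> V \<and> x w \<noteq> x (c - w)"
    by (auto simp: eventually_at)
  define B where "B = ball (0::complex) r - {0}"
  have B: "w \<in> V" "x w \<noteq> x (c - w)" if "w \<in> B" for w using r that by (auto simp: B_def dist_commute)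
  have dh: "(chord c has_field_derivative 0) (at w)" if "w \<in> B" for w
    using B[OF that] by (intro chord_deriv) (auto simp: V_iff)
  have "chord c constant_on B"
  proof (rule DERIV_zero_connected_constant_on[of _ "{}"])
    show "connected B" unfolding B_def by (intro connected_punctured_ball) simp
    show "open B" by (auto simp: B_def)
    show "continuous_on B (chord c)" using dh by (meson DERIV_isCont continuous_at_imp_continuous_on)
  qed (use dh in auto)
  then obtain k where k: "\<And>w. w \<in> B \<Longrightarrow> chord c w = k" by (auto simp: constant_on_def)
  have evB: "\<forall>\<^sub>F w in at 0. w \<in> B"
    unfolding B_def using r by (intro eventually_at_in_open) auto
  have "(chord c \<longlongrightarrow> k) (at 0)" by (rule tendsto_eventually) (use evB k in \<open>auto elim!: eventually_mono\<close>)
  moreover have "(chord c \<longlongrightarrow> x c) (at 0)" by (rule chord_limit[OF c])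
  ultimately have kc: "k = x c" using tendsto_unique[OF at_neq_bot] by blast
  define H where "H = (\<lambda>w. (y w - y (c - w))\<^sup>2 - (x (c - w) + x w + x c) * (x w - x (c - w))\<^sup>2)"
  have comp: "(\<lambda>w. f (c - w)) holomorphic_on V" if "f holomorphic_on - \<Lambda>" for f
  proof -
    have "(\<lambda>w. c - w) holomorphic_on V" by (intro holomorphic_intros)
    moreover have "(\<lambda>w. c - w) ` V \<subseteq> - \<Lambda>" by (auto simp: V_iff)
    ultimately show ?thesis using holomorphic_on_compose_gen[OF _ that] by (simp add: o_def)
  qed
  have hV: "f holomorphic_on V" if "f holomorphic_on - \<Lambda>" for f
    by (rule holomorphic_on_subset[OF that]) (auto simp: V_iff)
  have "H w = 0"
  proof (rule analytic_continuation_open[of B V H "\<lambda>_. 0"])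
    show "H holomorphic_on V" unfolding H_def
      by (intro holomorphic_intros comp hV x_hol y_hol)
    show "B \<noteq> {}"
      using eventually_happens[OF evB] by auto
    show "H w = 0" if "w \<in> B" for w
    proof -
      have "((y w - y (c - w)) / (x w - x (c - w)))\<^sup>2 = x (c - w) + x w + x c"
        using k[OF that] by (simp add: chord_def kc algebra_simps)
      thus ?thesis using B(2)[OF that] by (simp add: H_def power_divide field_simps)
    qed
  qed (use B \<open>open V\<close> \<open>connected V\<close> w in \<open>auto simp: V_iff B_def\<close>)
  thus ?thesis by (simp add: H_def)
qed

lemma x_add:
  assumes "z \<notin> \<Lambda>" "w \<notin> \<Lambda>" "z + w \<notin> \<Lambda>" "x z \<noteq> x w"
  shows "x (z + w) = ((y w - y z) / (x w - x z))\<^sup>2 - x z - x w"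
proof -
  have "(y w - y z)\<^sup>2 = (x z + x w + x (z + w)) * (x w - x z)\<^sup>2"
    using chord_identity[of "z + w" w] assms by simp
  hence "((y w - y z) / (x w - x z))\<^sup>2 = x z + x w + x (z + w)"
    using assms(4) by (simp add: power_divide)
  thus ?thesis by simp
qed

text \<open>Differentiate the formula for x (z + w) in z with w fixed: the left-hand side becomes
  \<delta> y (z + w), and twice the derivative of the slope is \<delta> (x z - x (z + w)).\<close>

lemma y_add:
  assumes zw: "z \<notin> \<Lambda>" "w \<notin> \<Lambda>" "z + w \<notin> \<Lambda>" "x z \<noteq> x w"
  shows "y (z + w) = (y w - y z) / (x w - x z) * (x z - x (z + w)) - y z"
proof -
  define l where "l = (\<lambda>u. (y w - y u) / (x w - x u))"
  define d e where "d = x w - x z" and "e = y w - y z"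
  have d: "d \<noteq> 0" using zw by (simp add: d_def)
  have lz: "l z = e / d" by (simp add: l_def d_def e_def)
  define l' where "l' = ((0 - \<delta> / 2 * (3 * x z ^ 2 + a)) * d - e * (0 - \<delta> * y z)) / (d * d)"
  have l: "(l has_field_derivative l') (at z)"
    unfolding l_def l'_def d_def e_def
    by (intro DERIV_divide DERIV_diff DERIV_const x_deriv y_deriv zw) (use zw in auto)
  have "((\<lambda>u. (l u)\<^sup>2 - x u - x w) has_field_derivative 2 * l z * l' - \<delta> * y z - 0) (at z)"
    using DERIV_power[OF l, of 2] by (intro DERIV_diff DERIV_const x_deriv zw) (simp add: mult_ac)
  moreover have "((\<lambda>u. (l u)\<^sup>2 - x u - x w) has_field_derivative \<delta> * y (z + w)) (at z)"
  proof (rule has_field_derivative_cong_ev[THEN iffD1, OF refl])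
    show "((\<lambda>u. x (u + w)) has_field_derivative \<delta> * y (z + w)) (at z)"
      using x_deriv[OF zw(3)] by (simp add: DERIV_shift)
    have 1: "\<forall>\<^sub>F u in nhds z. u \<in> - \<Lambda>"
      using open_compl_lat zw by (intro eventually_nhds_in_open) auto
    have "open ((\<lambda>u. u + w) -` (- \<Lambda>))"
      by (intro open_vimage open_compl_lat continuous_intros)
    hence 2: "\<forall>\<^sub>F u in nhds z. u \<in> (\<lambda>u. u + w) -` (- \<Lambda>)"
      using zw by (intro eventually_nhds_in_open) auto
    have "\<forall>\<^sub>F u in nhds z. x u \<in> - {x w}"
      using x_isCont[OF zw(1)] zw(4)
      by (intro topological_tendstoD[where l = "x z"]) (auto simp: isCont_def tendsto_at_iff_tendsto_nhds)
    with 1 2 show "\<forall>\<^sub>F u in nhds z. u \<in> UNIV \<longrightarrow> x (u + w) = (l u)\<^sup>2 - x u - x w"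
      by eventually_elim (use zw in \<open>auto simp: x_add l_def\<close>)
  qed (use zw in \<open>auto simp: x_add l_def\<close>)
  ultimately have "2 * l z * l' - \<delta> * y z - 0 = \<delta> * y (z + w)" by (rule DERIV_unique)
  moreover have "2 * l' = \<delta> * (x z - x (z + w))"
  proof -
    have e2: "e * (y w + y z) = d * (x z ^ 2 + x z * x w + x w ^ 2 + a)"
    proof -
      have "e * (y w + y z) = y w ^ 2 - y z ^ 2" by (simp add: e_def algebra_simps power2_eq_square)
      also have "\<dots> = d * (x z ^ 2 + x z * x w + x w ^ 2 + a)"
        unfolding curve_eq[OF zw(1)] curve_eq[OF zw(2)] by (simp add: d_def algebra_simps eval_nat_numeral)
      finally show ?thesis .
    qed
    have "x z - x (z + w) = x z + x z + x w - (e / d)\<^sup>2"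
      using x_add[OF zw] by (simp add: d_def e_def)
    hence "(x z - x (z + w)) * (d * d) = (2 * x z + x w) * (d * d) - e * e"
      using d by (simp add: power_divide field_simps power2_eq_square)
    moreover have "2 * l' * (d * d) = \<delta> * (2 * e * y z - (3 * x z ^ 2 + a) * d)"
      using d by (simp add: l'_def field_simps)
    moreover have "2 * e * y z - (3 * x z ^ 2 + a) * d = (2 * x z + x w) * (d * d) - e * e"
    proof -
      have "2 * e * y z = e * (y w + y z) - e * e" by (simp add: e_def algebra_simps)
      also have "\<dots> = d * (x z ^ 2 + x z * x w + x w ^ 2 + a) - e * e" by (simp only: e2)
      finally have *: "2 * e * y z = d * (x z ^ 2 + x z * x w + x w ^ 2 + a) - e * e" .
      show ?thesis unfolding * by (simp add: d_def algebra_simps eval_nat_numeral)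
    qed
    ultimately have "2 * l' * (d * d) = \<delta> * (x z - x (z + w)) * (d * d)" by simp
    thus ?thesis using d by simp
  qed
  moreover have "2 * l z * l' = l z * (2 * l')" by simp
  ultimately have "\<delta> * y (z + w) = l z * (\<delta> * (x z - x (z + w))) - \<delta> * y z" by simp
  hence "\<delta> * y (z + w) = \<delta> * (l z * (x z - x (z + w)) - y z)" by (simp add: algebra_simps)
  thus ?thesis using delta_nz by (simp add: lz d_def e_def)
qed

lemma xy_inj:
  assumes z: "z \<notin> \<Lambda>" and w: "w \<notin> \<Lambda>" and eq: "x z = x w" "y z = y w"
  shows "z - w \<in> \<Lambda>"
proof (rule ccontr)
  assume n: "z - w \<notin> \<Lambda>"
  \<comment> \<open>By the addition theorem \<open>x (z + v) = x (w + v)\<close> for generic \<open>v\<close>; as \<open>v\<close> tends to \<open>- w\<close>, only the right-hand side is unbounded.\<close>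
  have "((\<lambda>v. z + v) \<longlongrightarrow> z - w) (at (- w))" by (auto intro!: tendsto_eq_intros)
  hence 1: "((\<lambda>v. x (z + v)) \<longlongrightarrow> x (z - w)) (at (- w))" and
    ev: "\<forall>\<^sub>F v in at (- w). z + v \<in> - \<Lambda>"
    using n by (auto intro!: x_tendsto) (use n open_compl_lat topological_tendstoD in fastforce)
  have mw: "- w \<notin> \<Lambda>" using w by simp
  have shift: "filterlim (\<lambda>v. w + v) (at 0) (at (- w))"
    by (auto intro!: filterlim_atI tendsto_eq_intros simp: eventually_at_filter add_eq_0_iff)
  have "filterlim (\<lambda>v. x (w + v)) at_infinity (at (- w))"
    by (rule filterlim_compose[OF x_at_infinity shift])
  moreover have "\<forall>\<^sub>F v in at (- w). w + v \<notin> \<Lambda>"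
    using eventually_compose_filterlim[OF eventually_not_lat shift] .
  hence "\<forall>\<^sub>F v in at (- w). x (w + v) = x (z + v)"
    using ev eventually_not_lat[of "- w"] eventually_x_neq[OF mw, of "x w"]
    by eventually_elim (use w z in \<open>auto simp: x_add eq\<close>)
  ultimately have 2: "filterlim (\<lambda>v. x (z + v)) at_infinity (at (- w))"
    by (rule filterlim_cong[OF refl refl, THEN iffD1, rotated])
  from not_tendsto_and_filterlim_at_infinity[OF at_neq_bot 1 2] show False .
qed

lemma y_nz: "z \<notin> \<Lambda> \<Longrightarrow> z + z \<notin> \<Lambda> \<Longrightarrow> y z \<noteq> 0"
  using xy_inj[of z "- z"] y_odd[of z] by (auto simp: x_even)

text \<open>Let v tend to z in the addition formulas for z + v. The slope is a quotient of two
  difference quotients and tends to y'(z) / x'(z), whose denominator is nonzero by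
  \<open>y_nz\<close>.\<close>

lemma xy_double:
  assumes z: "z \<notin> \<Lambda>" "z + z \<notin> \<Lambda>"
  defines "m \<equiv> (3 * x z ^ 2 + a) / (2 * y z)"
  shows "x (z + z) = m\<^sup>2 - x z - x z" "y (z + z) = m * (x z - x (z + z)) - y z"
proof -
  have ynz: "y z \<noteq> 0" using y_nz z by blast
  have zv: "((\<lambda>v. z + v) \<longlongrightarrow> z + z) (at z)" and v: "((\<lambda>v. v) \<longlongrightarrow> z) (at z)"
    by (auto intro!: tendsto_eq_intros)
  have ev: "\<forall>\<^sub>F v in at z. z + v \<in> - \<Lambda>"
    using z by (intro topological_tendstoD[OF zv open_compl_lat]) simp
  have ev: "\<forall>\<^sub>F v in at z. z + v \<notin> \<Lambda> \<and> v \<notin> \<Lambda> \<and> x v \<noteq> x z \<and> v \<noteq> z"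
    using ev eventually_not_lat[of z] eventually_x_neq[OF z(1), of "x z"] eventually_neq_at_within[of z]
    by eventually_elim auto
  define l where "l = (\<lambda>v. (y v - y z) / (x v - x z))"
  have "((\<lambda>v. (y v - y z) / (v - z) / ((x v - x z) / (v - z))) \<longlongrightarrow> (\<delta> / 2 * (3 * x z ^ 2 + a)) / (\<delta> * y z)) (at z)"
    using x_deriv[OF z(1)] y_deriv[OF z(1)] ynz delta_nz
    by (intro tendsto_divide) (auto simp: has_field_derivative_iff)
  also have "(\<delta> / 2 * (3 * x z ^ 2 + a)) / (\<delta> * y z) = m"
    using delta_nz by (simp add: m_def)
  finally have "(l \<longlongrightarrow> m) (at z)"
    by (rule Lim_transform_eventually) (use ev in \<open>auto elim!: eventually_mono simp: l_def\<close>)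
  hence "((\<lambda>v. (l v)\<^sup>2 - x z - x v) \<longlongrightarrow> m\<^sup>2 - x z - x z) (at z)"
    and 2: "((\<lambda>v. l v * (x z - x (z + v)) - y z) \<longlongrightarrow> m * (x z - x (z + z)) - y z) (at z)"
    using z by (intro tendsto_intros x_tendsto zv v; simp)+
  hence "((\<lambda>v. x (z + v)) \<longlongrightarrow> m\<^sup>2 - x z - x z) (at z)"
    by (rule_tac Lim_transform_eventually) (use ev z in \<open>auto elim!: eventually_mono simp: l_def x_add\<close>)
  thus "x (z + z) = m\<^sup>2 - x z - x z"
    using x_tendsto[OF zv z(2)] tendsto_unique[OF at_neq_bot] by blast
  from 2 have "((\<lambda>v. y (z + v)) \<longlongrightarrow> m * (x z - x (z + z)) - y z) (at z)"
    by (rule Lim_transform_eventually) (use ev z in \<open>auto elim!: eventually_mono simp: l_def y_add\<close>)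
  thus "y (z + z) = m * (x z - x (z + z)) - y z"
    using y_tendsto[OF zv z(2)] tendsto_unique[OF at_neq_bot] by blast
qed

section \<open>The group isomorphism from the complex torus to the curve\<close>

definition Phi :: "complex \<Rightarrow> ec_point" where
  "Phi z = (if z \<in> \<Lambda> then Infinity else Affine (x z) (y z))"

lemma Phi_in [simp]: "Phi z \<in> ec_points E"
  using curve_eq by (auto simp: Phi_def ec_points_def)

lemma Phi_eq_Infinity_iff [simp]: "Phi z = Infinity \<longleftrightarrow> z \<in> \<Lambda>"
  by (simp add: Phi_def)

lemma Phi_0 [simp]: "Phi 0 = Infinity"
  by simp

lemma Phi_lat [simp]: "w \<in> \<Lambda> \<Longrightarrow> Phi (z + w) = Phi z"
  by (simp add: Phi_def x_lat y_lat)

lemma Phi_eq_iff: "Phi z = Phi w \<longleftrightarrow> z - w \<in> \<Lambda>"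
proof
  assume "Phi z = Phi w"
  thus "z - w \<in> \<Lambda>"
    by (cases "z \<in> \<Lambda>"; cases "w \<in> \<Lambda>") (auto simp: Phi_def intro: xy_inj)
next
  assume "z - w \<in> \<Lambda>"
  from Phi_lat[OF this, of w] show "Phi z = Phi w" by simp
qed

lemma Phi_add: "ec_add E (Phi z) (Phi w) = Phi (z + w)"
proof -
  consider "z \<in> \<Lambda>" | "z \<notin> \<Lambda>" "w \<in> \<Lambda>" | "z \<notin> \<Lambda>" "w \<notin> \<Lambda>" "z + w \<in> \<Lambda>"
    | "z \<notin> \<Lambda>" "w \<notin> \<Lambda>" "z + w \<notin> \<Lambda>" "x z \<noteq> x w"
    | "z \<notin> \<Lambda>" "w \<notin> \<Lambda>" "z + w \<notin> \<Lambda>" "x z = x w" by blast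
  thus ?thesis
  proof cases
    case 1
    thus ?thesis using Phi_lat[of z w] by (simp add: Phi_def[of z] add.commute)
  next
    case 2
    thus ?thesis by (simp add: Phi_def x_lat y_lat)
  next
    case 3
    have "Phi w = Phi (- z)" using 3 by (simp add: Phi_eq_iff add.commute)
    hence "x w = x z" "y w = - y z" using 3 by (auto simp: Phi_def x_even y_odd)
    thus ?thesis using 3 by (simp add: Phi_def)
  next
    case 4
    thus ?thesis by (simp add: Phi_def x_add y_add Let_def)
  next
    case 5
    \<comment> \<open>Equal x-coordinates leave y z = y w or y z = - y w, and the latter would put z
      + w into the lattice. So w is congruent to z and the doubling formula applies.\<close>
    have ne: "y z \<noteq> - y w"
    proof
      assume "y z = - y w"
      hence "Phi z = Phi (- w)" using 5 by (simp add: Phi_def x_even y_odd)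
      thus False using 5 by (simp add: Phi_eq_iff)
    qed
    have "y z ^ 2 = y w ^ 2" using 5 by (simp add: curve_eq)
    hence yy: "y z = y w" using ne by (simp add: power2_eq_iff)
    hence "Phi w = Phi z" using 5 by (simp add: Phi_def)
    hence "w - z \<in> \<Lambda>" by (simp add: Phi_eq_iff)
    from Phi_lat[OF this, of "z + z"] lat_add_cancel(1)[OF this, of "z + z"]
    have *: "Phi (z + w) = Phi (z + z)" "z + z \<notin> \<Lambda>" using 5 by (simp_all add: algebra_simps)
    from xy_double[OF 5(1) *(2)] show ?thesis
      unfolding *(1) using 5 ne yy * by (simp add: Phi_def Let_def)
  qed
qed

text \<open>If c were omitted, 1 / (x - c) would be elliptic without poles and tend to 0 at 0, hence
  vanish identically, which a reciprocal cannot do.\<close>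

lemma x_surj: "\<exists>z. z \<notin> \<Lambda> \<and> x z = c"
proof (rule ccontr)
  assume "\<nexists>z. z \<notin> \<Lambda> \<and> x z = c"
  hence ne: "x z \<noteq> c" if "z \<notin> \<Lambda>" for z using that by blast
  define F where "F = (\<lambda>z. inverse (x z - c))"
  have hol: "F holomorphic_on - \<Lambda>" unfolding F_def using ne by (intro holomorphic_intros x_hol) auto
  have "filterlim (\<lambda>z. x z + (- c)) at_infinity (at 0)"
    by (intro tendsto_add_filterlim_at_infinity' x_at_infinity) (rule tendsto_const)
  hence F0: "(F \<longlongrightarrow> 0) (at 0)"
    unfolding F_def using filterlim_compose[OF tendsto_inverse_0] by force
  obtain k where k: "\<And>z. z \<notin> \<Lambda> \<Longrightarrow> F z = k"
    using elliptic_removable_const[OF hol _ _ F0] by (auto simp: F_def x_per)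
  have "(F \<longlongrightarrow> k) (at 0)"
    using eventually_not_lat[of 0] k by (auto intro!: tendsto_eventually elim!: eventually_mono)
  with F0 have "k = 0" using tendsto_unique[OF at_neq_bot] by blast
  with k[of "1/2"] ne[of "1/2"] show False by (simp add: F_def)
qed

lemma Phi_surj:
  assumes "P \<in> ec_points E"
  obtains z where "Phi z = P"
proof (cases P)
  case Infinity
  thus ?thesis using that[of 0] by simp
next
  case (Affine X Y)
  with assms have eq: "Y ^ 2 = X ^ 3 + a * X + b" by (simp add: ec_points_def)
  obtain z where z: "z \<notin> \<Lambda>" "x z = X" using x_surj by blast
  hence "Y ^ 2 = y z ^ 2" using eq by (simp add: curve_eq)
  hence "Y = y z \<or> Y = - y z" by (simp add: power2_eq_iff)
  thus ?thesis using that[of z] that[of "- z"] z Affine by (auto simp: Phi_def x_even y_odd)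
qed

end

section \<open>Homomorphisms and lattices\<close>

locale unif_pair =
  A: uniformization \<tau> x L E y \<delta> + B: uniformization \<tau>' x' L' E' y' \<delta>'
  for \<tau> x L E y \<delta> \<tau>' x' L' E' y' \<delta>'
begin

text \<open>Preimages under \<open>A.Phi\<close> differ by lattice points, so the value is
  independent of the choice as soon as \<alpha> maps the first lattice into the second.\<close>

definition hmap :: "complex \<Rightarrow> ec_point \<Rightarrow> ec_point" where
  "hmap \<alpha> = (\<lambda>P\<in>ec_points E. B.Phi (\<alpha> * (SOME z. A.Phi z = P)))"

lemma hmap_Phi:
  assumes "\<And>w. w \<in> lat \<tau> \<Longrightarrow> \<alpha> * w \<in> lat \<tau>'"
  shows "hmap \<alpha> (A.Phi z) = B.Phi (\<alpha> * z)"
proof -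
  have "A.Phi (SOME u. A.Phi u = A.Phi z) = A.Phi z" by (rule someI) (rule refl)
  hence "(SOME u. A.Phi u = A.Phi z) - z \<in> lat \<tau>" by (simp add: A.Phi_eq_iff)
  from assms[OF this] show ?thesis
    by (simp add: hmap_def B.Phi_eq_iff right_diff_distrib)
qed

lemma hmap_hom:
  assumes "\<And>w. w \<in> lat \<tau> \<Longrightarrow> \<alpha> * w \<in> lat \<tau>'"
  shows "hmap \<alpha> \<in> hom (ec_group E) (ec_group E')"
proof (rule homI)
  fix P assume "P \<in> carrier (ec_group E)"
  thus "hmap \<alpha> P \<in> carrier (ec_group E')"
    by (auto simp: ec_group_def hmap_def)
next
  fix P Q assume "P \<in> carrier (ec_group E)" "Q \<in> carrier (ec_group E)"
  then obtain z w where "P = A.Phi z" "Q = A.Phi w"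
    by (metis A.Phi_surj ec_group_def partial_object.select_convs(1))
  thus "hmap \<alpha> (P \<otimes>\<^bsub>ec_group E\<^esub> Q) = hmap \<alpha> P \<otimes>\<^bsub>ec_group E'\<^esub> hmap \<alpha> Q"
    by (simp add: ec_group_def A.Phi_add B.Phi_add hmap_Phi[OF assms] distrib_left)
qed

lemma x_multiplication_rational:
  assumes lat: "\<And>w. w \<in> lat \<tau> \<Longrightarrow> \<alpha> * w \<in> lat \<tau>'" and nz: "\<alpha> \<noteq> 0"
  obtains N Q where "Q \<noteq> 0"
    "\<And>z. \<alpha> * z \<in> lat \<tau>' \<Longrightarrow> z \<notin> lat \<tau> \<Longrightarrow> poly Q (x z) = 0"
    "\<And>z. \<alpha> * z \<notin> lat \<tau>' \<Longrightarrow> x' (\<alpha> * z) * poly Q (x z) = poly N (x z)"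
proof -
  define P where "P = {z. \<alpha> * z \<in> lat \<tau>'}"
  \<comment> \<open>Representatives of all poles outside the lattice. Several may belong to one
    class, which merely raises the order of the zeros of \<open>R\<close>.\<close>
  define S where "S = {p \<in> P - lat \<tau>. norm p \<le> 1 + norm \<tau>}"
  have sub: "lat \<tau> \<subseteq> P" using lat by (auto simp: P_def)
  have scale: "filterlim (\<lambda>z. \<alpha> * z) (at (\<alpha> * p)) (at p)" for p
    using nz by (auto intro!: filterlim_atI tendsto_eq_intros simp: eventually_at_filter)
  have disc: "\<forall>\<^sub>F z in at p. z \<notin> P" for p
    using eventually_compose_filterlim[OF B.eventually_not_lat scale] by (simp add: P_def)
  have "finite (cball 0 (1 + norm \<tau>) \<inter> P)"
    using disc by (intro finite_not_islimpt_in_compact) (auto simp: islimpt_iff_eventually)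
  hence fin: "finite S" by (rule rev_finite_subset) (auto simp: S_def)
  define R where "R = (\<lambda>z. \<Prod>s\<in>S. (x z - x s)\<^sup>2)"
  define Q where "Q = (\<Prod>s\<in>S. [:- x s, 1:]\<^sup>2)"
  have Q: "poly Q (x z) = R z" for z by (simp add: Q_def R_def poly_prod)
  have Q0: "Q \<noteq> 0" using fin by (simp add: Q_def)
  have R0: "R z = 0" if z: "z \<in> P" "z \<notin> lat \<tau>" for z
  proof -
    obtain w where w: "w \<in> lat \<tau>" "norm (z - w) \<le> 1 + norm \<tau>" using A.lat_reduce .
    have "\<alpha> * (z - w) \<in> lat \<tau>'" using lat[OF w(1)] z by (auto simp: P_def right_diff_distrib)
    hence "z - w \<in> S" using w z by (simp add: S_def P_def)
    moreover have "x z = x (z - w)" using A.x_lat[of "- w" z] w by simp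
    ultimately show ?thesis unfolding R_def using fin by (intro prod_zero) auto
  qed
  \<comment> \<open>The factor \<open>R\<close> cancels the double poles outside \<open>lat \<tau>\<close>, so the product is a polynomial in \<open>x\<close>.\<close>
  define G where "G = (\<lambda>z. x' (\<alpha> * z) * R z)"
  have "open (- P)"
  proof -
    have "- P = (\<lambda>z. \<alpha> * z) -` (- lat \<tau>')" by (auto simp: P_def)
    thus ?thesis using B.open_compl_lat by (auto intro!: open_vimage continuous_intros)
  qed
  have R_hol: "R holomorphic_on - lat \<tau>" unfolding R_def by (intro holomorphic_intros A.x_hol)
  have G_hol: "G holomorphic_on - P"
  proof -
    have "(\<lambda>z. \<alpha> * z) holomorphic_on - P" "(\<lambda>z. \<alpha> * z) ` (- P) \<subseteq> - lat \<tau>'"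
      by (auto simp: P_def intro!: holomorphic_intros)
    from holomorphic_on_compose_gen[OF this(1) B.x_hol this(2)]
    have "(\<lambda>z. x' (\<alpha> * z)) holomorphic_on - P" by (simp add: o_def)
    moreover have "R holomorphic_on - P" using R_hol sub by (rule_tac holomorphic_on_subset) auto
    ultimately show ?thesis unfolding G_def by (intro holomorphic_intros)
  qed
  have pole: "((\<lambda>z. (z - p)\<^sup>2 * x' (\<alpha> * z)) \<longlongrightarrow> L' / \<alpha>\<^sup>2) (at p)" if p: "p \<in> P" for p
  proof -
    have "filterlim (\<lambda>z. \<alpha> * (z - p)) (at 0) (at p)"
      using nz by (auto intro!: filterlim_atI tendsto_eq_intros simp: eventually_at_filter)
    from filterlim_compose[OF B.x_pole this]
    have "((\<lambda>z. (\<alpha> * (z - p))\<^sup>2 * x' (\<alpha> * (z - p)) / \<alpha>\<^sup>2) \<longlongrightarrow> L' / \<alpha>\<^sup>2) (at p)"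
      by (intro tendsto_divide tendsto_const) (use nz in auto)
    moreover have "x' (\<alpha> * (z - p)) = x' (\<alpha> * z)" for z
      using B.x_lat[of "- (\<alpha> * p)" "\<alpha> * z"] p by (simp add: P_def right_diff_distrib)
    ultimately show ?thesis using nz by (simp add: power_mult_distrib)
  qed
  have lim: "\<exists>l. (G \<longlongrightarrow> l) (at p)" if p: "p \<in> P - lat \<tau>" for p
  proof -
    obtain w where w: "w \<in> lat \<tau>" "norm (p - w) \<le> 1 + norm \<tau>" using A.lat_reduce .
    define s where "s = p - w"
    have "\<alpha> * (p - w) \<in> lat \<tau>'" using lat[OF w(1)] p by (auto simp: P_def right_diff_distrib)
    hence s: "s \<in> S" using w p by (simp add: S_def P_def s_def)
    have xs: "x s = x p" using A.x_lat[of "- w" p] w by (simp add: s_def)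
    define R' where "R' = (\<lambda>z. \<Prod>s\<in>S - {s}. (x z - x s)\<^sup>2)"
    have R': "R z = (x z - x p)\<^sup>2 * R' z" for z
      unfolding R_def R'_def using fin s by (subst prod.remove[of S s]) (auto simp: xs)
    have "R' holomorphic_on - lat \<tau>" unfolding R'_def by (intro holomorphic_intros A.x_hol)
    hence "isCont R' p"
      using p A.open_compl_lat by (metis DiffD2 ComplI continuous_on_eq_continuous_at holomorphic_on_imp_continuous_on)
    hence 1: "(R' \<longlongrightarrow> R' p) (at p)" by (simp add: isCont_def)
    have 2: "((\<lambda>z. (x z - x p) / (z - p)) \<longlongrightarrow> \<delta> * y p) (at p)"
      using A.x_deriv[of p] p by (simp add: has_field_derivative_iff)
    have "((\<lambda>z. ((z - p)\<^sup>2 * x' (\<alpha> * z)) * ((x z - x p) / (z - p))\<^sup>2 * R' z) \<longlongrightarrow> L' / \<alpha>\<^sup>2 * (\<delta> * y p)\<^sup>2 * R' p) (at p)"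
      by (intro tendsto_intros 1 2 pole) (use p in auto)
    moreover have "\<forall>\<^sub>F z in at p. ((z - p)\<^sup>2 * x' (\<alpha> * z)) * ((x z - x p) / (z - p))\<^sup>2 * R' z = G z"
      using eventually_neq_at_within[of p]
      by eventually_elim (simp add: G_def R' power_divide)
    ultimately have "(G \<longlongrightarrow> L' / \<alpha>\<^sup>2 * (\<delta> * y p)\<^sup>2 * R' p) (at p)" by (rule Lim_transform_eventually)
    thus ?thesis by blast
  qed
  have rs: "remove_sings G holomorphic_on - lat \<tau>" "\<And>z. z \<notin> P \<Longrightarrow> remove_sings G z = G z"
    using remove_sings_holomorphic[OF G_hol disc lim A.closed_lat] by auto
  define H where "H = remove_sings G"
  have H_comp: "H (g z) = H z" if "\<And>z. G (g z) = G z" "filtermap g (at z) = at (g z)" for g z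
  proof -
    have "G \<circ> g = G" using that(1) by (simp add: fun_eq_iff)
    with remove_sings_compose[OF that(2), of G] show ?thesis by (simp add: H_def)
  qed
  have xper: "x' (\<alpha> * (z + w)) = x' (\<alpha> * z)" if "w \<in> lat \<tau>" for z w
    using B.x_lat[OF lat[OF that], of "\<alpha> * z"] by (simp add: distrib_left)
  have shift: "filtermap (\<lambda>z. z + w) (at z) = at (z + w)" for z w :: complex
    using filtermap_at_shift[of "- w" z] by simp
  have G1: "G (z + 1) = G z" "G (z + \<tau>) = G z" "G (- z) = G z" for z
    by (simp_all add: G_def R_def xper A.x_per A.x_even B.x_even)
  define n where "n = card S"
  \<comment> \<open>At 0 the factor \<open>x' (\<alpha> * z)\<close> has a pole of order 2, and each
    of the n squared factors of \<open>R\<close> one of order 4.\<close>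
  have Hlim: "((\<lambda>z. z ^ (2 * (1 + 2 * n)) * H z) \<longlongrightarrow> L' / \<alpha>\<^sup>2 * (\<Prod>s\<in>S. (L - 0\<^sup>2 * x s)\<^sup>2)) (at 0)"
  proof (rule Lim_transform_eventually)
    show "((\<lambda>z. ((z - 0)\<^sup>2 * x' (\<alpha> * z)) * (\<Prod>s\<in>S. (z\<^sup>2 * x z - z\<^sup>2 * x s)\<^sup>2)) \<longlongrightarrow>
       L' / \<alpha>\<^sup>2 * (\<Prod>s\<in>S. (L - 0\<^sup>2 * x s)\<^sup>2)) (at 0)"
      by (intro tendsto_intros A.x_pole pole) (simp add: P_def)
    show "\<forall>\<^sub>F z in at 0. ((z - 0)\<^sup>2 * x' (\<alpha> * z)) * (\<Prod>s\<in>S. (z\<^sup>2 * x z - z\<^sup>2 * x s)\<^sup>2) = z ^ (2 * (1 + 2 * n)) * H z"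
      using disc[of 0]
    proof eventually_elim
      case (elim z)
      have "(\<Prod>s\<in>S. (z\<^sup>2 * x z - z\<^sup>2 * x s)\<^sup>2) = (\<Prod>s\<in>S. z ^ 4 * (x z - x s)\<^sup>2)"
        by (intro prod.cong refl) (simp add: power_mult_distrib flip: right_diff_distrib power_mult)
      also have "\<dots> = z ^ (4 * n) * R z" by (simp add: prod.distrib R_def n_def power_mult)
      finally show ?case using rs(2)[OF elim] by (simp add: H_def G_def power_add power2_eq_square)
    qed
  qed
  obtain N where N: "\<And>z. z \<notin> lat \<tau> \<Longrightarrow> H z = poly N (x z)"
    using A.even_elliptic_poly[OF rs(1)[folded H_def] _ _ _ Hlim]
      H_comp[OF G1(1) shift] H_comp[OF G1(2) shift] H_comp[OF G1(3) filtermap_at_minus] by auto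
  show ?thesis
  proof (rule that[OF Q0])
    show "poly Q (x z) = 0" if "\<alpha> * z \<in> lat \<tau>'" "z \<notin> lat \<tau>" for z
      using R0 that by (simp add: Q P_def)
    show "x' (\<alpha> * z) * poly Q (x z) = poly N (x z)" if "\<alpha> * z \<notin> lat \<tau>'" for z
    proof -
      have "z \<notin> P" "z \<notin> lat \<tau>" using that sub by (auto simp: P_def)
      thus ?thesis using N[of z] rs(2)[of z] by (simp add: H_def G_def Q)
    qed
  qed
qed

text \<open>Differentiating x' (\<alpha> z) Q (x z) = N (x z) expresses y' (\<alpha> z) as y z times
  a rational function of x z with denominator Q^2. This fixes the common denominator, and so the
  first numerator becomes N Q.\<close>

lemma hmap_ec_hom:
  assumes lat: "\<And>w. w \<in> lat \<tau> \<Longrightarrow> \<alpha> * w \<in> lat \<tau>'" and nz: "\<alpha> \<noteq> 0"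
  shows "hmap \<alpha> \<in> ec_hom E E'"
proof -
  obtain N Q where Q: "Q \<noteq> 0" "\<And>z. \<alpha> * z \<in> lat \<tau>' \<Longrightarrow> z \<notin> lat \<tau> \<Longrightarrow> poly Q (x z) = 0"
    and N: "\<And>z. \<alpha> * z \<notin> lat \<tau>' \<Longrightarrow> x' (\<alpha> * z) * poly Q (x z) = poly N (x z)"
    using x_multiplication_rational[OF lat nz] by metis
  define c where "c = \<delta> / (\<alpha> * \<delta>')"
  define M where "M = pderiv N * Q - N * pderiv Q"
  have y'_eq: "y' (\<alpha> * z) = poly M (x z) * c * y z / poly (Q\<^sup>2) (x z)"
    if z: "z \<notin> lat \<tau>" and q: "poly Q (x z) \<noteq> 0" for z
  proof -
    have az: "\<alpha> * z \<notin> lat \<tau>'" using Q(2) z q by blast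
    have xd: "(x has_field_derivative \<delta> * y z) (at z)" using A.x_deriv z .
    have pd: "((\<lambda>z. poly p (x z)) has_field_derivative poly (pderiv p) (x z) * (\<delta> * y z)) (at z)" for p
      by (rule DERIV_chain2[OF poly_DERIV xd])
    have "((\<lambda>z. x' (\<alpha> * z)) has_field_derivative \<delta>' * y' (\<alpha> * z) * \<alpha>) (at z)"
      by (rule DERIV_chain2[where g = "\<lambda>z. \<alpha> * z" and x = z, OF B.x_deriv[OF az]]) (auto intro!: derivative_eq_intros)
    from DERIV_mult[OF this pd[of Q]]
    have 1: "((\<lambda>z. x' (\<alpha> * z) * poly Q (x z)) has_field_derivative
       \<delta>' * y' (\<alpha> * z) * \<alpha> * poly Q (x z) + poly (pderiv Q) (x z) * (\<delta> * y z) * x' (\<alpha> * z)) (at z)" .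
    have "open ((\<lambda>z. \<alpha> * z) -` (- lat \<tau>'))"
      by (intro open_vimage B.open_compl_lat continuous_intros)
    hence "((\<lambda>z. x' (\<alpha> * z) * poly Q (x z)) has_field_derivative poly (pderiv N) (x z) * (\<delta> * y z)) (at z)"
      by (rule has_field_derivative_transform_within_open[OF pd[of N]]) (use az N in auto)
    with 1 have eq: "\<delta>' * y' (\<alpha> * z) * \<alpha> * poly Q (x z) + poly (pderiv Q) (x z) * (\<delta> * y z) * x' (\<alpha> * z)
        = poly (pderiv N) (x z) * (\<delta> * y z)" by (rule DERIV_unique)
    have "\<delta>' * y' (\<alpha> * z) * \<alpha> * poly Q (x z) ^ 2 =
       poly Q (x z) * (poly (pderiv N) (x z) * (\<delta> * y z)) - poly (pderiv Q) (x z) * (\<delta> * y z) * (x' (\<alpha> * z) * poly Q (x z))"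
      unfolding eq [symmetric] by (simp add: algebra_simps power2_eq_square)
    also have "\<dots> = poly M (x z) * (\<delta> * y z)"
      unfolding N[OF az] by (simp add: M_def algebra_simps)
    finally have "\<delta>' * y' (\<alpha> * z) * \<alpha> * poly Q (x z) ^ 2 = poly M (x z) * (\<delta> * y z)" .
    thus ?thesis using q nz B.delta_nz by (simp add: c_def field_simps)
  qed
  have "given_by_rational_functions E (hmap \<alpha>)"
    unfolding given_by_rational_functions_def
  proof (rule exI[of _ "[:N * Q:]"], rule exI[of _ "[:0, smult c M:]"], rule exI[of _ "[:Q\<^sup>2:]"],
      intro conjI allI impI)
    obtain X where X: "poly Q X \<noteq> 0" using Q(1) poly_all_0_iff_0 by blast
    obtain z where "z \<notin> lat \<tau>" "x z = X" using A.x_surj by blast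
    thus "\<exists>X Y. Affine X Y \<in> ec_points E \<and> poly_xy [:Q\<^sup>2:] X Y \<noteq> 0"
      using A.Phi_in[of z] X by (intro exI[of _ "x z"] exI[of _ "y z"]) (auto simp: A.Phi_def poly_xy_def)
  next
    fix X Y assume XY: "Affine X Y \<in> ec_points E" and q: "poly_xy [:Q\<^sup>2:] X Y \<noteq> 0"
    obtain z where z: "A.Phi z = Affine X Y" using A.Phi_surj[OF XY] .
    hence z': "z \<notin> lat \<tau>" "x z = X" "y z = Y" by (auto simp: A.Phi_def split: if_splits)
    have qz: "poly Q (x z) \<noteq> 0" using q z' by (auto simp: poly_xy_def)
    hence az: "\<alpha> * z \<notin> lat \<tau>'" using Q(2) z' by blast
    have "x' (\<alpha> * z) = poly (N * Q) (x z) / poly (Q\<^sup>2) (x z)"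
      using N[OF az] qz by (simp add: field_simps power2_eq_square)
    thus "hmap \<alpha> (Affine X Y) =
      Affine (poly_xy [:N * Q:] X Y / poly_xy [:Q\<^sup>2:] X Y) (poly_xy [:0, smult c M:] X Y / poly_xy [:Q\<^sup>2:] X Y)"
      using hmap_Phi[OF lat, of z] az y'_eq[OF z'(1) qz] z z'
      by (simp add: B.Phi_def poly_xy_def mult_ac)
  qed
  thus ?thesis
    using hmap_hom[OF lat] by (auto simp: ec_hom_def hmap_def)
qed

lemma hmap_0: "hmap 0 = ec_zero_hom E"
  by (auto simp: hmap_def ec_zero_hom_def fun_eq_iff)

lemma hmap_eq_iff:
  assumes "\<And>w. w \<in> lat \<tau> \<Longrightarrow> \<alpha> * w \<in> lat \<tau>'" "\<And>w. w \<in> lat \<tau> \<Longrightarrow> \<beta> * w \<in> lat \<tau>'"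
  shows "hmap \<alpha> = hmap \<beta> \<longleftrightarrow> \<alpha> = \<beta>"
proof
  assume eq: "hmap \<alpha> = hmap \<beta>"
  show "\<alpha> = \<beta>"
  proof (rule ccontr)
    assume ne: "\<alpha> \<noteq> \<beta>"
    have "(\<alpha> - \<beta>) * z \<in> lat \<tau>'" for z
    proof -
      have "B.Phi (\<alpha> * z) = B.Phi (\<beta> * z)" using hmap_Phi[of \<alpha> z] hmap_Phi[of \<beta> z] assms eq by simp
      thus ?thesis by (simp add: B.Phi_eq_iff left_diff_distrib)
    qed
    \<comment> \<open>Distinct multipliers would make every complex number, in particular a half
      period, a multiple (\<alpha> - \<beta>) z and hence a lattice point.\<close>
    moreover have "(\<alpha> - \<beta>) * (1 / 2 / (\<alpha> - \<beta>)) = 1 / 2" using ne by simp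
    ultimately have "1 / 2 \<in> lat \<tau>'" by metis
    thus False by simp
  qed
qed simp

end

section \<open>Algebraic homomorphisms lift to linear maps\<close>

lemma poly_xy_0 [simp]: "poly_xy 0 X Y = 0"
  and poly_xy_pCons [simp]: "poly_xy (pCons c p) X Y = poly c X + Y * poly_xy p X Y"
  by (simp_all add: poly_xy_def)

lemma holomorphic_on_poly_xy [holomorphic_intros]:
  assumes "f holomorphic_on A" "g holomorphic_on A"
  shows "(\<lambda>z. poly_xy p (f z) (g z)) holomorphic_on A"
proof -
  have poly: "(\<lambda>z. poly c (f z)) holomorphic_on A" for c :: "complex poly"
    by (induction c) (auto intro!: holomorphic_intros assms)
  show ?thesis
    by (induction p) (auto intro!: holomorphic_intros assms poly)
qed

text \<open>Repeated halving gives k h = 2^n k (h / 2^n), so k h / h equals the difference quotient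
  at h / 2^n, which tends to the derivative at 0.\<close>

lemma locally_additive_imp_linear:
  fixes k :: "complex \<Rightarrow> complex"
  assumes r: "r > 0" and add: "\<And>u v. norm u < r \<Longrightarrow> norm v < r \<Longrightarrow> norm (u + v) < r \<Longrightarrow> k (u + v) = k u + k v"
    and diff: "(k has_field_derivative d) (at 0)" and h: "norm h < r"
  shows "k h = d * h"
proof (cases "h = 0")
  case True
  thus ?thesis using add[of 0 0] r by simp
next
  case False
  have k0: "k 0 = 0" using add[of 0 0] r by simp
  have pow: "k h = 2 ^ n * k (h / 2 ^ n)" for n
  proof (induction n)
    case (Suc n)
    define u where "u = h / 2 ^ Suc n"
    have uu: "u + u = h / 2 ^ n" by (simp add: u_def field_simps)
    have n2: "norm (h / 2 ^ m) < r" for m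
    proof -
      have "norm (h / 2 ^ m) = norm h / 2 ^ m" by (simp add: norm_divide norm_power)
      also have "\<dots> \<le> norm h" by (simp add: divide_le_eq mult_left_le_one_le one_le_power mult_le_cancel_left1)
      finally show ?thesis using h by simp
    qed
    have "norm u < r" "norm (u + u) < r" unfolding uu unfolding u_def by (rule n2)+
    hence "k (h / 2 ^ n) = 2 * k u" using add[of u u] by (simp add: uu)
    thus ?case using Suc by (simp add: u_def)
  qed simp
  have "(\<lambda>n. h * (1 / 2) ^ n) \<longlonglongrightarrow> h * 0"
    by (intro tendsto_intros LIMSEQ_power_zero) (simp add: norm_divide)
  hence "filterlim (\<lambda>n. h / 2 ^ n) (at 0) sequentially"
    using False by (intro filterlim_atI) (auto simp: power_divide)
  moreover have "((\<lambda>u. k u / u) \<longlongrightarrow> d) (at 0)"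
    using diff by (simp add: has_field_derivative_iff k0)
  ultimately have "(\<lambda>n. k (h / 2 ^ n) / (h / 2 ^ n)) \<longlonglongrightarrow> d"
    using filterlim_compose by blast
  moreover have "k (h / 2 ^ n) / (h / 2 ^ n) = k h / h" for n
    by (subst pow[of n]) simp
  ultimately have "(\<lambda>n::nat. k h / h) \<longlonglongrightarrow> d" by (simp only:)
  hence "k h / h = d" by (simp add: LIMSEQ_const_iff)
  thus ?thesis using False by (simp add: field_simps)
qed

context unif_pair
begin

lemma hom_Phi_add:
  assumes "f \<in> hom (ec_group E) (ec_group E')"
  shows "f (A.Phi (z + w)) = ec_add E' (f (A.Phi z)) (f (A.Phi w))" "f (A.Phi z) \<in> ec_points E'"
  using assms A.Phi_in by (auto simp: hom_def ec_group_def A.Phi_add [symmetric])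

text \<open>Every z is n times some h in the small ball, and additivity carries the formula from h
  to n h.\<close>

lemma hom_linear_globalize:
  assumes f: "f \<in> hom (ec_group E) (ec_group E')" and r: "r > 0"
    and lin: "\<And>h. norm h < r \<Longrightarrow> f (A.Phi h) = B.Phi (\<alpha> * h)"
  shows "f (A.Phi z) = B.Phi (\<alpha> * z)"
proof -
  obtain n :: nat where n: "norm z / r < of_nat n" using reals_Archimedean2 by blast
  have n0: "n > 0"
  proof (rule ccontr)
    assume "\<not> n > 0"
    thus False using n r by (simp add: divide_less_0_iff)
  qed
  define h where "h = z / of_nat n"
  have "norm h < r" using n n0 r by (simp add: h_def norm_divide field_simps)
  hence fh: "f (A.Phi h) = B.Phi (\<alpha> * h)" by (rule lin)
  have "f (A.Phi (of_nat m * h)) = B.Phi (\<alpha> * (of_nat m * h))" for m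
  proof (induction m)
    case 0
    show ?case using lin[of 0] r by simp
  next
    case (Suc m)
    have "f (A.Phi (of_nat m * h + h)) = B.Phi (\<alpha> * (of_nat m * h) + \<alpha> * h)"
      using Suc fh by (simp add: hom_Phi_add[OF f] B.Phi_add)
    thus ?case by (simp add: algebra_simps)
  qed
  from this[of n] show ?thesis using n0 by (simp add: h_def)
qed

lemma B_preimage:
  assumes "f \<in> hom (ec_group E) (ec_group E')"
  obtains u where "B.Phi u = f (A.Phi z)"
  using B.Phi_surj hom_Phi_add(2)[OF assms] by blast

lemma rational_hom_local_lift:
  assumes f: "f \<in> hom (ec_group E) (ec_group E')"
    and U: "open U" "z1 \<in> U" and r1: "r1 holomorphic_on U" and r2: "r2 holomorphic_on U"
    and eq: "\<And>z. z \<in> U \<Longrightarrow> f (A.Phi z) = Affine (r1 z) (r2 z)" and nz: "r2 z1 \<noteq> 0"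
  shows "\<exists>\<alpha>. \<forall>z. f (A.Phi z) = B.Phi (\<alpha> * z)"
proof -
  obtain w1 where w1: "B.Phi w1 = f (A.Phi z1)" using B_preimage[OF f] .
  hence w1': "w1 \<notin> lat \<tau>'" "x' w1 = r1 z1" "y' w1 = r2 z1"
    using eq[OF U(2)] by (auto simp: B.Phi_def split: if_splits)
  \<comment> \<open>The derivative of x' is \<delta>' y', and y' w1 = r2 z1 is nonzero. So x' is
    invertible near w1, and its inverse turns r1 into the holomorphic lift \<open>w\<close>.\<close>
  have "deriv x' w1 \<noteq> 0"
    using DERIV_imp_deriv[OF B.x_deriv[OF w1'(1)]] B.delta_nz w1'(3) nz by simp
  then obtain r where r: "r > 0" "ball w1 r \<subseteq> - lat \<tau>'" "inj_on x' (ball w1 r)"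
    using has_complex_derivative_locally_injective[OF B.x_hol _ B.open_compl_lat, of w1] w1'(1) by auto
  have xh: "x' holomorphic_on ball w1 r" by (rule holomorphic_on_subset[OF B.x_hol r(2)])
  obtain g where g: "g holomorphic_on (x' ` ball w1 r)" "\<And>z. z \<in> ball w1 r \<Longrightarrow> g (x' z) = z"
    using holomorphic_has_inverse[OF xh open_ball r(3)] by metis
  have op: "open (x' ` ball w1 r)" by (rule open_mapping_thm3[OF xh open_ball r(3)])
  define V where "V = U \<inter> r1 -` (x' ` ball w1 r)"
  have "open V"
    unfolding V_def using r1 U op by (metis Int_commute continuous_open_preimage holomorphic_on_imp_continuous_on)
  have z1V: "z1 \<in> V" using U r by (auto simp: V_def w1'(2) [symmetric])
  define w where "w = (\<lambda>z. g (r1 z))"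
  have w_hol: "w holomorphic_on V"
  proof -
    have "r1 holomorphic_on V" by (rule holomorphic_on_subset[OF r1]) (auto simp: V_def)
    moreover have "r1 ` V \<subseteq> x' ` ball w1 r" by (auto simp: V_def)
    ultimately show ?thesis
      using holomorphic_on_compose_gen[OF _ g(1)] by (simp add: w_def o_def)
  qed
  have wV: "w z \<in> ball w1 r" "x' (w z) = r1 z" if "z \<in> V" for z
    using that g(2) by (auto simp: V_def w_def)
  have ww1: "w z1 = w1" using g(2)[of w1] r by (simp add: w_def w1'(2) [symmetric])
  have "(\<lambda>z. y' (w z) + r2 z) holomorphic_on V"
  proof -
    have "w ` V \<subseteq> - lat \<tau>'" using wV r by blast
    from holomorphic_on_compose_gen[OF w_hol B.y_hol this]
    have "(\<lambda>z. y' (w z)) holomorphic_on V" by (simp add: o_def)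
    moreover have "r2 holomorphic_on V" by (rule holomorphic_on_subset[OF r2]) (auto simp: V_def)
    ultimately show ?thesis by (intro holomorphic_intros)
  qed
  \<comment> \<open>The x-coordinate determines y' (w z) only up to sign. Near z1 the sum with r2 z
    is nonzero, which excludes the wrong sign.\<close>
  hence "isCont (\<lambda>z. y' (w z) + r2 z) z1"
    using z1V \<open>open V\<close> by (metis continuous_on_eq_continuous_at holomorphic_on_imp_continuous_on)
  moreover have "y' (w z1) + r2 z1 \<noteq> 0" using nz by (simp add: ww1 w1')
  ultimately have "\<forall>\<^sub>F z in nhds z1. y' (w z) + r2 z \<noteq> 0"
    using tendsto_at_iff_tendsto_nhds[of "\<lambda>z. y' (w z) + r2 z" z1]
    by (intro tendsto_imp_eventually_ne[where c = "y' (w z1) + r2 z1"]) (auto simp: isCont_def)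
  moreover have "\<forall>\<^sub>F z in nhds z1. z \<in> V" using z1V \<open>open V\<close> by (rule eventually_nhds_in_open[rotated])
  ultimately have "\<forall>\<^sub>F z in nhds z1. B.Phi (w z) = f (A.Phi z) \<and> z \<in> V"
  proof eventually_elim
    case (elim z)
    have zU: "z \<in> U" using elim by (simp add: V_def)
    have wz: "w z \<notin> lat \<tau>'" using wV[OF elim(2)] r(2) by auto
    have "Affine (r1 z) (r2 z) \<in> ec_points E'" using hom_Phi_add(2)[OF f, of z] eq[OF zU] by simp
    hence "r2 z ^ 2 = y' (w z) ^ 2" using wV[OF elim(2)] by (simp add: B.curve_eq[OF wz] ec_points_def)
    hence "r2 z = y' (w z)" using elim(1) by (auto simp: power2_eq_iff)
    thus ?case using eq[OF zU] wz wV[OF elim(2)] elim by (simp add: B.Phi_def)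
  qed
  then obtain \<epsilon> where \<epsilon>: "\<epsilon> > 0" "\<And>z. dist z z1 < \<epsilon> \<Longrightarrow> B.Phi (w z) = f (A.Phi z) \<and> z \<in> V"
    by (auto simp: eventually_nhds_metric)
  \<comment> \<open>Translating the lift \<open>w\<close> of \<open>f\<close> near \<open>z1\<close> to the origin makes it additive, hence linear.\<close>
  define k where "k = (\<lambda>h. w (z1 + h) - w1)"
  have k_Phi: "B.Phi (k h) = f (A.Phi h)" if h: "norm h < \<epsilon>" for h
  proof -
    obtain u where u: "B.Phi u = f (A.Phi h)" using B_preimage[OF f] .
    have "B.Phi (w (z1 + h)) = f (A.Phi (z1 + h))" using \<epsilon>(2)[of "z1 + h"] h by (simp add: dist_norm)
    also have "\<dots> = B.Phi (w1 + u)" by (simp add: hom_Phi_add(1)[OF f] u w1 B.Phi_add [symmetric])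
    finally have "w (z1 + h) - (w1 + u) \<in> lat \<tau>'" by (simp add: B.Phi_eq_iff)
    hence "B.Phi (k h) = B.Phi u" by (simp add: k_def B.Phi_eq_iff algebra_simps)
    thus ?thesis using u by simp
  qed
  have k_diff: "(k has_field_derivative deriv w z1) (at 0)"
  proof -
    have "(w has_field_derivative deriv w z1) (at z1)"
      using holomorphic_derivI[OF w_hol \<open>open V\<close> z1V] .
    hence "((\<lambda>h. w (h + z1)) has_field_derivative deriv w z1) (at 0)" by (simp flip: DERIV_shift)
    thus ?thesis unfolding k_def by (auto intro!: derivative_eq_intros simp: add.commute)
  qed
  hence "isCont k 0" by (rule DERIV_isCont)
  hence "(k \<longlongrightarrow> k 0) (nhds 0)" by (simp add: isCont_def tendsto_at_iff_tendsto_nhds [of k])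
  moreover have "k 0 = 0" by (simp add: k_def ww1)
  \<comment> \<open>One third of the separation bound of the lattice, so that the three terms of k
    (u + v) - (k u + k v) together stay below it.\<close>
  moreover define m where "m = min 1 (Im \<tau>') / 3"
  have "m > 0" using B.Im_pos by (simp add: m_def)
  ultimately have "\<forall>\<^sub>F h in nhds 0. norm (k h) < m" by (auto simp: tendsto_iff)
  then obtain \<eta> where \<eta>: "\<eta> > 0" "\<And>h. norm h < \<eta> \<Longrightarrow> norm (k h) < m"
    by (auto simp: eventually_nhds_metric)
  define \<rho> where "\<rho> = min \<epsilon> \<eta>"
  have \<rho>: "\<rho> > 0" using \<epsilon> \<eta> by (simp add: \<rho>_def)
  have lin: "k h = deriv w z1 * h" if "norm h < \<rho>" for h
  proof (rule locally_additive_imp_linear[OF \<rho> _ k_diff that])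
    fix u v :: complex assume uv: "norm u < \<rho>" "norm v < \<rho>" "norm (u + v) < \<rho>"
    have "B.Phi (k (u + v)) = B.Phi (k u + k v)"
      using uv by (simp add: k_Phi \<rho>_def hom_Phi_add(1)[OF f] B.Phi_add [symmetric])
    hence "k (u + v) - (k u + k v) \<in> lat \<tau>'" by (simp add: B.Phi_eq_iff)
    moreover have "norm (k (u + v) - (k u + k v)) < min 1 (Im \<tau>')"
    proof -
      have "norm (k (u + v) - (k u + k v)) \<le> norm (k (u + v)) + (norm (k u) + norm (k v))"
        by (meson add_left_mono norm_triangle_ineq norm_triangle_ineq4 order_trans)
      also have "\<dots> < m + (m + m)" using \<eta>(2)[of u] \<eta>(2)[of v] \<eta>(2)[of "u + v"] uv by (simp add: \<rho>_def)
      finally show ?thesis by (simp add: m_def)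
    qed
    ultimately show "k (u + v) = k u + k v" using B.lat_discrete by fastforce
  qed
  have "f (A.Phi z) = B.Phi (deriv w z1 * z)" for z
    by (rule hom_linear_globalize[OF f \<rho>]) (use lin k_Phi in \<open>simp add: \<rho>_def flip: lin\<close>)
  thus ?thesis by blast
qed

lemma ec_hom_linear:
  assumes f: "f \<in> ec_hom E E'"
  obtains \<alpha> where "\<And>z. f (A.Phi z) = B.Phi (\<alpha> * z)"
proof -
  have fh: "f \<in> hom (ec_group E) (ec_group E')" using f by (auto simp: ec_hom_def)
  show ?thesis
  proof (cases "f = ec_zero_hom E")
    case True
    thus ?thesis by (intro that[of 0]) (simp add: ec_zero_hom_def)
  next
    case False
    then obtain p1 p2 q X0 Y0 where XY: "Affine X0 Y0 \<in> ec_points E" "poly_xy q X0 Y0 \<noteq> 0"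
      and pq: "\<And>X Y. Affine X Y \<in> ec_points E \<Longrightarrow> poly_xy q X Y \<noteq> 0 \<Longrightarrow>
           f (Affine X Y) = Affine (poly_xy p1 X Y / poly_xy q X Y) (poly_xy p2 X Y / poly_xy q X Y)"
      using f unfolding ec_hom_def given_by_rational_functions_def by blast
    obtain z0 where z0: "A.Phi z0 = Affine X0 Y0" using A.Phi_surj[OF XY(1)] .
    hence z0': "z0 \<notin> lat \<tau>" "x z0 = X0" "y z0 = Y0" by (auto simp: A.Phi_def split: if_splits)
    define Q where "Q = (\<lambda>z. poly_xy q (x z) (y z))"
    have Q_hol: "Q holomorphic_on - lat \<tau>" unfolding Q_def by (intro holomorphic_intros A.x_hol A.y_hol)
    define W where "W = (- lat \<tau>) \<inter> Q -` (- {0})"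
    have "open W"
      unfolding W_def using Q_hol A.open_compl_lat
      by (intro continuous_open_preimage holomorphic_on_imp_continuous_on) auto
    moreover have "z0 \<in> W" using z0' XY by (simp add: W_def Q_def)
    ultimately obtain r where r: "r > 0" "ball z0 r \<subseteq> W" using open_contains_ball by blast
    define U where "U = ball z0 r"
    define r1 r2 where "r1 = (\<lambda>z. poly_xy p1 (x z) (y z) / Q z)" and "r2 = (\<lambda>z. poly_xy p2 (x z) (y z) / Q z)"
    have UW: "z \<notin> lat \<tau>" "Q z \<noteq> 0" if "z \<in> U" for z using that r by (auto simp: U_def W_def)
    have hol: "r1 holomorphic_on U" "r2 holomorphic_on U"
      unfolding r1_def r2_def using UW
      by (intro holomorphic_intros holomorphic_on_subset[OF A.x_hol] holomorphic_on_subset[OF A.y_hol]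
          holomorphic_on_subset[OF Q_hol]; auto)+
    have eq: "f (A.Phi z) = Affine (r1 z) (r2 z)" if "z \<in> U" for z
      using pq[of "x z" "y z"] UW[OF that] A.Phi_in[of z] by (simp add: A.Phi_def Q_def r1_def r2_def)
    show ?thesis
    proof (cases "\<exists>z1\<in>U. r2 z1 \<noteq> 0")
      case True
      then obtain z1 where "z1 \<in> U" "r2 z1 \<noteq> 0" by blast
      from rational_hom_local_lift[OF fh _ this(1) hol eq this(2)] that show ?thesis by (auto simp: U_def)
    next
      \<comment> \<open>Near z0 all values are now points of order 2, of which there are finitely
        many. So f is constant there, hence trivial near the origin, and \<alpha> = 0 works.\<close>
      case r20: False
      define p where "p = [:coeff_b E', coeff_a E', 0, 1:]"
      have "r1 ` U \<subseteq> {t. poly p t = 0}"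
      proof safe
        fix z assume z: "z \<in> U"
        have "Affine (r1 z) (r2 z) \<in> ec_points E'" using hom_Phi_add(2)[OF fh, of z] eq[OF z] by simp
        thus "poly p (r1 z) = 0" using r20 z by (simp add: ec_points_def p_def algebra_simps eval_nat_numeral)
      qed
      moreover have "finite {t. poly p t = 0}" by (intro poly_roots_finite) (simp add: p_def)
      ultimately have "r1 constant_on U"
        using hol by (intro continuous_finite_range_constant holomorphic_on_imp_continuous_on)
          (auto simp: U_def intro: finite_subset)
      then obtain c where c: "\<And>z. z \<in> U \<Longrightarrow> f (A.Phi z) = Affine c 0"
        using eq r20 by (auto simp: constant_on_def)
      have "f (A.Phi z) = B.Phi (0 * z)" for z
      proof (rule hom_linear_globalize[OF fh r(1)])
        fix h :: complex assume h: "norm h < r"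
        obtain u where u: "B.Phi u = f (A.Phi h)" using B_preimage[OF fh] .
        obtain v where v: "B.Phi v = f (A.Phi z0)" using B_preimage[OF fh] .
        have "B.Phi (v + u) = f (A.Phi (z0 + h))" by (simp add: hom_Phi_add(1)[OF fh] u v B.Phi_add [symmetric])
        also have "\<dots> = B.Phi v" using c[of "z0 + h"] c[of z0] h r(1) v by (simp add: U_def dist_norm)
        finally have "u \<in> lat \<tau>'" by (simp add: B.Phi_eq_iff)
        thus "f (A.Phi h) = B.Phi (0 * h)" using u by (simp add: B.Phi_def)
      qed
      thus ?thesis by (rule that)
    qed
  qed
qed

lemma ec_hom_eq_hmap:
  assumes f: "f \<in> ec_hom E E'"
  obtains \<alpha> where "f = hmap \<alpha>" "\<And>w. w \<in> lat \<tau> \<Longrightarrow> \<alpha> * w \<in> lat \<tau>'"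
proof -
  obtain \<alpha> where \<alpha>: "\<And>z. f (A.Phi z) = B.Phi (\<alpha> * z)" using ec_hom_linear[OF f] by blast
  have lat: "\<alpha> * w \<in> lat \<tau>'" if "w \<in> lat \<tau>" for w
  proof -
    have "A.Phi w = A.Phi 0" using that by (simp add: A.Phi_eq_iff)
    hence "B.Phi (\<alpha> * w) = B.Phi (\<alpha> * 0)" using \<alpha>[of w] \<alpha>[of 0] by metis
    thus ?thesis by (simp add: B.Phi_eq_iff)
  qed
  have "f = hmap \<alpha>"
  proof (rule extensionalityI)
    show "f \<in> extensional (ec_points E)" using f by (auto simp: ec_hom_def)
    show "hmap \<alpha> \<in> extensional (ec_points E)" by (simp add: hmap_def)
    fix P assume "P \<in> ec_points E"
    then obtain z where "A.Phi z = P" by (rule A.Phi_surj)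
    thus "f P = hmap \<alpha> P" using \<alpha>[of z] hmap_Phi[OF lat, of z] by simp
  qed
  thus ?thesis using that lat by blast
qed

lemma hmap_in_ec_hom:
  assumes "\<And>w. w \<in> lat \<tau> \<Longrightarrow> \<alpha> * w \<in> lat \<tau>'"
  shows "hmap \<alpha> \<in> ec_hom E E'"
proof (cases "\<alpha> = 0")
  case True
  have "ec_zero_hom E \<in> ec_hom E E'"
    using hmap_hom[of 0] by (auto simp: ec_hom_def hmap_0) (simp add: ec_zero_hom_def)
  thus ?thesis using True by (simp add: hmap_0)
qed (use assms hmap_ec_hom in blast)

lemma isogenous_iff: "isogenous E E' \<longleftrightarrow> (\<exists>\<alpha>. \<alpha> \<noteq> 0 \<and> (\<forall>w\<in>lat \<tau>. \<alpha> * w \<in> lat \<tau>'))"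
proof
  assume "isogenous E E'"
  then obtain f where f: "f \<in> ec_hom E E'" "f \<noteq> ec_zero_hom E" by (auto simp: isogenous_def isogeny_def)
  then obtain \<alpha> where \<alpha>: "f = hmap \<alpha>" "\<And>w. w \<in> lat \<tau> \<Longrightarrow> \<alpha> * w \<in> lat \<tau>'" using ec_hom_eq_hmap by blast
  hence "\<alpha> \<noteq> 0" using f hmap_0 by auto
  thus "\<exists>\<alpha>. \<alpha> \<noteq> 0 \<and> (\<forall>w\<in>lat \<tau>. \<alpha> * w \<in> lat \<tau>')" using \<alpha> by blast
next
  assume "\<exists>\<alpha>. \<alpha> \<noteq> 0 \<and> (\<forall>w\<in>lat \<tau>. \<alpha> * w \<in> lat \<tau>')"
  then obtain \<alpha> where \<alpha>: "\<alpha> \<noteq> 0" "\<And>w. w \<in> lat \<tau> \<Longrightarrow> \<alpha> * w \<in> lat \<tau>'" by blast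
  have "hmap \<alpha> \<noteq> hmap 0" using hmap_eq_iff[of \<alpha> 0] \<alpha> by simp
  thus "isogenous E E'" using hmap_in_ec_hom[OF \<alpha>(2)] by (auto simp: isogenous_def isogeny_def hmap_0)
qed

end

section \<open>The endomorphism ring\<close>

lemma primitive_quadratic:
  fixes A B C :: int and z :: complex
  assumes A: "A \<noteq> 0" and quad: "of_int A * z\<^sup>2 + of_int B * z + of_int C = 0"
  obtains g A' B' C' where "A' \<noteq> 0" "gcd A' (gcd B' C') = 1"
    "of_int A' * z\<^sup>2 + of_int B' * z + of_int C' = 0" "g \<noteq> 0" "A = g * A'" "B = g * B'" "C = g * C'"
proof -
  define g where "g = gcd A (gcd B C)"
  have "g dvd A" "g dvd gcd B C" unfolding g_def by (rule gcd_dvd1, rule gcd_dvd2)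
  moreover have g0: "g \<noteq> 0" using A by (simp add: g_def)
  ultimately have "g dvd A" "g dvd B" "g dvd C" by (simp_all only: gcd_greatest_iff)
  then obtain A' B' C' where ABC: "A = g * A'" "B = g * B'" "C = g * C'" by (elim dvdE)
  have "g = gcd (g * A') (gcd (g * B') (g * C'))" unfolding ABC[symmetric] by (rule g_def)
  also have "\<dots> = \<bar>g\<bar> * gcd A' (gcd B' C')" by (simp add: gcd_mult_left, simp add: abs_mult)
  also have "\<bar>g\<bar> = g" by (simp add: g_def)
  finally have "g = g * gcd A' (gcd B' C')" .
  from this [symmetric] have "g * gcd A' (gcd B' C') = g * 1" unfolding mult_1_right .
  hence 1: "gcd A' (gcd B' C') = 1" using g0 by (simp only: mult_cancel_left simp_thms)
  have "of_int g * (of_int A' * z\<^sup>2 + of_int B' * z + of_int C') = 0"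
    using quad unfolding ABC by (simp add: algebra_simps)
  hence 2: "of_int A' * z\<^sup>2 + of_int B' * z + of_int C' = 0" using g0 by simp
  have "A' \<noteq> 0" using ABC(1) A by (intro notI) simp
  from that[OF this 1 2 g0 ABC] show ?thesis .
qed

section \<open>The multiplier ring of a lattice\<close>

definition (in half_plane) mults :: "complex set" where
  "mults = {\<alpha>. \<forall>w\<in>\<Lambda>. \<alpha> * w \<in> \<Lambda>}"

context half_plane
begin

lemma mults_iff: "\<alpha> \<in> mults \<longleftrightarrow> \<alpha> \<in> \<Lambda> \<and> \<alpha> * \<tau> \<in> \<Lambda>"
proof
  assume "\<alpha> \<in> mults"
  hence "\<forall>w\<in>\<Lambda>. \<alpha> * w \<in> \<Lambda>" by (simp add: mults_def)
  from bspec[OF this lat_1] bspec[OF this lat_tau]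
  show "\<alpha> \<in> \<Lambda> \<and> \<alpha> * \<tau> \<in> \<Lambda>" by simp
next
  assume *: "\<alpha> \<in> \<Lambda> \<and> \<alpha> * \<tau> \<in> \<Lambda>"
  have "\<alpha> * w \<in> \<Lambda>" if "w \<in> \<Lambda>" for w
  proof -
    from that obtain m n where w: "w = of_int m + of_int n * \<tau>" by (auto simp: lat_iff)
    have "of_int m * \<alpha> + of_int n * (\<alpha> * \<tau>) \<in> \<Lambda>" using * by (intro lat_add lat_of_int_mult) auto
    thus ?thesis by (simp add: w algebra_simps)
  qed
  thus "\<alpha> \<in> mults" by (simp add: mults_def)
qed

lemma multsD: "\<alpha> \<in> mults \<Longrightarrow> w \<in> \<Lambda> \<Longrightarrow> \<alpha> * w \<in> \<Lambda>"
  by (simp add: mults_def)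

lemma mults_closed:
  "1 \<in> mults" "0 \<in> mults"
  "\<alpha> \<in> mults \<Longrightarrow> \<beta> \<in> mults \<Longrightarrow> \<alpha> + \<beta> \<in> mults"
  "\<alpha> \<in> mults \<Longrightarrow> \<beta> \<in> mults \<Longrightarrow> \<alpha> * \<beta> \<in> mults"
  "\<alpha> \<in> mults \<Longrightarrow> of_int n * \<alpha> \<in> mults"
  by (simp_all add: mults_def distrib_right mult.assoc lat_add lat_of_int_mult)

lemma tau_neq_cnj: "\<tau> \<noteq> cnj \<tau>"
  using Im_pos by (auto simp: complex_eq_iff)

text \<open>Write \<alpha> and \<alpha> \<tau> in the basis 1, \<tau> and eliminate \<alpha>. The
  leading coefficient of the resulting equation is nonzero because \<alpha> is not an
  integer.\<close>

lemma mults_nonint_quadratic: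
  assumes "\<alpha> \<in> mults" "\<And>n::int. \<alpha> \<noteq> of_int n"
  obtains A B C :: int where "A \<noteq> 0" "gcd A (gcd B C) = 1"
    "of_int A * \<tau>\<^sup>2 + of_int B * \<tau> + of_int C = 0"
proof -
  from assms(1) have "\<alpha> \<in> \<Lambda>" "\<alpha> * \<tau> \<in> \<Lambda>" by (simp_all add: mults_iff)
  then obtain m n m' n' where a: "\<alpha> = of_int m + of_int n * \<tau>"
    and b: "\<alpha> * \<tau> = of_int m' + of_int n' * \<tau>" unfolding lat_iff by blast
  have n: "n \<noteq> 0"
  proof
    assume "n = 0"
    with a have "\<alpha> = of_int m" by simp
    with assms(2) show False by blast
  qed
  have eq: "of_int n * \<tau>\<^sup>2 + of_int (m - n') * \<tau> + of_int (- m') = 0"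
    using b by (simp add: a algebra_simps power2_eq_square)
  show ?thesis by (rule primitive_quadratic[OF n eq]) (rule that)
qed

context
  fixes A B C :: int
  assumes A: "A \<noteq> 0" and prim: "gcd A (gcd B C) = 1"
    and quad: "of_int A * \<tau>\<^sup>2 + of_int B * \<tau> + of_int C = 0"
begin

lemma quad_square: "of_int A * \<tau>\<^sup>2 = - of_int B * \<tau> - of_int C"
proof -
  have "of_int A * \<tau>\<^sup>2 + (of_int B * \<tau> + of_int C) = 0" using quad by (simp only: add.assoc)
  hence "of_int A * \<tau>\<^sup>2 = - (of_int B * \<tau> + of_int C)" by (rule eq_neg_iff_add_eq_0 [THEN iffD2])
  thus ?thesis by (simp only: minus_add_distrib diff_conv_add_uminus mult_minus_left)
qed

lemma quad_trace_norm: "of_int A * (\<tau> + cnj \<tau>) = - of_int B" "of_int A * (\<tau> * cnj \<tau>) = of_int C"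
proof -
  have "cnj (of_int A * \<tau>\<^sup>2 + of_int B * \<tau> + of_int C) = 0" unfolding quad by simp
  hence q2: "of_int A * (cnj \<tau>)\<^sup>2 + of_int B * cnj \<tau> + of_int C = 0" by simp
  have "(\<tau> - cnj \<tau>) * (of_int A * (\<tau> + cnj \<tau>) + of_int B) =
    (of_int A * \<tau>\<^sup>2 + of_int B * \<tau> + of_int C) - (of_int A * (cnj \<tau>)\<^sup>2 + of_int B * cnj \<tau> + of_int C)"
    by (simp add: algebra_simps power2_eq_square)
  also have "\<dots> = 0" unfolding quad q2 by simp
  finally have "(\<tau> - cnj \<tau>) * (of_int A * (\<tau> + cnj \<tau>) + of_int B) = 0" .
  thus 1: "of_int A * (\<tau> + cnj \<tau>) = - of_int B"
    using tau_neq_cnj by (simp add: eq_neg_iff_add_eq_0)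
  have "of_int A * (\<tau> * cnj \<tau>) = (of_int A * (\<tau> + cnj \<tau>)) * \<tau> - of_int A * \<tau>\<^sup>2"
    by (simp add: algebra_simps power2_eq_square)
  also have "\<dots> = of_int C - (of_int A * \<tau>\<^sup>2 + of_int B * \<tau> + of_int C)" unfolding 1 by simp
  finally show "of_int A * (\<tau> * cnj \<tau>) = of_int C" unfolding quad by simp
qed

text \<open>For \<alpha> = p + r \<tau>, membership of \<alpha> \<tau> in the lattice makes A divide
  r B and r C. As A also divides r A, primitivity yields that A divides r.\<close>

lemma mults_quadratic: "\<alpha> \<in> mults \<longleftrightarrow> (\<exists>m n. \<alpha> = of_int m + of_int n * (of_int A * \<tau>))"
proof
  assume "\<exists>m n. \<alpha> = of_int m + of_int n * (of_int A * \<tau>)"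
  then obtain m n where a: "\<alpha> = of_int m + of_int n * (of_int A * \<tau>)" by auto
  have "\<alpha> = of_int m + of_int (n * A) * \<tau>" by (simp add: a)
  moreover have "\<alpha> * \<tau> = of_int (- n * C) + of_int (m - n * B) * \<tau>"
  proof -
    have "\<alpha> * \<tau> = of_int m * \<tau> + of_int n * (of_int A * \<tau>\<^sup>2)" by (simp add: a algebra_simps power2_eq_square)
    thus ?thesis unfolding quad_square by (simp add: algebra_simps)
  qed
  ultimately show "\<alpha> \<in> mults" unfolding mults_iff lat_iff by blast
next
  assume "\<alpha> \<in> mults"
  then obtain p r k l where pr: "\<alpha> = of_int p + of_int r * \<tau>" and kl: "\<alpha> * \<tau> = of_int k + of_int l * \<tau>"
    by (auto simp: mults_iff lat_iff)
  have "of_int A * (\<alpha> * \<tau>) = of_int A * of_int p * \<tau> + of_int r * (of_int A * \<tau>\<^sup>2)"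
    by (simp add: pr algebra_simps power2_eq_square)
  hence "of_int A * (\<alpha> * \<tau>) = of_int (- r * C) + of_int (A * p - r * B) * \<tau>"
    unfolding quad_square by (simp add: algebra_simps)
  hence "of_real (of_int (- r * C)) + of_real (of_int (A * p - r * B)) * \<tau> =
         of_real (of_int (A * k)) + of_real (of_int (A * l)) * \<tau>"
    by (simp add: kl algebra_simps)
  from lat_coords_unique[OF this] have "- r * C = A * k" "A * p - r * B = A * l"
    by (simp_all only: of_int_eq_iff)
  hence "r * C = A * (- k)" "r * B = A * (p - l)" by (simp_all add: algebra_simps)
  hence "A dvd r * C" "A dvd r * B" "A dvd r * A" by simp_all
  hence "A dvd gcd (r * A) (gcd (r * B) (r * C))" by simp
  also have "\<dots> = \<bar>r\<bar> * gcd A (gcd B C)" by (simp add: gcd_mult_left, simp add: abs_mult)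
  finally have "A dvd r" by (simp add: prim)
  then obtain n where "r = A * n" ..
  thus "\<exists>m n. \<alpha> = of_int m + of_int n * (of_int A * \<tau>)"
    using pr by (intro exI[of _ p] exI[of _ n]) simp
qed

end

end

section \<open>Transfer to the endomorphism ring and its discriminant\<close>

context uniformization
begin

interpretation self: unif_pair \<tau> x L E y \<delta> \<tau> x L E y \<delta>
  by unfold_locales

abbreviation "h \<equiv> self.hmap"
abbreviation "R \<equiv> End_ring E"

lemma h_Phi: "\<alpha> \<in> mults \<Longrightarrow> h \<alpha> (Phi z) = Phi (\<alpha> * z)"
  by (rule self.hmap_Phi) (rule multsD)

lemma h_inj: "\<alpha> \<in> mults \<Longrightarrow> \<beta> \<in> mults \<Longrightarrow> h \<alpha> = h \<beta> \<longleftrightarrow> \<alpha> = \<beta>"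
  by (rule self.hmap_eq_iff) (rule multsD; assumption)+

lemma carrier_End: "carrier R = h ` mults"
proof -
  have "f \<in> h ` mults" if f: "f \<in> ec_hom E E" for f
  proof -
    obtain \<alpha> where "f = h \<alpha>" "\<And>w. w \<in> \<Lambda> \<Longrightarrow> \<alpha> * w \<in> \<Lambda>" using self.ec_hom_eq_hmap[OF f] by blast
    thus ?thesis by (auto simp: mults_def)
  qed
  moreover have "h \<alpha> \<in> ec_hom E E" if "\<alpha> \<in> mults" for \<alpha>
    by (rule self.hmap_in_ec_hom) (rule multsD[OF that])
  ultimately show ?thesis by (auto simp: End_ring_def)
qed

lemma h_eqI:
  assumes "\<alpha> \<in> mults" "f \<in> extensional (ec_points E)" "\<And>z. f (Phi z) = Phi (\<alpha> * z)"
  shows "f = h \<alpha>"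
proof (rule extensionalityI[OF assms(2)])
  show "h \<alpha> \<in> extensional (ec_points E)" by (simp add: self.hmap_def)
  fix P assume "P \<in> ec_points E"
  then obtain z where "Phi z = P" by (rule Phi_surj)
  thus "f P = h \<alpha> P" using assms(3)[of z] h_Phi[OF assms(1), of z] by simp
qed

lemma End_mult: "\<alpha> \<in> mults \<Longrightarrow> \<beta> \<in> mults \<Longrightarrow> h \<alpha> \<otimes>\<^bsub>R\<^esub> h \<beta> = h (\<alpha> * \<beta>)"
  by (rule h_eqI) (auto simp: End_ring_def mults_closed compose_def h_Phi mult.assoc)

lemma End_add: "\<alpha> \<in> mults \<Longrightarrow> \<beta> \<in> mults \<Longrightarrow> h \<alpha> \<oplus>\<^bsub>R\<^esub> h \<beta> = h (\<alpha> + \<beta>)"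
  by (rule h_eqI) (auto simp: End_ring_def mults_closed h_Phi Phi_add distrib_right)

lemma End_one: "\<one>\<^bsub>R\<^esub> = h 1"
  by (rule h_eqI) (auto simp: End_ring_def mults_closed)

lemma End_zero: "\<zero>\<^bsub>R\<^esub> = h 0"
  by (simp add: End_ring_def self.hmap_0)

lemma End_nat_pow: "\<alpha> \<in> mults \<Longrightarrow> h \<alpha> [^]\<^bsub>add_monoid R\<^esub> (n::nat) = h (of_nat n * \<alpha>)"
proof (induction n)
  case 0
  thus ?case by (simp add: nat_pow_def End_zero)
next
  case (Suc n)
  have "of_int (int n) * \<alpha> \<in> mults" using Suc.prems by (rule mults_closed)
  thus ?case using Suc by (simp add: nat_pow_def End_add algebra_simps)
qed

text \<open>For negative n the multiple is defined through \<open>m_inv\<close>, a definite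
  description; injectivity of \<open>h\<close> provides the uniqueness that identifies it with
  \<open>h (- \<beta>)\<close>.\<close>

lemma End_int_mult: "\<alpha> \<in> mults \<Longrightarrow> [n] \<cdot>\<^bsub>R\<^esub> h \<alpha> = h (of_int n * \<alpha>)" for n :: int
proof -
  assume \<alpha>: "\<alpha> \<in> mults"
  have inv: "m_inv (add_monoid R) (h \<beta>) = h (- \<beta>)" if \<beta>: "\<beta> \<in> mults" for \<beta>
  proof -
    have m: "- \<beta> \<in> mults" using mults_closed(5)[OF \<beta>, of "-1"] by simp
    show ?thesis
      unfolding m_inv_def
    proof (rule the_equality)
      show "h (- \<beta>) \<in> carrier (add_monoid R) \<and>
        h \<beta> \<otimes>\<^bsub>add_monoid R\<^esub> h (- \<beta>) = \<one>\<^bsub>add_monoid R\<^esub> \<and>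
        h (- \<beta>) \<otimes>\<^bsub>add_monoid R\<^esub> h \<beta> = \<one>\<^bsub>add_monoid R\<^esub>"
        using m \<beta> by (simp add: carrier_End End_add End_zero)
    next
      fix g assume g: "g \<in> carrier (add_monoid R) \<and>
        h \<beta> \<otimes>\<^bsub>add_monoid R\<^esub> g = \<one>\<^bsub>add_monoid R\<^esub> \<and>
        g \<otimes>\<^bsub>add_monoid R\<^esub> h \<beta> = \<one>\<^bsub>add_monoid R\<^esub>"
      then obtain \<gamma> where \<gamma>: "\<gamma> \<in> mults" "g = h \<gamma>" by (auto simp: carrier_End)
      hence "h (\<beta> + \<gamma>) = h 0" using g \<beta> by (simp add: End_add End_zero)
      hence "\<beta> + \<gamma> = 0" using h_inj \<beta> \<gamma> mults_closed by blast
      thus "g = h (- \<beta>)" using \<gamma> by (simp add: add_eq_0_iff)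
    qed
  qed
  show ?thesis
  proof (cases "n < 0")
    case True
    have "of_int (int (nat (- n))) * \<alpha> \<in> mults" using \<alpha> by (rule mults_closed)
    thus ?thesis using True \<alpha> inv[of "of_nat (nat (- n)) * \<alpha>"] End_nat_pow[OF \<alpha>, of "nat (- n)"]
      by (simp add: add_pow_def int_pow_def nat_pow_def)
  next
    case False
    thus ?thesis using End_nat_pow[OF \<alpha>, of "nat n"]
      by (simp add: add_pow_def int_pow_def nat_pow_def)
  qed
qed

lemma has_CM_nonint:
  assumes "has_CM E"
  obtains \<alpha> where "\<alpha> \<in> mults" "\<And>n::int. \<alpha> \<noteq> of_int n"
proof -
  from assms obtain f where f: "f \<in> carrier R" "\<And>n::int. f \<noteq> [n] \<cdot>\<^bsub>R\<^esub> \<one>\<^bsub>R\<^esub>"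
    by (auto simp: has_CM_def)
  then obtain \<alpha> where \<alpha>: "\<alpha> \<in> mults" "f = h \<alpha>" by (auto simp: carrier_End)
  have "\<alpha> \<noteq> of_int n" for n :: int
    using f(2)[of n] \<alpha> by (auto simp: End_one End_int_mult mults_closed)
  thus ?thesis using that \<alpha> by blast
qed

lemma End_lincomb:
  assumes "u \<in> mults" "v \<in> mults"
  shows "[m] \<cdot>\<^bsub>R\<^esub> h u \<oplus>\<^bsub>R\<^esub> [n] \<cdot>\<^bsub>R\<^esub> h v = h (of_int m * u + of_int n * v)"
  using assms by (simp add: End_int_mult End_add mults_closed)

lemma Z_basis_iff:
  assumes "u \<in> mults" "v \<in> mults"
  shows "Z_basis R (h u) (h v) \<longleftrightarrow>
    (\<forall>\<alpha>\<in>mults. \<exists>!c::int \<times> int. \<alpha> = of_int (fst c) * u + of_int (snd c) * v)"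
proof -
  have eq: "h \<alpha> = [fst c] \<cdot>\<^bsub>R\<^esub> h u \<oplus>\<^bsub>R\<^esub> [snd c] \<cdot>\<^bsub>R\<^esub> h v \<longleftrightarrow>
     \<alpha> = of_int (fst c) * u + of_int (snd c) * v" if "\<alpha> \<in> mults" for \<alpha> and c :: "int \<times> int"
    unfolding End_lincomb[OF assms] by (intro h_inj that mults_closed(3) mults_closed(5) assms)
  have "Z_basis R (h u) (h v) \<longleftrightarrow> (\<forall>\<alpha>\<in>mults. \<exists>!c::int \<times> int.
      h \<alpha> = [fst c] \<cdot>\<^bsub>R\<^esub> h u \<oplus>\<^bsub>R\<^esub> [snd c] \<cdot>\<^bsub>R\<^esub> h v)"
    using imageI[OF assms(1), of h] imageI[OF assms(2), of h]
    by (simp only: Z_basis_def carrier_End ball_simps simp_thms)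
  also have "\<dots> \<longleftrightarrow> (\<forall>\<alpha>\<in>mults. \<exists>!c::int \<times> int. \<alpha> = of_int (fst c) * u + of_int (snd c) * v)"
    by (intro ball_cong refl arg_cong[of _ _ Ex1] ext eq)
  finally show ?thesis .
qed

lemma Z_basis_ex:
  assumes "u \<in> mults" "v \<in> mults" "Z_basis R (h u) (h v)" "\<alpha> \<in> mults"
  obtains m n :: int where "\<alpha> = of_int m * u + of_int n * v"
proof -
  from assms(3,4) have "\<exists>!c::int \<times> int. \<alpha> = of_int (fst c) * u + of_int (snd c) * v"
    unfolding Z_basis_iff[OF assms(1,2)] by (rule bspec)
  then obtain c :: "int \<times> int" where "\<alpha> = of_int (fst c) * u + of_int (snd c) * v" by (rule ex1E)
  thus ?thesis by (rule that)
qed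

lemma Z_coords_eq:
  assumes uv: "u \<in> mults" "v \<in> mults" and basis: "Z_basis R (h u) (h v)"
    and eq: "\<alpha> = of_int m * u + of_int n * v"
  shows "Z_coords R (h u) (h v) (h \<alpha>) = (m, n)"
proof -
  have \<alpha>: "\<alpha> \<in> mults" unfolding eq by (intro mults_closed(3) mults_closed(5) uv)
  have "\<exists>!c::int \<times> int. h \<alpha> = [fst c] \<cdot>\<^bsub>R\<^esub> h u \<oplus>\<^bsub>R\<^esub> [snd c] \<cdot>\<^bsub>R\<^esub> h v"
  proof -
    have "\<forall>x\<in>h ` mults. \<exists>!c::int \<times> int. x = [fst c] \<cdot>\<^bsub>R\<^esub> h u \<oplus>\<^bsub>R\<^esub> [snd c] \<cdot>\<^bsub>R\<^esub> h v"
      using basis unfolding Z_basis_def carrier_End by (elim conjE)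
    from bspec[OF this imageI[OF \<alpha>]] show ?thesis .
  qed
  thus ?thesis unfolding Z_coords_def
    by (rule the1_equality) (simp only: End_lincomb[OF uv] fst_conv snd_conv eq)
qed

text \<open>Expand \<alpha> u, \<alpha> v and their conjugates in the basis. Then (\<alpha> + cnj
  \<alpha>) times the determinant u cnj v - cnj u v equals the matrix trace times the same
  determinant, which can be cancelled.\<close>

lemma order_trace_eq:
  assumes uv: "u \<in> mults" "v \<in> mults" and basis: "Z_basis R (h u) (h v)"
    and W: "u * cnj v - cnj u * v \<noteq> 0" and \<alpha>: "\<alpha> \<in> mults"
  shows "of_int (order_trace R (h u) (h v) (h \<alpha>)) = \<alpha> + cnj \<alpha>"
proof -
  obtain p q where pq: "\<alpha> * u = of_int p * u + of_int q * v"
    using Z_basis_ex[OF uv basis mults_closed(4)[OF \<alpha> uv(1)]] .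
  obtain r s where rs: "\<alpha> * v = of_int r * u + of_int s * v"
    using Z_basis_ex[OF uv basis mults_closed(4)[OF \<alpha> uv(2)]] .
  have tr: "order_trace R (h u) (h v) (h \<alpha>) = p + s"
    using Z_coords_eq[OF uv basis pq] Z_coords_eq[OF uv basis rs]
    by (simp add: order_trace_def End_mult uv \<alpha>)
  have pq': "cnj \<alpha> * cnj u = of_int p * cnj u + of_int q * cnj v"
    using arg_cong[OF pq, of cnj] by simp
  have rs': "cnj \<alpha> * cnj v = of_int r * cnj u + of_int s * cnj v"
    using arg_cong[OF rs, of cnj] by simp
  have "(\<alpha> + cnj \<alpha>) * (u * cnj v - cnj u * v) =
     (\<alpha> * u) * cnj v + u * (cnj \<alpha> * cnj v) - cnj u * (\<alpha> * v) - (cnj \<alpha> * cnj u) * v"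
    by (simp add: algebra_simps)
  also have "\<dots> = of_int (p + s) * (u * cnj v - cnj u * v)"
    unfolding pq rs pq' rs' by (simp add: algebra_simps)
  finally show ?thesis using W by (simp add: tr)
qed

text \<open>The Gram determinant of a basis is the square of \<open>W u v\<close>. Two bases differ
  by an integer matrix of determinant 1 or -1, so this square is the same for all of them, and the
  basis 1, A \<tau> evaluates it by Vieta's formulas.\<close>

lemma order_discr_eq:
  assumes A: "A \<noteq> 0" and prim: "gcd A (gcd B C) = 1"
    and quad: "of_int A * \<tau>\<^sup>2 + of_int B * \<tau> + of_int C = 0"
  shows "order_discr R = B\<^sup>2 - 4 * A * C"
proof -
  note mq = mults_quadratic[OF A prim quad]
  define \<omega> where "\<omega> = of_int A * \<tau>"
  define W where "W = (\<lambda>u v::complex. u * cnj v - cnj u * v)"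
  have W\<omega>: "(W 1 \<omega>)\<^sup>2 = of_int (B\<^sup>2 - 4 * A * C)"
  proof -
    have "(W 1 \<omega>)\<^sup>2 = (of_int A * (\<tau> + cnj \<tau>))\<^sup>2 - 4 * of_int A * (of_int A * (\<tau> * cnj \<tau>))"
      by (simp add: W_def \<omega>_def algebra_simps power2_eq_square)
    thus ?thesis unfolding quad_trace_norm[OF A prim quad] by simp
  qed
  have W\<omega>0: "W 1 \<omega> \<noteq> 0"
    using A tau_neq_cnj by (auto simp: W_def \<omega>_def)
  have \<omega>m: "\<omega> \<in> mults" unfolding mq \<omega>_def by (intro exI[of _ 0] exI[of _ 1]) simp
  have Wlin: "W (of_int a + of_int b * \<omega>) (of_int c + of_int d * \<omega>) = of_int (a * d - b * c) * W 1 \<omega>" for a b c d :: int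
    by (simp add: W_def algebra_simps)
  have Wlin2: "W (of_int a * u + of_int b * v) (of_int c * u + of_int d * v) = of_int (a * d - b * c) * W u v" for a b c d :: int and u v
    by (simp add: W_def algebra_simps)
  define D where "D = (\<lambda>f g. order_trace R f g (f \<otimes>\<^bsub>R\<^esub> f) * order_trace R f g (g \<otimes>\<^bsub>R\<^esub> g)
         - order_trace R f g (f \<otimes>\<^bsub>R\<^esub> g) * order_trace R f g (g \<otimes>\<^bsub>R\<^esub> f))"
  have key: "D (h u) (h v) = B\<^sup>2 - 4 * A * C"
    if uv: "u \<in> mults" "v \<in> mults" and basis: "Z_basis R (h u) (h v)" for u v
  proof -
    obtain a b where u: "u = of_int a + of_int b * \<omega>" using uv mq by (auto simp: \<omega>_def)
    obtain c d where v: "v = of_int c + of_int d * \<omega>" using uv mq by (auto simp: \<omega>_def)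
    obtain p q where 1: "1 = of_int p * u + of_int q * v" using Z_basis_ex[OF uv basis mults_closed(1)] .
    obtain r s where 2: "\<omega> = of_int r * u + of_int s * v" using Z_basis_ex[OF uv basis \<omega>m] .
    have "W 1 \<omega> = W (of_int p * u + of_int q * v) (of_int r * u + of_int s * v)" by (simp only: 1 [symmetric] 2 [symmetric])
    also have "\<dots> = of_int (p * s - q * r) * W u v" by (rule Wlin2)
    also have Wuv: "W u v = of_int (a * d - b * c) * W 1 \<omega>" unfolding u v by (rule Wlin)
    finally have "of_int ((p * s - q * r) * (a * d - b * c)) * W 1 \<omega> = of_int 1 * W 1 \<omega>" by (simp add: mult.assoc)
    hence "of_int ((p * s - q * r) * (a * d - b * c)) = (of_int 1 :: complex)" using W\<omega>0 by simp
    hence "(p * s - q * r) * (a * d - b * c) = 1" by (simp only: of_int_eq_iff)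
    hence "a * d - b * c = 1 \<or> a * d - b * c = -1" by (metis mult.commute zmult_eq_1_iff)
    hence "W u v = W 1 \<omega> \<or> W u v = - W 1 \<omega>" unfolding Wuv by (elim disjE) simp_all
    hence W2: "(W u v)\<^sup>2 = (W 1 \<omega>)\<^sup>2" "W u v \<noteq> 0" using W\<omega>0 by (elim disjE; simp)+
    note tr = order_trace_eq[OF uv basis W2(2)[unfolded W_def]]
    have "(of_int (D (h u) (h v)) :: complex) = (u * u + cnj (u * u)) * (v * v + cnj (v * v)) - (u * v + cnj (u * v)) * (v * u + cnj (v * u))"
      unfolding D_def End_mult[OF uv(1,1)] End_mult[OF uv(2,2)] End_mult[OF uv] End_mult[OF uv(2,1)] of_int_diff of_int_mult
        tr[OF mults_closed(4)[OF uv(1,1)]] tr[OF mults_closed(4)[OF uv(2,2)]] tr[OF mults_closed(4)[OF uv]] tr[OF mults_closed(4)[OF uv(2,1)]] ..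
    also have "\<dots> = (W u v)\<^sup>2" by (simp add: W_def algebra_simps power2_eq_square)
    also have "\<dots> = of_int (B\<^sup>2 - 4 * A * C)" unfolding W2 W\<omega> ..
    finally show ?thesis by (simp only: of_int_eq_iff)
  qed
  have basis: "Z_basis R (h 1) (h \<omega>)"
    unfolding Z_basis_iff[OF mults_closed(1) \<omega>m]
  proof safe
    fix \<alpha> assume "\<alpha> \<in> mults"
    then obtain m n where "\<alpha> = of_int m * 1 + of_int n * \<omega>" using mq by (auto simp: \<omega>_def)
    thus "\<exists>c. \<alpha> = of_int (fst c) * 1 + of_int (snd c) * \<omega>" by (intro exI[of _ "(m, n)"]) simp
  next
    fix m n m' n' :: int
    assume "of_int (fst (m, n)) * 1 + of_int (snd (m, n)) * \<omega> = of_int (fst (m', n')) * 1 + of_int (snd (m', n')) * \<omega>"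
    hence "of_real (of_int m) + of_real (of_int (n * A)) * \<tau> = of_real (of_int m') + of_real (of_int (n' * A)) * \<tau>"
      by (simp add: \<omega>_def mult.assoc)
    from lat_coords_unique[OF this] have "m = m' \<and> n * A = n' * A" by (simp only: of_int_eq_iff)
    thus "m = m'" "n = n'" using A by auto
  qed
  have "order_discr R = (THE d. \<exists>u v. Z_basis R u v \<and> d = D u v)"
    by (simp add: order_discr_def D_def)
  also have "\<dots> = B\<^sup>2 - 4 * A * C"
  proof (rule the_equality)
    show "\<exists>u v. Z_basis R u v \<and> B\<^sup>2 - 4 * A * C = D u v"
      using basis key[OF mults_closed(1) \<omega>m basis] by (intro exI[of _ "h 1"] exI[of _ "h \<omega>"]) simp
  next
    fix d assume "\<exists>u v. Z_basis R u v \<and> d = D u v"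
    then obtain f g where fg: "Z_basis R f g" "d = D f g" by blast
    then obtain u v where "f = h u" "g = h v" "u \<in> mults" "v \<in> mults"
      by (auto simp: Z_basis_def carrier_End)
    thus "d = B\<^sup>2 - 4 * A * C" using fg key by simp
  qed
  finally show ?thesis .
qed

lemma odd_curve_iff:
  assumes "A \<noteq> 0" "gcd A (gcd B C) = 1" "of_int A * \<tau>\<^sup>2 + of_int B * \<tau> + of_int C = 0"
  shows "odd_curve E \<longleftrightarrow> odd B"
  unfolding odd_curve_def order_discr_eq[OF assms] by simp

end

section \<open>Existence of uniformizations\<close>

text \<open>Equal j means a^3 b0^2 = a0^3 b^2. The case j = 0 takes a sixth root, the case j = 1728
  a fourth root; otherwise dividing the two scaling equations forces \<mu>^2 = b a0 / (a
  b0).\<close>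

lemma twist_exists:
  fixes a b a0 b0 :: complex
  assumes D: "4 * a ^ 3 + 27 * b ^ 2 \<noteq> 0" and D0: "4 * a0 ^ 3 + 27 * b0 ^ 2 \<noteq> 0"
    and j: "4 * a ^ 3 / (4 * a ^ 3 + 27 * b ^ 2) = 4 * a0 ^ 3 / (4 * a0 ^ 3 + 27 * b0 ^ 2)"
  obtains \<mu> where "\<mu> \<noteq> 0" "a = \<mu> ^ 4 * a0" "b = \<mu> ^ 6 * b0"
proof -
  have "4 * a ^ 3 * (4 * a0 ^ 3 + 27 * b0 ^ 2) = 4 * a0 ^ 3 * (4 * a ^ 3 + 27 * b ^ 2)"
    using j D D0 by (simp add: frac_eq_eq)
  hence eq: "a ^ 3 * b0 ^ 2 = a0 ^ 3 * b ^ 2" by (simp add: algebra_simps)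
  consider "a0 = 0" | "a0 \<noteq> 0" "b0 = 0" | "a0 \<noteq> 0" "b0 \<noteq> 0" by blast
  thus ?thesis
  proof cases
    case 1
    have b0: "b0 \<noteq> 0" using D0 1 by auto
    have a: "a = 0" using eq 1 b0 by simp
    have b: "b \<noteq> 0" using D a by auto
    obtain \<mu> where "b / b0 = \<mu> ^ 6" by (rule exists_complex_root[of 6 "b / b0"]) simp_all
    note \<mu> = this [symmetric]
    show ?thesis
    proof (rule that)
      show "\<mu> \<noteq> 0" using \<mu> b b0 by (intro notI) simp
      show "b = \<mu> ^ 6 * b0" unfolding \<mu> using b0 by simp
    qed (simp add: a 1)
  next
    case 2
    have b: "b = 0" using eq 2 by simp
    have a: "a \<noteq> 0" using D b by auto
    obtain \<mu> where "a / a0 = \<mu> ^ 4" by (rule exists_complex_root[of 4 "a / a0"]) simp_all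
    note \<mu> = this [symmetric]
    show ?thesis
    proof (rule that)
      show "\<mu> \<noteq> 0" using \<mu> a 2 by (intro notI) simp
      show "a = \<mu> ^ 4 * a0" unfolding \<mu> using 2 by simp
    qed (simp add: b 2)
  next
    case 3
    have ab: "a \<noteq> 0" "b \<noteq> 0"
    proof -
      show "a \<noteq> 0"
      proof
        assume "a = 0"
        hence "b = 0" using eq 3 by simp
        thus False using D \<open>a = 0\<close> by simp
      qed
      show "b \<noteq> 0"
      proof
        assume "b = 0"
        hence "a = 0" using eq 3 by simp
        thus False using D \<open>b = 0\<close> by simp
      qed
    qed
    define \<mu> where "\<mu> = csqrt (b * a0 / (a * b0))"
    have \<mu>2: "\<mu>\<^sup>2 = b * a0 / (a * b0)" by (simp add: \<mu>_def)
    have \<mu>0: "\<mu> \<noteq> 0" using ab 3 by (simp add: \<mu>_def)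
    have "\<mu> ^ 4 * a0 = (\<mu>\<^sup>2)\<^sup>2 * a0" by (simp flip: power_mult)
    also have "\<dots> = (a0 ^ 3 * b ^ 2) / (a ^ 2 * b0 ^ 2)"
      unfolding \<mu>2 by (simp add: power_divide power_mult_distrib power2_eq_square power3_eq_cube mult_ac)
    also have "\<dots> = a" unfolding eq [symmetric] using ab 3 by (simp add: power2_eq_square power3_eq_cube)
    finally have 1: "\<mu> ^ 4 * a0 = a" .
    have "\<mu> ^ 6 * b0 = \<mu> ^ 4 * a0 * \<mu>\<^sup>2 * b0 / a0" using 3 by (simp flip: power_add)
    also have "\<dots> = b" unfolding 1 \<mu>2 using ab 3 by simp
    finally have 2: "\<mu> ^ 6 * b0 = b" .
    show ?thesis by (rule that[OF \<mu>0 1 [symmetric] 2 [symmetric]])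
  qed
qed

definition Mfun :: "complex \<Rightarrow> complex" where
  "Mfun s = kap s + 1 / kap s"

definition jm :: "complex \<Rightarrow> complex" where
  "jm m = 256 * (m\<^sup>2 - 3) ^ 3 / (m\<^sup>2 - 4)"

text \<open>The short Weierstrass form of \<open>Y\<^sup>2 = X\<^sup>3 - m X\<^sup>2 + X\<close>, by the substitution \<open>X = x + m / 3\<close>.\<close>

definition mcurve :: "complex \<Rightarrow> weierstrass" where
  "mcurve m = Weierstrass (1 - m\<^sup>2 / 3) (m / 3 - 2 * m ^ 3 / 27)"

lemma mcurve_disc: "4 * coeff_a (mcurve m) ^ 3 + 27 * coeff_b (mcurve m) ^ 2 = 4 - m\<^sup>2"
  by (simp add: mcurve_def field_simps eval_nat_numeral)

lemma j_inv_mcurve: "m\<^sup>2 \<noteq> 4 \<Longrightarrow> j_inv (mcurve m) = jm m"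
proof -
  assume m: "m\<^sup>2 \<noteq> 4"
  have "1728 * (4 * coeff_a (mcurve m) ^ 3) = 6912 * (- ((m\<^sup>2 - 3) / 3)) ^ 3"
    by (simp add: mcurve_def diff_divide_distrib)
  also have "\<dots> = - (256 * (m\<^sup>2 - 3) ^ 3)" by (simp add: power_divide)
  finally have "j_inv (mcurve m) = - (256 * (m\<^sup>2 - 3) ^ 3) / - (m\<^sup>2 - 4)"
    unfolding j_inv_def mcurve_disc by (simp only: minus_diff_eq)
  thus ?thesis unfolding jm_def minus_divide_divide .
qed

lemma elliptic_mcurve: "m\<^sup>2 \<noteq> 4 \<Longrightarrow> elliptic_curve (mcurve m)"
  unfolding elliptic_curve_def mcurve_disc by simp

definition uniformized :: "weierstrass \<Rightarrow> complex \<Rightarrow> bool" where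
  "uniformized E \<tau> \<longleftrightarrow> (\<exists>x L y \<delta>. uniformization \<tau> x L E y \<delta>)"

text \<open>The differential equation, multiplied by the square of \<open>qD\<close>, says that this
  square and \<open>qc * qD z * deriv qD z\<close> solve Y^2 = X^3 - m X^2 + X. The shift by m / 3
  leads to the short form, the twist \<mu> to the given equation, and \<delta> compares x' with
  y.\<close>

lemma (in half_plane) uniformized_exists:
  assumes ell: "elliptic_curve E" and m4: "(Mfun (cexp (\<tau> / 2)))\<^sup>2 \<noteq> 4"
    and j: "j_inv E = jm (Mfun (cexp (\<tau> / 2)))"
  shows "uniformized E \<tau>"
proof -
  define m where "m = Mfun (cexp (\<tau> / 2))"
  have mk: "m = kappa + 1 / kappa" by (simp add: m_def Mfun_def kappa_eq)
  have k1: "kappa\<^sup>2 \<noteq> 1"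
  proof
    assume "kappa\<^sup>2 = 1"
    hence "kappa = 1 \<or> kappa = -1" by (simp add: power2_eq_1_iff)
    hence "m\<^sup>2 = 4" unfolding mk by (elim disjE) simp_all
    thus False using m4 by (simp add: m_def)
  qed
  define a0 b0 where "a0 = coeff_a (mcurve m)" and "b0 = coeff_b (mcurve m)"
  have m4': "m\<^sup>2 \<noteq> 4" using m4 by (simp add: m_def)
  have D: "4 * coeff_a E ^ 3 + 27 * coeff_b E ^ 2 \<noteq> 0" using ell by (simp add: elliptic_curve_def)
  have D0: "4 * a0 ^ 3 + 27 * b0 ^ 2 \<noteq> 0" using elliptic_mcurve[OF m4'] by (simp add: elliptic_curve_def a0_def b0_def)
  have "j_inv E = j_inv (mcurve m)" using j j_inv_mcurve[OF m4'] by (simp add: m_def)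
  hence "4 * coeff_a E ^ 3 / (4 * coeff_a E ^ 3 + 27 * coeff_b E ^ 2) = 4 * a0 ^ 3 / (4 * a0 ^ 3 + 27 * b0 ^ 2)"
    unfolding j_inv_def a0_def b0_def times_divide_eq_right [symmetric] by (simp only: mult_cancel_left) simp
  then obtain \<mu> where \<mu>: "\<mu> \<noteq> 0" "coeff_a E = \<mu> ^ 4 * a0" "coeff_b E = \<mu> ^ 6 * b0"
    using twist_exists[OF D D0] by blast
  define x where "x = (\<lambda>z. \<mu>\<^sup>2 * ((qD z)\<^sup>2 - m / 3))"
  define y where "y = (\<lambda>z. \<mu> ^ 3 * (qc * qD z * deriv qD z))"
  define \<delta> where "\<delta> = 2 / (qc * \<mu>)"
  have "uniformization \<tau> x (\<mu>\<^sup>2 * qc\<^sup>2) E y \<delta>"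
  proof unfold_locales
    show "x holomorphic_on - \<Lambda>" unfolding x_def by (intro holomorphic_intros qD_holomorphic)
    show "x (z + 1) = x z" "x (z + \<tau>) = x z" "x (- z) = x z" for z
      by (simp_all add: x_def qD_1 qD_tau qD_minus)
    have "((\<lambda>z. \<mu>\<^sup>2 * ((z * qD z)\<^sup>2 - z\<^sup>2 * (m / 3))) \<longlongrightarrow> \<mu>\<^sup>2 * (qc\<^sup>2 - 0\<^sup>2 * (m / 3))) (at 0)"
      by (intro tendsto_intros qD_pole)
    thus "((\<lambda>z. z\<^sup>2 * x z) \<longlongrightarrow> \<mu>\<^sup>2 * qc\<^sup>2) (at 0)"
      by (simp add: x_def algebra_simps power_mult_distrib)
    show "\<mu>\<^sup>2 * qc\<^sup>2 \<noteq> 0" "\<delta> \<noteq> 0" using \<mu>(1) qc_nz by (simp_all add: \<delta>_def)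
    show "elliptic_curve E" by (rule ell)
    show "(x has_field_derivative \<delta> * y z) (at z)" if z: "z \<notin> \<Lambda>" for z
    proof -
      have "(x has_field_derivative \<mu>\<^sup>2 * (2 * qD z * deriv qD z)) (at z)"
        unfolding x_def by (rule derivative_eq_intros DERIV_qD[OF z] refl | simp)+
      also have "\<mu>\<^sup>2 * (2 * qD z * deriv qD z) = \<delta> * y z"
        using \<mu>(1) qc_nz by (simp add: \<delta>_def y_def power2_eq_square power3_eq_cube)
      finally show ?thesis .
    qed
    show "y z ^ 2 = x z ^ 3 + coeff_a E * x z + coeff_b E" if z: "z \<notin> \<Lambda>" for z
    proof -
      define X where "X = (qD z)\<^sup>2"
      have "(qc * qD z * deriv qD z)\<^sup>2 = X * (qc\<^sup>2 * (deriv qD z)\<^sup>2)"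
        by (simp add: X_def power_mult_distrib)
      also have "qc\<^sup>2 * (deriv qD z)\<^sup>2 = X\<^sup>2 - m * X + 1"
        using qD_ode[OF k1 z] by (simp add: X_def mk flip: power_mult)
      finally have Y: "(qc * qD z * deriv qD z)\<^sup>2 = X * (X\<^sup>2 - m * X + 1)" .
      have "y z ^ 2 = \<mu> ^ 6 * (X * (X\<^sup>2 - m * X + 1))"
        by (simp only: y_def power_mult_distrib[of "\<mu> ^ 3"] Y flip: power_mult) simp
      also have "X * (X\<^sup>2 - m * X + 1) = (X - m / 3) ^ 3 + a0 * (X - m / 3) + b0"
        by (simp add: a0_def b0_def mcurve_def field_simps eval_nat_numeral)
      also have "\<mu> ^ 6 * ((X - m / 3) ^ 3 + a0 * (X - m / 3) + b0) = x z ^ 3 + coeff_a E * x z + coeff_b E"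
      proof -
        have p: "\<mu> ^ 4 = (\<mu>\<^sup>2)\<^sup>2" "\<mu> ^ 6 = (\<mu>\<^sup>2) ^ 3" by (simp_all flip: power_mult)
        define P N where "P = X - m / 3" and "N = \<mu>\<^sup>2"
        have xz: "x z = N * P" by (simp add: x_def X_def P_def N_def)
        show ?thesis
          unfolding xz \<mu>(2,3) p P_def [symmetric] N_def [symmetric]
          by (simp add: algebra_simps power2_eq_square power3_eq_cube)
      qed
      finally show ?thesis .
    qed
  qed
  thus ?thesis unfolding uniformized_def by blast
qed

lemma cnj_qprod: "norm q < 1 \<Longrightarrow> cnj (qprod q u) = qprod (cnj q) (cnj u)"
proof -
  assume q: "norm q < 1"
  have "(\<lambda>N. cnj (\<Prod>n<N. 1 - q ^ n * u)) \<longlonglongrightarrow> cnj (qprod q u)"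
    by (intro tendsto_intros qprod_LIMSEQ q)
  moreover have "(\<lambda>N. \<Prod>n<N. 1 - cnj q ^ n * cnj u) \<longlonglongrightarrow> qprod (cnj q) (cnj u)"
    by (intro qprod_LIMSEQ) (simp add: q)
  ultimately show ?thesis using LIMSEQ_unique by (simp add: cnj_prod)
qed

text \<open>A square root of theta_3 / theta_4 at 0. Since negating s inverts it, complex
  conjugation acts as inversion for imaginary s.\<close>

definition krat :: "complex \<Rightarrow> complex" where
  "krat s = qprod (s\<^sup>2) (- s) / qprod (s\<^sup>2) s"

lemma kap_krat: "kap s = krat s ^ 4"
  by (simp add: kap_def krat_def)

lemma norm_sq_less_1: "norm (s :: complex) < 1 \<Longrightarrow> norm (s\<^sup>2) < 1"
  by (simp add: norm_power power_less_one_iff)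

lemma qprod_sq_nz:
  assumes "norm s < 1"
  shows "qprod (s\<^sup>2) s \<noteq> 0" "qprod (s\<^sup>2) (- s) \<noteq> 0"
proof -
  have "(s\<^sup>2) ^ n * u \<noteq> 1" if "norm u = norm s" for n u
  proof
    assume "(s\<^sup>2) ^ n * u = 1"
    hence "norm ((s\<^sup>2) ^ n * u) = 1" by simp
    moreover have "norm ((s\<^sup>2) ^ n * u) = norm s ^ (2 * n) * norm s"
      by (simp add: norm_mult norm_power that power_mult)
    ultimately have "norm s ^ Suc (2 * n) = 1" by (simp add: mult.commute)
    moreover have "norm s ^ Suc (2 * n) < 1" using assms by (subst power_less_one_iff) auto
    ultimately show False by simp
  qed
  note ne = this
  have "qprod (s\<^sup>2) u \<noteq> 0" if "norm u = norm s" for u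
    unfolding qprod_eq_0_iff[OF norm_sq_less_1[OF assms]] using ne[OF that] by blast
  thus "qprod (s\<^sup>2) s \<noteq> 0" "qprod (s\<^sup>2) (- s) \<noteq> 0" by simp_all
qed

lemma krat_nz: "norm s < 1 \<Longrightarrow> krat s \<noteq> 0"
  using qprod_sq_nz by (simp add: krat_def)

lemma continuous_on_krat:
  assumes "continuous_on A f" "\<And>x. x \<in> A \<Longrightarrow> norm (f x) < 1"
  shows "continuous_on A (\<lambda>x. krat (f x))"
  unfolding krat_def
  by (intro continuous_on_divide continuous_on_qprod continuous_intros assms)
     (use assms qprod_sq_nz norm_sq_less_1 in auto)

lemma continuous_on_Mfun:
  assumes "continuous_on A f" "\<And>x. x \<in> A \<Longrightarrow> norm (f x) < 1"
  shows "continuous_on A (\<lambda>x. Mfun (f x))"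
  unfolding Mfun_def kap_krat
  by (intro continuous_intros continuous_on_krat assms) (use assms krat_nz in auto)

lemma cnj_krat: "norm s < 1 \<Longrightarrow> cnj (krat s) = krat (cnj s)"
  by (simp add: krat_def cnj_qprod norm_sq_less_1)

lemma krat_minus: "krat (- s) = 1 / krat s"
  by (simp add: krat_def)

lemma krat_0: "krat 0 = 1"
  using qprod_sq_nz[of 0] by (simp add: krat_def)

section \<open>Real j-invariants\<close>

lemma norm_qprod_minus_ge:
  fixes q v :: real
  assumes "0 \<le> q" "q < 1" "0 \<le> v" "v < 1"
  shows "norm (qprod (of_real q) (of_real v)) \<le> norm (qprod (of_real q) (- of_real v))"
proof (rule LIMSEQ_le)
  have q: "norm (of_real q :: complex) < 1" using assms by simp
  show "(\<lambda>N. norm (\<Prod>n<N. 1 - (of_real q :: complex) ^ n * of_real v)) \<longlonglongrightarrow> norm (qprod (of_real q) (of_real v))"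
    "(\<lambda>N. norm (\<Prod>n<N. 1 - (of_real q :: complex) ^ n * (- of_real v))) \<longlonglongrightarrow> norm (qprod (of_real q) (- of_real v))"
    by (intro tendsto_norm qprod_LIMSEQ q)+
  have "norm (1 - (of_real q :: complex) ^ n * of_real v) \<le> norm (1 - (of_real q :: complex) ^ n * (- of_real v))" for n
  proof -
    have "1 - (of_real q :: complex) ^ n * of_real v = of_real (1 - q ^ n * v)" by simp
    hence "norm (1 - (of_real q :: complex) ^ n * of_real v) = \<bar>1 - q ^ n * v\<bar>" by (simp only: norm_of_real)
    also have "\<dots> \<le> \<bar>1 + q ^ n * v\<bar>" using assms by (simp add: abs_le_iff)
    also have "\<bar>1 + q ^ n * v\<bar> = norm (of_real (1 + q ^ n * v) :: complex)" by (simp only: norm_of_real)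
    also have "of_real (1 + q ^ n * v) = 1 - (of_real q :: complex) ^ n * (- of_real v)" by simp
    finally show ?thesis .
  qed
  hence "norm (\<Prod>n<N. 1 - (of_real q :: complex) ^ n * of_real v) \<le> norm (\<Prod>n<N. 1 - (of_real q :: complex) ^ n * (- of_real v))" for N
    unfolding prod_norm [symmetric] by (intro prod_mono conjI norm_ge_zero)
  thus "\<exists>N. \<forall>n\<ge>N. norm (\<Prod>i<n. 1 - (of_real q :: complex) ^ i * of_real v) \<le> norm (\<Prod>i<n. 1 - (of_real q :: complex) ^ i * (- of_real v))"
    by blast
qed

text \<open>In each factor the numerator dominates for real s, so keeping only the first factor
  gives a lower bound that is unbounded as s tends to 1.\<close>

lemma norm_krat_ge:
  assumes "0 \<le> s" "s < 1"
  shows "(1 + s) / (1 - s) \<le> norm (krat (of_real s))"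
proof -
  define q where "q = s\<^sup>2"
  have q: "0 \<le> q" "q < 1" using assms by (simp_all add: q_def power_less_one_iff)
  have nq: "norm (of_real q :: complex) < 1" using q by simp
  have qs: "0 \<le> q * s" "q * s < 1" using q assms
    by (simp_all add: mult_nonneg_nonneg) (metis assms(1) mult_le_one mult_less_cancel_right2 order_less_le_trans less_eq_real_def mult_zero_right zero_less_one)
  define P M where "P = qprod (of_real q) (- of_real (q * s))" and "M = qprod (of_real q) (of_real (q * s))"
  have "norm (of_real s :: complex) < 1" using assms by simp
  hence "qprod ((of_real s)\<^sup>2) (of_real s) \<noteq> 0" by (rule qprod_sq_nz)
  hence nz: "qprod (of_real q) (of_real s) \<noteq> 0" by (simp add: q_def)
  have 1: "qprod (of_real q) (of_real s) = (1 - of_real s) * M"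
    using qprod_rec[OF nq, of "of_real s"] by (simp add: M_def)
  have 2: "qprod (of_real q) (- of_real s) = (1 + of_real s) * P"
    using qprod_rec[OF nq, of "- of_real s"] by (simp add: P_def)
  have M: "M \<noteq> 0" using nz 1 by auto
  have MP: "norm M \<le> norm P" unfolding M_def P_def by (rule norm_qprod_minus_ge[OF q qs])
  have n1: "norm (1 + of_real s :: complex) = 1 + s" "norm (1 - of_real s :: complex) = 1 - s"
    using assms norm_of_real[of "1 + s", where 'a = complex] norm_of_real[of "1 - s", where 'a = complex]
    by simp_all
  have "krat (of_real s) = (1 + of_real s) * P / ((1 - of_real s) * M)"
    unfolding krat_def 1 [symmetric] 2 [symmetric] by (simp add: q_def)
  hence "norm (krat (of_real s)) = (1 + s) / (1 - s) * (norm P / norm M)"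
    by (simp add: norm_divide norm_mult n1)
  moreover have "1 \<le> norm P / norm M" using MP M by simp
  moreover have "0 \<le> (1 + s) / (1 - s)" using assms by simp
  ultimately show ?thesis by (metis mult.right_neutral mult_left_mono)
qed

lemma kap_of_real:
  assumes "\<bar>s\<bar> < 1"
  shows "kap (of_real s) = of_real (norm (krat (of_real s)) ^ 4)"
proof -
  have "norm (of_real s :: complex) < 1" using assms by simp
  from cnj_krat[OF this] have "cnj (krat (of_real s)) = krat (of_real s)" by simp
  hence "krat (of_real s) \<in> \<real>" by (simp add: complex_is_Real_iff complex_eq_iff)
  then obtain x where x: "krat (of_real s) = of_real x" by (auto elim: Reals_cases)
  show ?thesis unfolding kap_krat x by simp
qed

lemma Mfun_real_surj:
  fixes m :: real
  assumes "m > 2"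
  obtains s where "0 < s" "s < 1" "Mfun (of_real s) = of_real m"
proof -
  define k where "k = (m + sqrt (m\<^sup>2 - 4)) / 2"
  have m4: "m\<^sup>2 - 4 > 0" using power_strict_mono[of 2 m 2] assms by simp
  have k2: "2 * k = m + sqrt (m\<^sup>2 - 4)" by (simp add: k_def)
  hence k1: "k > 1" using assms real_sqrt_gt_zero[OF m4] by linarith
  have "2 * k - m = sqrt (m\<^sup>2 - 4)" using k2 by simp
  hence "(2 * k - m)\<^sup>2 = m\<^sup>2 - 4" using m4 by simp
  hence kk: "k * k - m * k + 1 = 0" by (simp add: power2_eq_square algebra_simps)
  have km: "k + 1 / k = m"
  proof -
    have "k + 1 / k = (k * k + 1) / k" using k1 by (simp add: field_simps)
    also have "k * k + 1 = m * k" using kk by simp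
    finally show ?thesis using k1 by simp
  qed
  define f where "f = (\<lambda>s. norm (krat (of_real s)) ^ 4)"
  \<comment> \<open>Chosen with 1 / (1 - S) = k, so that the lower bound on \<open>krat\<close>
    reaches k at S, whereas f 0 = 1 lies below k.\<close>
  define S where "S = 1 - 1 / k"
  have S: "0 \<le> S" "S < 1" using k1 by (simp_all add: S_def)
  have "k \<le> f S"
  proof -
    have "k = 1 / (1 - S)" by (simp add: S_def)
    also have "\<dots> \<le> (1 + S) / (1 - S)" using S by (intro divide_right_mono) auto
    also have "\<dots> \<le> norm (krat (of_real S))" by (rule norm_krat_ge[OF S])
    finally have *: "k \<le> norm (krat (of_real S))" .
    also have "norm (krat (of_real S)) \<le> norm (krat (of_real S)) ^ 4"
      using * k1 by (intro self_le_power) auto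
    finally show ?thesis by (simp add: f_def)
  qed
  moreover have "f 0 \<le> k" using k1 by (simp add: f_def krat_0)
  moreover have "continuous_on {0..S} f"
    unfolding f_def using S by (intro continuous_intros continuous_on_krat) auto
  ultimately obtain s where s: "0 \<le> s" "s \<le> S" "f s = k" using IVT'[of f 0 k S] S by auto
  have "s \<noteq> 0" using s(3) k1 by (auto simp: f_def krat_0)
  moreover have "s < 1" using s S by simp
  moreover have "Mfun (of_real s) = of_real m"
    using s S kap_of_real[of s] unfolding Mfun_def km [symmetric] f_def by simp
  ultimately show ?thesis using that[of s] s by simp
qed

text \<open>On the imaginary axis conjugation is negation, which inverts \<open>krat\<close>. So
  \<open>kap\<close> has modulus 1, and adding its inverse gives twice its real part.\<close>

lemma kap_imaginary:
  assumes "\<bar>r\<bar> < 1"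
  shows "Mfun (\<i> * of_real r) = of_real (2 * Re (kap (\<i> * of_real r)))"
proof -
  have n: "norm (\<i> * of_real r) < 1" using assms by (simp add: norm_mult)
  have "cnj (kap (\<i> * of_real r)) = krat (- (\<i> * of_real r)) ^ 4"
    using cnj_krat[OF n] by (simp add: kap_krat)
  also have "\<dots> = 1 / kap (\<i> * of_real r)" by (simp add: krat_minus kap_krat power_divide)
  finally have "Mfun (\<i> * of_real r) = kap (\<i> * of_real r) + cnj (kap (\<i> * of_real r))"
    by (simp add: Mfun_def)
  thus ?thesis by (simp add: complex_add_cnj)
qed

lemma cis_twice_arctan: "(1 + \<i> * of_real y) / (1 - \<i> * of_real y) = cis (2 * arctan y)"
proof -
  define d where "d = sqrt (1 + y\<^sup>2)"
  have d: "d > 0" by (simp add: d_def add_pos_nonneg)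
  have c: "cis (arctan y) = (1 + \<i> * of_real y) / of_real d" "cis (- arctan y) = (1 - \<i> * of_real y) / of_real d"
    using d by (simp_all add: complex_eq_iff cos_arctan sin_arctan flip: d_def)
  have "cis (2 * arctan y) = cis (arctan y) / cis (- arctan y)" by (simp add: cis_divide)
  also have "\<dots> = (1 + \<i> * of_real y) / (1 - \<i> * of_real y)" unfolding c using d by simp
  finally show ?thesis ..
qed

lemma arctan_third_bounds: "3 / 10 \<le> arctan (1 / 3)" "arctan (1 / 3) \<le> 1 / 3"
proof -
  show "arctan (1 / 3) \<le> 1 / 3" by (rule arctan_le_self) simp
  \<comment> \<open>On this interval the derivative of arctan is at least 9 / 10, and 3 / 10 = 1 / 3
    * 9 / 10.\<close>
  obtain z :: real where z: "0 < z" "z < 1 / 3" "arctan (1 / 3) - arctan 0 = (1 / 3 - 0) * inverse (1 + z\<^sup>2)"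
    using MVT2[of 0 "1/3" arctan "\<lambda>x. inverse (1 + x\<^sup>2)"] DERIV_arctan by auto
  have "z\<^sup>2 \<le> (1 / 3)\<^sup>2" using z by (intro power_mono) auto
  hence "inverse (10 / 9 :: real) \<le> inverse (1 + z\<^sup>2)" by (intro le_imp_inverse_le) (auto simp: power2_eq_square add_pos_nonneg)
  thus "3 / 10 \<le> arctan (1 / 3)" using z by simp
qed

text \<open>With \<open>s = \<i> / 3\<close>, every factor of \<open>krat s\<close> has modulus 1, and the argument of \<open>krat s ^ 4\<close> is
  \<open>8 (arctan (1 / 3) - arctan (1 / 27) + \<dots>)\<close>, which lies between \<open>\<pi> / 2\<close> and \<open>\<pi>\<close>.\<close>

lemma Re_kap_third: "Re (kap (\<i> * of_real (1 / 3))) \<le> 0"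
proof -
  define s :: complex where "s = \<i> * of_real (1 / 3)"
  define y :: "nat \<Rightarrow> real" where "y = (\<lambda>n. (- (1 / 9)) ^ n / 3)"
  define \<phi> where "\<phi> = (\<lambda>N. \<Sum>n<N. arctan (y n))"
  have s2: "s\<^sup>2 = of_real (- (1 / 9))" by (simp add: s_def power_divide)
  have n: "norm s < 1" by (simp add: s_def)
  have term_eq: "(s\<^sup>2) ^ n * s = \<i> * of_real (y n)" for n
  proof -
    have "(s\<^sup>2) ^ n * s = of_real ((- (1 / 9)) ^ n) * s" by (simp only: s2 of_real_power)
    thus ?thesis by (simp add: s_def y_def)
  qed
  define R where "R = (\<lambda>N. (\<Prod>n<N. 1 - (s\<^sup>2) ^ n * (- s)) / (\<Prod>n<N. 1 - (s\<^sup>2) ^ n * s))"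
  have R: "R \<longlonglongrightarrow> krat s"
    unfolding R_def krat_def by (intro tendsto_divide qprod_LIMSEQ norm_sq_less_1 n qprod_sq_nz)
  have Rcis: "R N = cis (2 * \<phi> N)" for N
  proof -
    have "R N = (\<Prod>n<N. (1 + \<i> * of_real (y n)) / (1 - \<i> * of_real (y n)))"
      by (simp only: R_def prod_dividef mult_minus_right diff_minus_eq_add term_eq)
    also have "\<dots> = (\<Prod>n<N. cis (2 * arctan (y n)))" by (simp only: cis_twice_arctan)
    also have "\<dots> = cis (2 * \<phi> N)"
      by (induction N) (simp_all add: \<phi>_def cis_mult distrib_left)
    finally show ?thesis .
  qed
  \<comment> \<open>The terms after the first are bounded by 1 / (3 * 9^n) with n \<ge> 1, whose sum
    is 1 / 24.\<close>
  have tail: "\<bar>\<phi> (Suc N) - arctan (1 / 3)\<bar> \<le> (1 - (1 / 9) ^ N) / 24" for N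
  proof (induction N)
    case (Suc N)
    have "\<bar>arctan (y (Suc N))\<bar> \<le> \<bar>y (Suc N)\<bar>" by (rule abs_arctan_le)
    also have "\<bar>y (Suc N)\<bar> = (1 / 9) ^ Suc N / 3" by (simp add: y_def abs_mult power_abs)
    finally have "\<bar>\<phi> (Suc (Suc N)) - arctan (1 / 3)\<bar> \<le> (1 - (1 / 9) ^ N) / 24 + (1 / 9) ^ Suc N / 3"
      using Suc.IH unfolding \<phi>_def sum.lessThan_Suc[of _ "Suc N"] by linarith
    also have "\<dots> = (1 - (1 / 9) ^ Suc N) / 24" by (simp add: field_simps)
    finally show ?case .
  qed (simp add: \<phi>_def y_def)
  have Re_le: "Re (R (Suc N) ^ 4) \<le> 0" for N
  proof -
    have "(1 - (1 / 9) ^ N) / 24 \<le> (1 / 24 :: real)" by simp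
    with tail[of N] have "\<bar>\<phi> (Suc N) - arctan (1 / 3)\<bar> \<le> 1 / 24" by linarith
    hence "3 / 10 - 1 / 24 \<le> \<phi> (Suc N)" "\<phi> (Suc N) \<le> 1 / 3 + 1 / 24"
      using arctan_third_bounds by linarith+
    \<comment> \<open>The window from 2 to 3 lies between \<pi> / 2 and \<pi>, by the crude bounds 3
      < \<pi> < 4.\<close>
    hence "2 \<le> 8 * \<phi> (Suc N)" "8 * \<phi> (Suc N) \<le> 3" by simp_all
    hence "cos (8 * \<phi> (Suc N)) \<le> cos (pi / 2)"
      using pi_gt3 pi_less_4 by (intro cos_monotone_0_pi_le) auto
    moreover have "R (Suc N) ^ 4 = cis (8 * \<phi> (Suc N))"
      by (simp add: Rcis Complex.DeMoivre)
    ultimately show ?thesis by simp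
  qed
  have "(\<lambda>N. Re (R (Suc N) ^ 4)) \<longlonglongrightarrow> Re (kap s)"
    unfolding kap_krat by (intro tendsto_intros LIMSEQ_Suc[OF R])
  hence "Re (kap s) \<le> 0" by (rule LIMSEQ_le_const2) (use Re_le in blast)
  thus ?thesis by (simp add: s_def)
qed

text \<open>The value is 2 at r = 0 and nonpositive at r = 1 / 3. Positive m are enough, as j
  depends on m only through its square.\<close>

lemma Mfun_imaginary_surj:
  fixes m :: real
  assumes "0 < m" "m < 2"
  obtains r where "0 < r" "r < 1" "Mfun (\<i> * of_real r) = of_real m"
proof -
  define f where "f = (\<lambda>r::real. 2 * Re (krat (\<i> * of_real r) ^ 4))"
  have "f (1 / 3) \<le> m" using Re_kap_third assms by (simp add: f_def kap_krat)
  moreover have "m \<le> f 0" using assms by (simp add: f_def krat_0)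
  moreover have "continuous_on {0..1/3} f"
    unfolding f_def by (intro continuous_intros continuous_on_krat) (auto simp: norm_mult)
  ultimately obtain r where r: "0 \<le> r" "r \<le> 1 / 3" "f r = m" using IVT2'[of f "1 / 3" m 0] by auto
  have "r \<noteq> 0" using r(3) assms by (auto simp: f_def krat_0)
  moreover have "Mfun (\<i> * of_real r) = of_real m"
    using r kap_imaginary[of r] by (simp add: f_def kap_krat)
  ultimately show ?thesis using that[of r] r by simp
qed

section \<open>Values of j on the lines Re \<tau> = 0 and Re \<tau> = 1 / 2\<close>

definition line :: "real \<Rightarrow> real \<Rightarrow> complex" where
  "line c t = of_real c + \<i> * of_real t"

definition mt :: "complex \<Rightarrow> complex" where
  "mt \<tau> = Mfun (cexp (\<tau> / 2))"

lemma cexp_line: "cexp (line 0 t / 2) = of_real (exp (- pi * t))"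
  "cexp (line (1 / 2) t / 2) = \<i> * of_real (exp (- pi * t))"
proof -
  have "2 * of_real pi * \<i> * (line c t / 2) = of_real (- pi * t) + of_real (pi * c) * \<i>" for c
    by (simp add: line_def complex_eq_iff)
  hence e: "cexp (line c t / 2) = of_real (exp (- pi * t)) * cis (pi * c)" for c
    unfolding cexp_def by (simp only: exp_add exp_of_real cis_conv_exp mult.commute)
  show "cexp (line 0 t / 2) = of_real (exp (- pi * t))" unfolding e by simp
  show "cexp (line (1 / 2) t / 2) = \<i> * of_real (exp (- pi * t))" unfolding e by (simp add: mult.commute)
qed

lemma norm_cexp_line: "t > 0 \<Longrightarrow> norm (cexp (line c t / 2)) < 1"
  by (simp add: norm_cexp line_def)

lemma mt_line_real:
  assumes "c = 0 \<or> c = 1 / 2" "t > 0"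
  shows "mt (line c t) \<in> \<real>"
proof -
  have e: "\<bar>exp (- pi * t)\<bar> < 1" using assms by simp
  show ?thesis
    using assms(1) kap_of_real[OF e] kap_imaginary[OF e]
    by (auto simp only: mt_def cexp_line Mfun_def Reals_of_real Reals_add Reals_divide Reals_1)
qed

lemma jm_of_real: "jm (of_real m) = of_real (256 * (m\<^sup>2 - 3) ^ 3 / (m\<^sup>2 - 4))"
  by (simp add: jm_def)

lemma obtain_exp:
  fixes s :: real
  assumes "0 < s" "s < 1"
  obtains t where "t > 0" "s = exp (- pi * t)"
  using assms that[of "- ln s / pi"] by (simp add: divide_neg_pos)

text \<open>In terms of w = m^2 - 3 the equation j = r is the cubic 256 w^3 = r (w - 1). The
  condition w \<noteq> 1 is nonvanishing of the discriminant, and w > - 3 makes m real.\<close>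

lemma jm_line_eqI:
  fixes r w :: real
  assumes w: "w \<noteq> 1" "w > - 3" "256 * w ^ 3 = r * (w - 1)" and mt: "mt (line c t) = of_real (sqrt (w + 3))"
  shows "(mt (line c t))\<^sup>2 \<noteq> 4" "jm (mt (line c t)) = of_real r"
proof -
  define m where "m = sqrt (w + 3)"
  have m2: "m\<^sup>2 = w + 3" using w by (simp add: m_def)
  have "(of_real (m\<^sup>2) :: complex) \<noteq> of_real 4" unfolding of_real_eq_iff m2 using w by simp
  thus "(mt (line c t))\<^sup>2 \<noteq> 4" unfolding mt m_def [symmetric] by simp
  have "256 * (m\<^sup>2 - 3) ^ 3 / (m\<^sup>2 - 4) = r" using w by (simp add: m2 field_simps)
  thus "jm (mt (line c t)) = of_real r" unfolding mt m_def [symmetric] jm_of_real by simp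
qed

lemma jm_rect_surj:
  fixes r :: real
  assumes "r \<ge> 1728"
  obtains t where "t > 0" "(mt (line 0 t))\<^sup>2 \<noteq> 4" "jm (mt (line 0 t)) = of_real r"
proof -
  define f where "f = (\<lambda>w::real. 256 * w ^ 3 - r * (w - 1))"
  \<comment> \<open>Here f (3 / 2) = 864 - r / 2. For w > 1 the quotient 256 w^3 / (w - 1) has its
    minimum 1728 at w = 3 / 2.\<close>
  have "f (3 / 2) \<le> 0" using assms by (simp add: f_def power_divide)
  moreover have "0 \<le> f 1" by (simp add: f_def)
  moreover have "continuous_on {1..3/2} f" unfolding f_def by (intro continuous_intros)
  ultimately obtain w where w: "1 \<le> w" "f w = 0" using IVT2'[of f "3/2" 0 1] by auto
  have "w \<noteq> 1" using w(2) by (auto simp: f_def)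
  hence w1: "w > 1" using w by simp
  have "sqrt 4 < sqrt (w + 3)" using w1 by (intro real_sqrt_less_mono) simp
  hence "sqrt (w + 3) > 2" by simp
  then obtain s where s: "0 < s" "s < 1" "Mfun (of_real s) = of_real (sqrt (w + 3))" by (rule Mfun_real_surj)
  obtain t where t: "t > 0" "s = exp (- pi * t)" using obtain_exp[OF s(1,2)] .
  have "mt (line 0 t) = of_real (sqrt (w + 3))" using s(3) unfolding mt_def cexp_line t(2) .
  from that[OF t(1) jm_line_eqI[OF _ _ _ this]] show ?thesis using w1 w(2) by (simp add: f_def)
qed

lemma jm_rhomb_surj:
  fixes r :: real
  assumes "r < 1728"
  obtains t where "t > 0" "(mt (line (1 / 2) t))\<^sup>2 \<noteq> 4" "jm (mt (line (1 / 2) t)) = of_real r"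
proof -
  define f where "f = (\<lambda>w::real. 256 * w ^ 3 - r * (w - 1))"
  \<comment> \<open>The end point w = - 3 belongs to m = 0 and j = 1728, and f (- 3) = 4 (r -
    1728).\<close>
  have f3: "f (- 3) < 0" using assms by (simp add: f_def)
  moreover have f1: "0 < f 1" by (simp add: f_def)
  moreover have "continuous_on {-3..1} f" unfolding f_def by (intro continuous_intros)
  ultimately obtain w where w: "- 3 \<le> w" "w \<le> 1" "f w = 0" using IVT'[of f "-3" 0 1] by auto
  have "w \<noteq> 1" "w \<noteq> - 3" using w(3) f3 f1 by auto
  hence w1: "w < 1" "w > - 3" using w by simp_all
  have "sqrt (w + 3) < sqrt 4" using w1 by (intro real_sqrt_less_mono) simp
  hence "0 < sqrt (w + 3)" "sqrt (w + 3) < 2" using w1 by simp_all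
  then obtain s where s: "0 < s" "s < 1" "Mfun (\<i> * of_real s) = of_real (sqrt (w + 3))"
    by (rule Mfun_imaginary_surj)
  obtain t where t: "t > 0" "s = exp (- pi * t)" using obtain_exp[OF s(1,2)] .
  have "mt (line (1 / 2) t) = of_real (sqrt (w + 3))" using s(3) unfolding mt_def cexp_line t(2) .
  from that[OF t(1) jm_line_eqI[OF _ _ _ this]] show ?thesis using w1 w(3) by (simp add: f_def)
qed

lemma jm_line_nearby:
  assumes "t0 > 0" "(mt (line c t0))\<^sup>2 \<noteq> 4" "e > 0"
  obtains d where "d > 0" "\<And>t. \<bar>t - t0\<bar> < d \<Longrightarrow> t > 0 \<and> (mt (line c t))\<^sup>2 \<noteq> 4 \<and> dist (jm (mt (line c t))) (jm (mt (line c t0))) < e"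
proof -
  have "continuous_on {0<..} (\<lambda>t. mt (line c t))"
    unfolding mt_def
    by (intro continuous_on_Mfun) (auto simp: norm_cexp_line line_def cexp_def intro!: continuous_intros)
  hence "isCont (\<lambda>t. mt (line c t)) t0"
    using assms(1) by (simp add: continuous_on_eq_continuous_at)
  hence m: "((\<lambda>t. mt (line c t)) \<longlongrightarrow> mt (line c t0)) (nhds t0)"
    using tendsto_at_iff_tendsto_nhds[of "\<lambda>t. mt (line c t)" t0] by (simp add: isCont_def)
  have "((\<lambda>t. (mt (line c t))\<^sup>2) \<longlongrightarrow> (mt (line c t0))\<^sup>2) (nhds t0)" by (intro tendsto_intros m)
  hence "\<forall>\<^sub>F t in nhds t0. (mt (line c t))\<^sup>2 \<noteq> 4" by (rule tendsto_imp_eventually_ne) (rule assms)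
  moreover have "((\<lambda>t. jm (mt (line c t))) \<longlongrightarrow> jm (mt (line c t0))) (nhds t0)"
    unfolding jm_def by (intro tendsto_intros m) (use assms in auto)
  hence "\<forall>\<^sub>F t in nhds t0. dist (jm (mt (line c t))) (jm (mt (line c t0))) < e"
    using assms(3) by (rule tendstoD)
  moreover have "\<forall>\<^sub>F t in nhds t0. t \<in> {0<..}"
    using assms(1) by (intro eventually_nhds_in_open) auto
  ultimately have "\<forall>\<^sub>F t in nhds t0. t > 0 \<and> (mt (line c t))\<^sup>2 \<noteq> 4 \<and> dist (jm (mt (line c t))) (jm (mt (line c t0))) < e"
    by eventually_elim auto
  then obtain d where "d > 0" "\<And>t. dist t t0 < d \<Longrightarrow> t > 0 \<and> (mt (line c t))\<^sup>2 \<noteq> 4 \<and> dist (jm (mt (line c t))) (jm (mt (line c t0))) < e"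
    unfolding eventually_nhds_metric by blast
  thus ?thesis using that[of d] unfolding dist_real_def by blast
qed

text \<open>Odd numerators are 2 apart, so for every odd q some odd p brings p c / q within c / q of
  t. Odd p and q have squares 1 mod 4, which controls the parities in the quadratic equations to
  come.\<close>

lemma odd_fractions_dense:
  fixes c t e :: real
  assumes "c > 0" "t > 0" "e > 0"
  obtains p q :: int where "p > 0" "q > 0" "odd p" "odd q" "\<bar>of_int p / of_int q * c - t\<bar> < e"
proof -
  obtain n :: nat where n: "c / e < real n" using reals_Archimedean2 by blast
  define q where "q = 2 * int n + 1"
  have q: "q > 0" "odd q" by (simp_all add: q_def)
  have "c / e < of_int q" using n by (simp add: q_def)
  hence cq: "c / of_int q < e" using q assms by (simp add: field_simps)
  define X where "X = t * of_int q / c"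
  have X: "X > 0" using assms q by (simp add: X_def)
  define p where "p = 2 * \<lfloor>X / 2\<rfloor> + 1"
  have p: "p > 0" "odd p" using X by (simp_all add: p_def add_nonneg_pos)
  have "\<bar>of_int p - X\<bar> \<le> 1" unfolding p_def by linarith
  have "of_int p / of_int q * c - t = (of_int p - X) * (c / of_int q)"
    using assms q by (simp add: X_def field_simps)
  hence "\<bar>of_int p / of_int q * c - t\<bar> = \<bar>of_int p - X\<bar> * (c / of_int q)"
    using assms q by (simp add: abs_mult)
  also have "\<dots> \<le> 1 * (c / of_int q)" using \<open>\<bar>of_int p - X\<bar> \<le> 1\<close> assms q by (intro mult_right_mono) auto
  finally have "\<bar>of_int p / of_int q * c - t\<bar> < e" using cq by simp
  thus ?thesis using that p q by blast
qed

section \<open>Density\<close>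

lemma uniformized_half_plane: "uniformized E \<tau> \<Longrightarrow> half_plane \<tau>"
  by (auto simp: uniformized_def uniformization_def even_elliptic_def)

lemma half_plane_line: "t > 0 \<Longrightarrow> half_plane (line c t)"
  by (simp add: half_plane_def line_def)

lemma uniformized_line:
  assumes "t > 0" "elliptic_curve E" "(mt (line c t))\<^sup>2 \<noteq> 4" "j_inv E = jm (mt (line c t))"
  shows "uniformized E (line c t)"
  using half_plane.uniformized_exists[OF half_plane_line[OF assms(1)] assms(2)] assms(3,4) by (simp add: mt_def)

lemma has_CM_quadratic:
  assumes "uniformized E \<tau>" "has_CM E"
  obtains A B C :: int where "A \<noteq> 0" "gcd A (gcd B C) = 1"
    "of_int A * \<tau>\<^sup>2 + of_int B * \<tau> + of_int C = 0"
proof -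
  obtain x L y \<delta> where "uniformization \<tau> x L E y \<delta>" using assms(1) by (auto simp: uniformized_def)
  then interpret uniformization \<tau> x L E y \<delta> .
  obtain \<alpha> where \<alpha>: "\<alpha> \<in> mults" "\<And>n::int. \<alpha> \<noteq> of_int n" using has_CM_nonint[OF assms(2)] by blast
  show ?thesis by (rule mults_nonint_quadratic[OF \<alpha>]) (rule that)
qed

lemma odd_curve_primitive:
  assumes "uniformized E \<tau>" "A \<noteq> 0" "gcd A (gcd B C) = 1"
    "of_int A * \<tau>\<^sup>2 + of_int B * \<tau> + of_int C = 0"
  shows "odd_curve E \<longleftrightarrow> odd B"
proof -
  obtain x L y \<delta> where "uniformization \<tau> x L E y \<delta>" using assms(1) by (auto simp: uniformized_def)
  then interpret uniformization \<tau> x L E y \<delta> .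
  show ?thesis by (rule odd_curve_iff[OF assms(2-4)])
qed

text \<open>The equation need not be primitive; the condition on \<open>B\<close> and \<open>C\<close> ensures that division by its content
  preserves the parity of \<open>B\<close>.\<close>

lemma odd_curve_quadratic:
  assumes u: "uniformized E \<tau>" and A: "A \<noteq> 0"
    and quad: "of_int A * \<tau>\<^sup>2 + of_int B * \<tau> + of_int C = 0"
    and par: "odd B \<or> odd C \<or> B = 0"
  shows "odd_curve E \<longleftrightarrow> odd B"
proof -
  obtain g A' B' C' where 1: "A' \<noteq> 0" "gcd A' (gcd B' C') = 1"
    "of_int A' * \<tau>\<^sup>2 + of_int B' * \<tau> + of_int C' = 0" and g0: "g \<noteq> 0" and ABC: "A = g * A'" "B = g * B'" "C = g * C'"
    by (rule primitive_quadratic[OF A quad])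
  have "odd_curve E \<longleftrightarrow> odd B'" by (rule odd_curve_primitive[OF u 1])
  also have "\<dots> \<longleftrightarrow> odd B" using par g0 unfolding ABC by auto
  finally show ?thesis .
qed

lemma isogenous_lattice_iff:
  assumes "uniformized E \<tau>" "uniformized E' \<tau>'"
  shows "isogenous E E' \<longleftrightarrow> (\<exists>\<alpha>. \<alpha> \<noteq> 0 \<and> (\<forall>w\<in>lat \<tau>. \<alpha> * w \<in> lat \<tau>'))"
proof -
  obtain x L y \<delta> where "uniformization \<tau> x L E y \<delta>" using assms(1) by (auto simp: uniformized_def)
  moreover obtain x' L' y' \<delta>' where "uniformization \<tau>' x' L' E' y' \<delta>'" using assms(2) by (auto simp: uniformized_def)
  ultimately interpret unif_pair \<tau> x L E y \<delta> \<tau>' x' L' E' y' \<delta>' by (rule unif_pair.intro)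
  show ?thesis by (rule isogenous_iff)
qed

lemma isogenousI:
  fixes d a b :: int
  assumes u: "uniformized E \<tau>" "uniformized E' \<tau>'" and d: "d \<noteq> 0"
    and eq: "of_int d * \<tau> = of_int a + of_int b * \<tau>'"
  shows "isogenous E E'"
  unfolding isogenous_lattice_iff[OF u]
proof (intro exI[of _ "of_int d"] conjI ballI)
  show "of_int d \<noteq> (0 :: complex)" using d by simp
  fix w assume "w \<in> lat \<tau>"
  then obtain m n where w: "w = of_int m + of_int n * \<tau>" by (auto simp: lat_def)
  have "of_int d * w = of_int d * of_int m + of_int n * (of_int d * \<tau>)" by (simp add: w algebra_simps)
  also have "\<dots> = of_int (d * m + n * a) + of_int (n * b) * \<tau>'" unfolding eq by (simp add: algebra_simps)
  finally show "of_int d * w \<in> lat \<tau>'" unfolding lat_def by blast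
qed

text \<open>The matrix of \<alpha> in the two lattice bases has determinant n, and its adjugate
  shows that n times the second lattice lies in \<alpha> times the first. So n \<beta> is a
  multiplier of the first lattice for every multiplier \<beta> of the second.\<close>

lemma isogenous_CM_quadratic:
  assumes u: "uniformized E \<tau>" "uniformized E' \<tau>'" and iso: "isogenous E E'" and cm: "has_CM E'"
  obtains A B C :: int where "A \<noteq> 0" "gcd A (gcd B C) = 1"
    "of_int A * \<tau>\<^sup>2 + of_int B * \<tau> + of_int C = 0"
proof -
  interpret T: half_plane \<tau> by (rule uniformized_half_plane[OF u(1)])
  interpret T': half_plane \<tau>' by (rule uniformized_half_plane[OF u(2)])
  obtain x' L' y' \<delta>' where "uniformization \<tau>' x' L' E' y' \<delta>'" using u(2) by (auto simp: uniformized_def)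
  from uniformization.has_CM_nonint[OF this cm]
  obtain \<beta> where \<beta>: "\<beta> \<in> T'.mults" "\<And>n::int. \<beta> \<noteq> of_int n" by blast
  obtain \<alpha> where \<alpha>: "\<alpha> \<noteq> 0" "\<And>w. w \<in> lat \<tau> \<Longrightarrow> \<alpha> * w \<in> lat \<tau>'"
    using iso unfolding isogenous_lattice_iff[OF u] by blast
  have "\<alpha> * 1 \<in> lat \<tau>'" "\<alpha> * \<tau> \<in> lat \<tau>'" by (rule \<alpha>(2), simp)+
  then obtain a b c d where ab: "\<alpha> = of_int a + of_int b * \<tau>'" and cd: "\<alpha> * \<tau> = of_int c + of_int d * \<tau>'"
    unfolding T'.lat_iff mult_1_right by blast
  define n where "n = a * d - b * c"
  have n1: "of_int n = \<alpha> * (of_int d - of_int b * \<tau>)"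
  proof -
    have "\<alpha> * (of_int d - of_int b * \<tau>) = of_int d * \<alpha> - of_int b * (\<alpha> * \<tau>)" by (simp add: algebra_simps)
    also have "\<dots> = of_int n" unfolding cd unfolding ab n_def by (simp add: algebra_simps)
    finally show ?thesis ..
  qed
  have n2: "of_int n * \<tau>' = \<alpha> * (of_int a * \<tau> - of_int c)"
  proof -
    have "\<alpha> * (of_int a * \<tau> - of_int c) = of_int a * (\<alpha> * \<tau>) - of_int c * \<alpha>" by (simp add: algebra_simps)
    also have "\<dots> = of_int n * \<tau>'" unfolding cd unfolding ab n_def by (simp add: algebra_simps)
    finally show ?thesis ..
  qed
  have n0: "n \<noteq> 0"
  proof
    assume "n = 0"
    hence "of_int d - of_int b * \<tau> = 0" using n1 \<alpha>(1) by simp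
    hence "Im (of_int d - of_int b * \<tau>) = 0" "Re (of_int d - of_int b * \<tau>) = 0" by (simp_all only: zero_complex.sel)
    hence bd: "b = 0" "d = 0" using T.Im_pos by auto
    hence "of_int a * \<tau> = of_int c" using ab cd by simp
    hence "Im (of_int a * \<tau>) = Im (of_int c)" by (simp only:)
    hence "a = 0" using T.Im_pos by simp
    with bd ab \<alpha>(1) show False by simp
  qed
  have sub: "\<exists>v\<in>lat \<tau>. of_int n * w = \<alpha> * v" if wl: "w \<in> lat \<tau>'" for w
  proof -
    obtain p r where w: "w = of_int p + of_int r * \<tau>'" using wl by (auto simp: T'.lat_iff)
    have "of_int n * w = of_int p * of_int n + of_int r * (of_int n * \<tau>')" by (simp add: w algebra_simps)
    also have "\<dots> = of_int p * (\<alpha> * (of_int d - of_int b * \<tau>)) + of_int r * (\<alpha> * (of_int a * \<tau> - of_int c))"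
      by (simp only: n1 [symmetric] n2 [symmetric])
    also have "\<dots> = \<alpha> * (of_int (p * d - r * c) + of_int (r * a - p * b) * \<tau>)"
      by (simp add: algebra_simps)
    finally show ?thesis by (rule bexI) (unfold T.lat_iff, intro exI, rule refl)
  qed
  have "of_int n * \<beta> \<in> T.mults"
    unfolding T.mults_def
  proof safe
    fix w assume "w \<in> lat \<tau>"
    hence "\<beta> * (\<alpha> * w) \<in> lat \<tau>'" using \<alpha>(2) T'.multsD[OF \<beta>(1)] by blast
    then obtain v where v: "v \<in> lat \<tau>" "of_int n * (\<beta> * (\<alpha> * w)) = \<alpha> * v" using sub by blast
    have "\<alpha> * (of_int n * \<beta> * w) = \<alpha> * v" using v(2) by (simp add: mult_ac)
    hence "of_int n * \<beta> * w = v" using \<alpha>(1) by simp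
    thus "of_int n * \<beta> * w \<in> lat \<tau>" using v(1) by simp
  qed
  moreover have "of_int n * \<beta> \<noteq> of_int k" for k :: int
  proof
    assume k: "of_int n * \<beta> = of_int k"
    obtain p r where pr: "\<beta> = of_int p + of_int r * \<tau>'"
      using \<beta>(1) by (auto simp: T'.mults_iff T'.lat_iff)
    have "Im (of_int n * \<beta>) = 0" unfolding k by simp
    hence "r = 0" using n0 T'.Im_pos by (simp add: pr)
    with pr \<beta>(2)[of p] show False by simp
  qed
  ultimately show ?thesis by (rule T.mults_nonint_quadratic) (rule that)
qed

text \<open>Completing the square: 2 A \<tau> + B has the real square B^2 - 4 A C and nonzero
  imaginary part, so it is purely imaginary. A sign makes v positive.\<close>

lemma imaginary_quadratic_sqrt:
  fixes A B C :: int
  assumes Im: "Im \<tau> > 0" and A: "A \<noteq> 0" and quad: "of_int A * \<tau>\<^sup>2 + of_int B * \<tau> + of_int C = 0"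
  obtains v :: real and a b :: int where "v > 0" "\<i> * of_real v = of_int a + of_int b * \<tau>" "v\<^sup>2 = of_int (4 * A * C - B\<^sup>2)"
proof -
  define w where "w = of_int (2 * A) * \<tau> + of_int B"
  have "w\<^sup>2 = 4 * of_int A * (of_int A * \<tau>\<^sup>2 + of_int B * \<tau> + of_int C) + of_int (B\<^sup>2 - 4 * A * C)"
    by (simp add: w_def algebra_simps power2_eq_square)
  hence w2: "w\<^sup>2 = of_int (B\<^sup>2 - 4 * A * C)" unfolding quad by simp
  have Imw: "Im w \<noteq> 0" using A Im by (simp add: w_def)
  have "Im (w\<^sup>2) = 0" unfolding w2 by simp
  hence Rew: "Re w = 0" using Imw by (simp add: power2_eq_square)
  have "Re (w\<^sup>2) = of_int (B\<^sup>2 - 4 * A * C)" unfolding w2 by simp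
  hence v2: "(Im w)\<^sup>2 = of_int (4 * A * C - B\<^sup>2)" using Rew by (simp add: power2_eq_square)
  have wi: "w = \<i> * of_real (Im w)" using Rew by (simp add: complex_eq_iff)
  show ?thesis
  proof (cases "Im w > 0")
    case True
    have "\<i> * of_real (Im w) = of_int B + of_int (2 * A) * \<tau>" unfolding wi [symmetric] by (simp add: w_def)
    from that[OF True this v2] show ?thesis .
  next
    case False
    hence "- Im w > 0" using Imw by simp
    moreover have "\<i> * of_real (- Im w) = - w" by (subst (2) wi) simp
    hence "\<i> * of_real (- Im w) = of_int (- B) + of_int (- (2 * A)) * \<tau>" by (simp add: w_def)
    moreover have "(- Im w)\<^sup>2 = of_int (4 * A * C - B\<^sup>2)" using v2 by simp
    ultimately show ?thesis by (rule that)
  qed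
qed

text \<open>Isolates the arithmetic from the analysis: the linear relation yields an isogeny, and
  the quadratic equation, primitive or not, reveals the parity.\<close>

definition same_parity_point :: "weierstrass \<Rightarrow> complex \<Rightarrow> complex \<Rightarrow> bool" where
  "same_parity_point E \<tau> \<sigma> \<longleftrightarrow> (\<exists>d a b A B C :: int. d \<noteq> 0 \<and> of_int d * \<sigma> = of_int a + of_int b * \<tau> \<and>
     A \<noteq> 0 \<and> of_int A * \<sigma>\<^sup>2 + of_int B * \<sigma> + of_int C = 0 \<and> (odd B \<or> odd C \<or> B = 0) \<and> (odd B \<longleftrightarrow> odd_curve E))"

lemma same_parity_pointD:
  assumes "same_parity_point E \<tau> \<sigma>" and F: "uniformized F \<sigma>" and E: "uniformized E \<tau>"
  shows "isogenous F E" "odd_curve F \<longleftrightarrow> odd_curve E"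
proof -
  obtain d a b A B C :: int where 1: "d \<noteq> 0" "of_int d * \<sigma> = of_int a + of_int b * \<tau>"
    and 2: "A \<noteq> 0" "of_int A * \<sigma>\<^sup>2 + of_int B * \<sigma> + of_int C = 0" "odd B \<or> odd C \<or> B = 0"
    and 3: "odd B \<longleftrightarrow> odd_curve E"
    using assms(1) unfolding same_parity_point_def by blast
  show "isogenous F E" by (rule isogenousI[OF F E 1])
  show "odd_curve F \<longleftrightarrow> odd_curve E" using odd_curve_quadratic[OF F 2] 3 by (rule trans)
qed

lemma same_parity_pointI:
  fixes d a b A B C :: int
  assumes "of_int d * \<sigma> = of_int a + of_int b * \<tau>" "of_int A * \<sigma>\<^sup>2 + of_int B * \<sigma> + of_int C = 0"
    "d \<noteq> 0" "A \<noteq> 0" "odd B \<or> odd C \<or> B = 0" "odd B \<longleftrightarrow> odd_curve E"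
  shows "same_parity_point E \<tau> \<sigma>"
  using assms unfolding same_parity_point_def by blast

text \<open>On these lines j is real and continuous, so t may be moved to a nearby k p / q, and
  \<open>mcurve\<close> provides a curve there. The unit k is left open because each parity needs
  its own.\<close>

lemma real_j_dense:
  assumes c: "c = 0 \<or> c = 1 / 2" and t: "t > 0" "(mt (line c t))\<^sup>2 \<noteq> 4" "jm (mt (line c t)) = of_real r"
    and k: "k > 0"
    and u: "uniformized E \<tau>"
    and arith: "\<And>p q \<sigma>. p > 0 \<Longrightarrow> q > 0 \<Longrightarrow> odd p \<Longrightarrow> odd q \<Longrightarrow> \<sigma> = line c (of_int p / of_int q * k) \<Longrightarrow>
       same_parity_point E \<tau> \<sigma>"
  shows "r \<in> closure (real_j_set E)"
  unfolding closure_approachable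
proof safe
  fix e :: real assume "e > 0"
  from jm_line_nearby[OF t(1,2) this]
  obtain d where d: "d > 0" "\<And>t'. \<bar>t' - t\<bar> < d \<Longrightarrow> t' > 0 \<and> (mt (line c t'))\<^sup>2 \<noteq> 4 \<and>
      dist (jm (mt (line c t'))) (jm (mt (line c t))) < e" by blast
  obtain p q :: int where pq: "p > 0" "q > 0" "odd p" "odd q" "\<bar>of_int p / of_int q * k - t\<bar> < d"
    using odd_fractions_dense[OF k t(1) d(1)] by blast
  define t' where "t' = of_int p / of_int q * k"
  have t': "t' > 0" "(mt (line c t'))\<^sup>2 \<noteq> 4" "dist (jm (mt (line c t'))) (jm (mt (line c t))) < e"
    using d(2)[of t'] pq(5) by (simp_all add: t'_def)
  obtain m where m: "mt (line c t') = of_real m" using mt_line_real[OF c t'(1)] by (auto elim: Reals_cases)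
  define r' where "r' = 256 * (m\<^sup>2 - 3) ^ 3 / (m\<^sup>2 - 4)"
  have r': "jm (mt (line c t')) = of_real r'" unfolding m jm_of_real r'_def ..
  define F where "F = mcurve (mt (line c t'))"
  have F: "elliptic_curve F" "j_inv F = jm (mt (line c t'))"
    unfolding F_def using t'(2) by (rule elliptic_mcurve, rule j_inv_mcurve)
  have uF: "uniformized F (line c t')" by (rule uniformized_line[OF t'(1) F(1) t'(2) F(2)])
  have "line c t' = line c (of_int p / of_int q * k)" by (simp only: t'_def)
  from arith[OF pq(1-4) this] have "same_parity_point E \<tau> (line c t')" .
  from same_parity_pointD[OF this uF u] have "r' \<in> real_j_set E" using F r' by (auto simp: real_j_set_def)
  moreover have "dist r' r < e" using t'(3) unfolding r' t(3) by (simp add: dist_of_real)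
  ultimately show "\<exists>y\<in>real_j_set E. dist y r < e" by blast
qed

theorem theorem2p4:
  fixes E :: weierstrass
  assumes "elliptic_curve E" and "has_CM E" and "j_inv E \<in> \<real>"
  shows "(odd_curve E \<longrightarrow> closure (real_j_set E) = {..1728}) \<and>
         (even_curve E \<longrightarrow> closure (real_j_set E) = UNIV)"
proof -
  obtain r0 where r0: "j_inv E = of_real r0" using assms(3) by (auto elim: Reals_cases)
  \<comment> \<open>Reality of j alone puts a period ratio of E on one of the two lines.\<close>
  have "\<exists>c t. t > 0 \<and> uniformized E (line c t)"
  proof (cases "r0 < 1728")
    case True
    obtain t where "t > 0" "(mt (line (1 / 2) t))\<^sup>2 \<noteq> 4" "jm (mt (line (1 / 2) t)) = of_real r0"
      using jm_rhomb_surj[OF True] .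
    thus ?thesis using uniformized_line[of t E "1 / 2"] assms(1) r0 by auto
  next
    case False
    then obtain t where "t > 0" "(mt (line 0 t))\<^sup>2 \<noteq> 4" "jm (mt (line 0 t)) = of_real r0"
      using jm_rect_surj[of r0] by auto
    thus ?thesis using uniformized_line[of t E 0] assms(1) r0 by auto
  qed
  then obtain \<tau> where \<tau>: "uniformized E \<tau>" by blast
  interpret half_plane \<tau> by (rule uniformized_half_plane[OF \<tau>])
  obtain A B C :: int where ABC: "A \<noteq> 0" "gcd A (gcd B C) = 1" "of_int A * \<tau>\<^sup>2 + of_int B * \<tau> + of_int C = 0"
    using has_CM_quadratic[OF \<tau> assms(2)] .
  have parity_E: "odd_curve E \<longleftrightarrow> odd B" by (rule odd_curve_primitive[OF \<tau> ABC])
  define N where "N = 4 * A * C - B\<^sup>2"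
  obtain v a b where v: "v > 0" "\<i> * of_real v = of_int a + of_int b * \<tau>" "v\<^sup>2 = of_int N"
    using imaginary_quadratic_sqrt[OF Im_pos ABC(1,3)] unfolding N_def .
  have upper: "real_j_set E \<subseteq> {..1728}" if odd: "odd_curve E"
  proof
    fix r assume "r \<in> real_j_set E"
    then obtain F where F: "elliptic_curve F" "isogenous F E" "j_inv F = of_real r" "odd_curve F"
      using odd by (auto simp: real_j_set_def)
    show "r \<in> {..1728}"
    proof (rule ccontr)
      assume "r \<notin> {..1728}"
      then obtain t where t: "t > 0" "(mt (line 0 t))\<^sup>2 \<noteq> 4" "jm (mt (line 0 t)) = of_real r"
        using jm_rect_surj[of r] by auto
      have uF: "uniformized F (line 0 t)" using uniformized_line[OF t(1) F(1) t(2)] F(3) t(3) by simp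
      obtain A' B' C' :: int where ABC': "A' \<noteq> 0" "gcd A' (gcd B' C') = 1"
          "of_int A' * (line 0 t)\<^sup>2 + of_int B' * line 0 t + of_int C' = 0"
        using isogenous_CM_quadratic[OF uF \<tau> F(2) assms(2)] .
      \<comment> \<open>For purely imaginary argument only the middle term has an imaginary part,
        namely B' t.\<close>
      have "Im (of_int A' * (line 0 t)\<^sup>2 + of_int B' * line 0 t + of_int C') = 0" unfolding ABC'(3) by simp
      hence "B' = 0" using t(1) by (simp add: line_def power2_eq_square)
      moreover have "odd B'" using odd_curve_primitive[OF uF ABC'] F(4) by simp
      ultimately show False by simp
    qed
  qed
  have dense_half_odd: "r \<in> closure (real_j_set E)" if odd: "odd_curve E" and r: "r < 1728" for r
  proof -
    obtain t where t: "t > 0" "(mt (line (1 / 2) t))\<^sup>2 \<noteq> 4" "jm (mt (line (1 / 2) t)) = of_real r"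
      using jm_rhomb_surj[OF r] .
    \<comment> \<open>With the unit v / 2 the point \<sigma> has trace 1 and norm (q^2 + p^2 N) / (4
      q^2). Scaled by q^2, its equation has the odd middle coefficient - q^2, and its constant term
      is an integer if 4 divides q^2 + p^2 N.\<close>
    show ?thesis
    proof (rule real_j_dense[OF _ t _ \<tau>, of "v / 2"])
      fix p q :: int and \<sigma>
      assume pq: "p > 0" "q > 0" "odd p" "odd q" and \<sigma>: "\<sigma> = line (1 / 2) (of_int p / of_int q * (v / 2))"
      have "odd B" using odd parity_E by simp
      \<comment> \<open>As B is odd, N = 3 mod 4, and the sum is 1 + 3 = 0 mod 4.\<close>
      have "4 dvd q\<^sup>2 + p\<^sup>2 * N"
      proof -
        from \<open>odd B\<close> \<open>odd p\<close> \<open>odd q\<close> obtain i j l where "B = 2 * i + 1" "p = 2 * j + 1" "q = 2 * l + 1"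
          by (auto elim!: oddE)
        hence "q\<^sup>2 + p\<^sup>2 * N = 4 * (l\<^sup>2 + l + p\<^sup>2 * A * C - p\<^sup>2 * (i\<^sup>2 + i) - j\<^sup>2 - j)"
          by (simp add: N_def power2_eq_square algebra_simps)
        thus ?thesis by simp
      qed
      then obtain K where K: "q\<^sup>2 + p\<^sup>2 * N = 4 * K" ..
      have "of_int (2 * q) * \<sigma> = of_int q + of_int p * (\<i> * of_real v)"
        using pq by (simp add: \<sigma> line_def field_simps)
      also have "\<dots> = of_int (q + p * a) + of_int (p * b) * \<tau>" unfolding v(2) by (simp add: algebra_simps)
      finally have eq: "of_int (2 * q) * \<sigma> = of_int (q + p * a) + of_int (p * b) * \<tau>" .
      have "of_int (4 * K) = (of_int (q\<^sup>2) + of_int (p\<^sup>2) * of_real (v\<^sup>2) :: complex)"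
        unfolding K [symmetric] v(3) by simp
      note K' = this
      have "of_int (q\<^sup>2) * (\<sigma>\<^sup>2 - \<sigma>) = - (of_int (q\<^sup>2) + of_int (p\<^sup>2) * of_real (v\<^sup>2)) / 4"
        using pq by (simp add: \<sigma> line_def field_simps power2_eq_square)
      also have "\<dots> = - of_int K" unfolding K' [symmetric] by simp
      finally have "of_int (q\<^sup>2) * (\<sigma>\<^sup>2 - \<sigma>) = - of_int K" .
      hence quad: "of_int (q\<^sup>2) * \<sigma>\<^sup>2 + of_int (- (q\<^sup>2)) * \<sigma> + of_int K = 0" by (simp add: algebra_simps)
      from eq quad show "same_parity_point E \<tau> \<sigma>" by (rule same_parity_pointI) (use pq odd in auto)
    qed (use v in auto)
  qed
  have dense_half_even: "r \<in> closure (real_j_set E)" if even: "\<not> odd_curve E" and r: "r < 1728" for r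
  proof -
    obtain t where t: "t > 0" "(mt (line (1 / 2) t))\<^sup>2 \<noteq> 4" "jm (mt (line (1 / 2) t)) = of_real r"
      using jm_rhomb_surj[OF r] .
    \<comment> \<open>With the unit v the constant term q^2 + 4 p^2 N is odd and the middle
      coefficient - 4 q^2 even. The content is then odd, so the primitive equation also has an even
      middle coefficient.\<close>
    show ?thesis
    proof (rule real_j_dense[OF _ t _ \<tau>, of v])
      fix p q :: int and \<sigma>
      assume pq: "p > 0" "q > 0" "odd p" "odd q" and \<sigma>: "\<sigma> = line (1 / 2) (of_int p / of_int q * v)"
      have "of_int (2 * q) * \<sigma> = of_int q + of_int (2 * p) * (\<i> * of_real v)"
        using pq by (simp add: \<sigma> line_def field_simps)
      also have "\<dots> = of_int (q + 2 * p * a) + of_int (2 * p * b) * \<tau>" unfolding v(2) by (simp add: algebra_simps)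
      finally have eq: "of_int (2 * q) * \<sigma> = of_int (q + 2 * p * a) + of_int (2 * p * b) * \<tau>" .
      have "of_int (4 * q\<^sup>2) * (\<sigma>\<^sup>2 - \<sigma>) = - (of_int (q\<^sup>2) + 4 * of_int (p\<^sup>2) * of_real (v\<^sup>2))"
        using pq by (simp add: \<sigma> line_def field_simps power2_eq_square)
      also have "\<dots> = - of_int (q\<^sup>2 + 4 * p\<^sup>2 * N)" unfolding v(3) by simp
      finally have "of_int (4 * q\<^sup>2) * (\<sigma>\<^sup>2 - \<sigma>) = - of_int (q\<^sup>2 + 4 * p\<^sup>2 * N)" .
      hence quad: "of_int (4 * q\<^sup>2) * \<sigma>\<^sup>2 + of_int (- (4 * q\<^sup>2)) * \<sigma> + of_int (q\<^sup>2 + 4 * p\<^sup>2 * N) = 0"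
        by (simp add: algebra_simps)
      from eq quad show "same_parity_point E \<tau> \<sigma>" by (rule same_parity_pointI) (use pq even in auto)
    qed (use v in auto)
  qed
  have dense_zero_even: "r \<in> closure (real_j_set E)" if even: "\<not> odd_curve E" and r: "r \<ge> 1728" for r
  proof -
    obtain t where t: "t > 0" "(mt (line 0 t))\<^sup>2 \<noteq> 4" "jm (mt (line 0 t)) = of_real r"
      using jm_rect_surj[OF r] .
    \<comment> \<open>Here \<sigma> has trace 0, so the middle coefficient is 0 and remains so after
      division by the content.\<close>
    show ?thesis
    proof (rule real_j_dense[OF _ t _ \<tau>, of v])
      fix p q :: int and \<sigma>
      assume pq: "p > 0" "q > 0" "odd p" "odd q" and \<sigma>: "\<sigma> = line 0 (of_int p / of_int q * v)"
      have "of_int q * \<sigma> = of_int p * (\<i> * of_real v)"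
        using pq by (simp add: \<sigma> line_def field_simps)
      also have "\<dots> = of_int (p * a) + of_int (p * b) * \<tau>" unfolding v(2) by (simp add: algebra_simps)
      finally have eq: "of_int q * \<sigma> = of_int (p * a) + of_int (p * b) * \<tau>" .
      have "of_int (q\<^sup>2) * \<sigma>\<^sup>2 = - (of_int (p\<^sup>2) * of_real (v\<^sup>2))"
        using pq by (simp add: \<sigma> line_def field_simps power2_eq_square)
      also have "\<dots> = - of_int (p\<^sup>2 * N)" unfolding v(3) by simp
      finally have quad: "of_int (q\<^sup>2) * \<sigma>\<^sup>2 + of_int 0 * \<sigma> + of_int (p\<^sup>2 * N) = 0" by simp
      from eq quad show "same_parity_point E \<tau> \<sigma>" by (rule same_parity_pointI) (use pq even in auto)
    qed (use v in auto)
  qed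
  have ee: "even_curve E \<longleftrightarrow> \<not> odd_curve E" by (simp add: even_curve_def odd_curve_def)
  show ?thesis
  proof (intro conjI impI)
    assume odd: "odd_curve E"
    show "closure (real_j_set E) = {..1728}"
    proof (rule antisym)
      show "closure (real_j_set E) \<subseteq> {..1728}" by (rule closure_minimal[OF upper[OF odd] closed_atMost])
      \<comment> \<open>The density argument reaches r < 1728; the end point enters by closing the
        open half-line.\<close>
      have "{..<1728} \<subseteq> closure (real_j_set E)" using dense_half_odd[OF odd] by auto
      hence "closure {..<1728} \<subseteq> closure (real_j_set E)" by (rule closure_minimal[OF _ closed_closure])
      thus "{..1728} \<subseteq> closure (real_j_set E)" by simp
    qed
  next
    assume "even_curve E"
    hence even: "\<not> odd_curve E" by (simp add: ee)
    have "r \<in> closure (real_j_set E)" for r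
      using dense_half_even[OF even, of r] dense_zero_even[OF even, of r] by linarith
    thus "closure (real_j_set E) = UNIV" by blast
  qed
qed

end
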